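(* Let $k\in\mathbb{N}$. Let $(\varphi_\varepsilon)_{\varepsilon>0}\subset L^1(\Omega)$ with $|\varphi_\varepsilon|\le1$ a.e. in $\Omega$, and let $\varphi\in BV(\Omega,\{\pm1\})\cap\mathcal{U}$ (such that $E^\varphi=\{x\in\Omega:\varphi(x)=1\}$ contains an open ball) satisfy $$\lim_{\varepsilon\searrow0}\|\varphi_\varepsilon-\varphi\|_{L^1(\Omega)}=0\qquad\text{with the rate}\qquad \|\varphi_\varepsilon-\varphi\|_{L^1(E^\varphi\cap\{\varphi_\varepsilon<0\})}=\mathcal{O}(\varepsilon).$$ Let $w_k^{\varphi_\varepsilon}$ denote the $L^2(\Omega)$-normalized eigenfunctions to the eigenvalues $\lambda_k^{\varepsilon,\varphi_\varepsilon}$ of the diffuse interface problem. Then there exists an eigenfunction $u_k\in V^\varphi$ of the limit problem to the eigenvalue $\lambda_k^{0,\varphi}$ such that, up to subsequence extraction, $$\lim_{\varepsilon\searrow0}\int_\Omega b_\varepsilon(\varphi_\varepsilon)|w_k^{\varphi_\varepsilon}|^2\,dx=\int_\Omega b_0(\varphi)|u_k|^2\,dx=0,$$ $$\lim_{\varepsilon\searrow0}\|w_k^{\varphi_\varepsilon}-u_k\|_{H^1(\Omega)}=0,\qquad \lim_{\varepsilon\searrow0}\lambda_k^{\varepsilon,\varphi_\varepsilon}=\lambda_k^{0,\varphi}.$$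
   Context: Setting. $\Omega\subset\mathbb{R}^d$, $d\ge2$, is a bounded Lipschitz domain. $S_0,S_1\subset\Omega$ are disjoint sets of finite perimeter in $\Omega$ such that $\tilde\Omega:=\Omega\setminus(S_0\cup S_1)$ is a domain with Lipschitz boundary. $\mathcal{U}=\{\varphi\in L^1(\Omega):\varphi=-1\text{ a.e. on }S_0,\ \varphi=1\text{ a.e. on }S_1\}$. Convention. $(\zeta_\varepsilon)_{\varepsilon>0}$ stands for $(\zeta_{\varepsilon_n})_{n\in\mathbb{N}}$ with an arbitrary sequence $\varepsilon_n\to0$, $\varepsilon_n>0$; subsequences are extracted from $(\varepsilon_n)$ and not relabeled. Coefficients. $b_\varepsilon:[-1,1]\to[0,\overline b_\varepsilon]$ ($\varepsilon>0$) and $b_0:[-1,1]\to[0,+\infty]$ satisfy: each $b_\varepsilon$ ($\varepsilon>0$) is decreasing, continuous and surjective (and is the restriction of a non-negative $C^{1,1}_{loc}(\mathbb{R})$ function); $b_0$ is continuous at the point $1$; $b_0(0)<+\infty$; $b_\varepsilon\to b_0$ pointwise in $[-1,1]$ as $\varepsilon\to0$; $b_\delta\ge b_\varepsilon$ on $[-1,1]$ for all $0\le\delta\le\varepsilon$. Moreover $\lim_{\varepsilon\to0}\overline b_\varepsilon=+\infty$ with $\overline b_\varepsilon=o(\varepsilon^{-\kappa})$ as $\varepsilon\to0$, where $\kappa\in(0,1)$ if $d=2$ and $\kappa=2/d$ if $d\ge3$. Conventions in $\overline{\mathbb{R}}$: $\pm\infty\cdot0=0$, $0^{-1}=+\infty$.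 Diffuse interface problem ($a_\varepsilon=c_\varepsilon=1$). For $\varepsilon>0$ and $\varphi\in L^\infty(\Omega)$ with $|\varphi|\le1$: find $\lambda\in\mathbb{R}$, $0\ne w\in H^1_0(\Omega)$ with $\int_\Omega\nabla w\cdot\nabla\eta\,dx+\int_\Omega b_\varepsilon(\varphi)w\eta\,dx=\lambda\int_\Omega w\eta\,dx$ for all $\eta\in H^1_0(\Omega)$. The eigenvalues, repeated according to multiplicity, are $0<\lambda_1^{\varepsilon,\varphi}\le\lambda_2^{\varepsilon,\varphi}\le\cdots$, and $(w_k^{\varepsilon,\varphi})_{k\in\mathbb{N}}$ is a fixed corresponding sequence of eigenfunctions forming an orthonormal basis of $L^2(\Omega)$; we write $w_k^{\varphi_\varepsilon}:=w_k^{\varepsilon,\varphi_\varepsilon}$. Limit problem. For $\varphi\in BV(\Omega,\{\pm1\})\cap\mathcal{U}$ set $E^\varphi=\{x\in\Omega:\varphi(x)=1\}$ and $V^\varphi=\{\eta\in H^1_0(\Omega):\eta=0\text{ a.e. in }\Omega\setminus E^\varphi\}$. Throughout, only $\varphi$ such that $E^\varphi$ contains an open ball are considered (so $V^\varphi$ is infinite dimensional). The limit problem is: find $(w,\lambda)\in(V^\varphi\setminus\{0\})\times\mathbb{R}$ with $\int_\Omega\nabla w\cdot\nabla\eta\,dx=\lambda\int_\Omega w\eta\,dx$ for all $\eta\in V^\varphi$. Its eigenvalues, repeated according to multiplicity, are $0<\lambda_1^{0,\varphi}\le\lambda_2^{0,\varphi}\le\cdots\to\infty$. *)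

theory Defs
  imports "HOL-Analysis.Analysis" "HOL-Library.Landau_Symbols"
begin

text \<open>
  Functions on \<open>\<Omega>\<close> are total functions of which only the values on \<open>\<Omega>\<close> matter: all
  integrals and almost-everywhere statements are taken with respect to \<open>lebesgue_on \<Omega>\<close>.
  Elements of function spaces are functions, not equivalence classes; the spaces below are
  invariant under modification on null sets.
\<close>

subsection \<open>Domains\<close>

text \<open>Near every boundary point, \<open>\<Omega>\<close> is the strict epigraph, in some direction \<open>\<nu>\<close>, of a
  Lipschitz function \<open>\<gamma>\<close> on the hyperplane orthogonal to \<open>\<nu>\<close>.\<close>

definition lipschitz_boundary :: "'a::euclidean_space set \<Rightarrow> bool" where
  "lipschitz_boundary \<Omega> \<longleftrightarrow>
     (\<forall>p\<in>frontier \<Omega>. \<exists>U \<nu> L \<gamma>. open U \<and> p \<in> U \<and> norm \<nu> = 1 \<and>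
        L-lipschitz_on {y. y \<bullet> \<nu> = 0} (\<gamma> :: 'a \<Rightarrow> real) \<and>
        \<Omega> \<inter> U = {x \<in> U. \<gamma> (x - (x \<bullet> \<nu>) *\<^sub>R \<nu>) < x \<bullet> \<nu>})"

definition lipschitz_domain :: "'a::euclidean_space set \<Rightarrow> bool" where
  "lipschitz_domain \<Omega> \<longleftrightarrow> open \<Omega> \<and> connected \<Omega> \<and> \<Omega> \<noteq> {} \<and> lipschitz_boundary \<Omega>"

subsection \<open>Test functions\<close>

primrec C_k :: "nat \<Rightarrow> ('a::euclidean_space \<Rightarrow> 'b::real_normed_vector) \<Rightarrow> bool" where
  "C_k 0 f \<longleftrightarrow> continuous_on UNIV f"
| "C_k (Suc k) f \<longleftrightarrow> (\<forall>x. f differentiable at x) \<and>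
     (\<forall>i\<in>Basis. C_k k (\<lambda>x. frechet_derivative f (at x) i))"

definition compactly_supported_in ::
    "'a::euclidean_space set \<Rightarrow> ('a \<Rightarrow> 'b::real_normed_vector) \<Rightarrow> bool" where
  "compactly_supported_in \<Omega> f \<longleftrightarrow>
     compact (closure {x. f x \<noteq> 0}) \<and> closure {x. f x \<noteq> 0} \<subseteq> \<Omega>"

definition test_functions :: "'a::euclidean_space set \<Rightarrow> ('a \<Rightarrow> real) set" where
  "test_functions \<Omega> = {\<psi>. (\<forall>k. C_k k \<psi>) \<and> compactly_supported_in \<Omega> \<psi>}"

subsection \<open>Functions of bounded variation, sets of finite perimeter\<close>

definition divergence :: "('a::euclidean_space \<Rightarrow> 'a) \<Rightarrow> 'a \<Rightarrow> real" where
  "divergence \<psi> x = (\<Sum>i\<in>Basis. frechet_derivative \<psi> (at x) i \<bullet> i)"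

definition total_variation :: "'a::euclidean_space set \<Rightarrow> ('a \<Rightarrow> real) \<Rightarrow> ereal" where
  "total_variation \<Omega> f =
     (SUP \<psi> \<in> {\<psi>. C_k 1 \<psi> \<and> compactly_supported_in \<Omega> \<psi> \<and> (\<forall>x. norm (\<psi> x) \<le> 1)}.
        ereal (LINT x|lebesgue_on \<Omega>. f x * divergence \<psi> x))"

definition BV :: "'a::euclidean_space set \<Rightarrow> ('a \<Rightarrow> real) set" where
  "BV \<Omega> = {f. integrable (lebesgue_on \<Omega>) f \<and> total_variation \<Omega> f < \<infinity>}"

definition BV_pm1 :: "'a::euclidean_space set \<Rightarrow> ('a \<Rightarrow> real) set" where
  "BV_pm1 \<Omega> = {f \<in> BV \<Omega>. AE x in lebesgue_on \<Omega>. f x \<in> {-1, 1}}"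

definition finite_perimeter_in :: "'a::euclidean_space set \<Rightarrow> 'a set \<Rightarrow> bool" where
  "finite_perimeter_in \<Omega> S \<longleftrightarrow>
     S \<in> sets lebesgue \<and> total_variation \<Omega> (indicat_real S) < \<infinity>"

subsection \<open>Lebesgue and Sobolev spaces\<close>

definition L2 :: "'a::euclidean_space set \<Rightarrow> ('a \<Rightarrow> 'b::euclidean_space) set" where
  "L2 \<Omega> = {f. f \<in> borel_measurable (lebesgue_on \<Omega>) \<and>
              integrable (lebesgue_on \<Omega>) (\<lambda>x. (norm (f x))\<^sup>2)}"

definition L2_norm :: "'a::euclidean_space set \<Rightarrow> ('a \<Rightarrow> 'b::euclidean_space) \<Rightarrow> real" where
  "L2_norm \<Omega> f = sqrt (LINT x|lebesgue_on \<Omega>. (norm (f x))\<^sup>2)"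

definition L2_inner :: "'a::euclidean_space set \<Rightarrow> ('a \<Rightarrow> real) \<Rightarrow> ('a \<Rightarrow> real) \<Rightarrow> real" where
  "L2_inner \<Omega> f g = (LINT x|lebesgue_on \<Omega>. f x * g x)"

definition is_weak_gradient ::
    "'a::euclidean_space set \<Rightarrow> ('a \<Rightarrow> real) \<Rightarrow> ('a \<Rightarrow> 'a) \<Rightarrow> bool" where
  "is_weak_gradient \<Omega> u g \<longleftrightarrow> g \<in> L2 \<Omega> \<and>
     (\<forall>\<psi>\<in>test_functions \<Omega>. \<forall>i\<in>Basis.
        (LINT x|lebesgue_on \<Omega>. u x * frechet_derivative \<psi> (at x) i) =
        - (LINT x|lebesgue_on \<Omega>. (g x \<bullet> i) * \<psi> x))"

definition H1 :: "'a::euclidean_space set \<Rightarrow> ('a \<Rightarrow> real) set" where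
  "H1 \<Omega> = {u \<in> L2 \<Omega>. \<exists>g. is_weak_gradient \<Omega> u g}"

text \<open>The weak gradient of a function in \<open>H1 \<Omega>\<close> is unique almost everywhere in \<open>\<Omega>\<close>.\<close>

definition weak_grad :: "'a::euclidean_space set \<Rightarrow> ('a \<Rightarrow> real) \<Rightarrow> 'a \<Rightarrow> 'a" where
  "weak_grad \<Omega> u = (SOME g. is_weak_gradient \<Omega> u g)"

definition H1_norm :: "'a::euclidean_space set \<Rightarrow> ('a \<Rightarrow> real) \<Rightarrow> real" where
  "H1_norm \<Omega> u = sqrt ((L2_norm \<Omega> u)\<^sup>2 + (L2_norm \<Omega> (weak_grad \<Omega> u))\<^sup>2)"

definition H10 :: "'a::euclidean_space set \<Rightarrow> ('a \<Rightarrow> real) set" where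
  "H10 \<Omega> = {u \<in> H1 \<Omega>. \<exists>\<psi>. (\<forall>n. \<psi> n \<in> test_functions \<Omega>) \<and>
                (\<lambda>n. H1_norm \<Omega> (\<lambda>x. \<psi> n x - u x)) \<longlonglongrightarrow> 0}"

definition orthonormal_basis_L2 ::
    "'a::euclidean_space set \<Rightarrow> (nat \<Rightarrow> 'a \<Rightarrow> real) \<Rightarrow> bool" where
  "orthonormal_basis_L2 \<Omega> w \<longleftrightarrow>
     (\<forall>j. w j \<in> L2 \<Omega>) \<and>
     (\<forall>i j. L2_inner \<Omega> (w i) (w j) = (if i = j then 1 else 0)) \<and>
     (\<forall>f\<in>L2 \<Omega>. (\<lambda>N. L2_norm \<Omega> (\<lambda>x. f x - (\<Sum>j<N. L2_inner \<Omega> f (w j) * w j x))) \<longlonglongrightarrow> 0)"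

subsection \<open>Variational eigenvalue problems\<close>

text \<open>In the following, \<open>V\<close> is a space of functions and \<open>a\<close> a bilinear form on it.\<close>

definition eigenspace ::
    "'a::euclidean_space set \<Rightarrow> ('a \<Rightarrow> real) set \<Rightarrow> (('a \<Rightarrow> real) \<Rightarrow> ('a \<Rightarrow> real) \<Rightarrow> real) \<Rightarrow>
     real \<Rightarrow> ('a \<Rightarrow> real) set" where
  "eigenspace \<Omega> V a \<mu> = {w \<in> V. \<forall>\<eta>\<in>V. a w \<eta> = \<mu> * L2_inner \<Omega> w \<eta>}"

definition eigenfunction ::
    "'a::euclidean_space set \<Rightarrow> ('a \<Rightarrow> real) set \<Rightarrow> (('a \<Rightarrow> real) \<Rightarrow> ('a \<Rightarrow> real) \<Rightarrow> real) \<Rightarrow>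
     real \<Rightarrow> ('a \<Rightarrow> real) \<Rightarrow> bool" where
  "eigenfunction \<Omega> V a \<mu> w \<longleftrightarrow>
     w \<in> eigenspace \<Omega> V a \<mu> \<and> \<not> (AE x in lebesgue_on \<Omega>. w x = 0)"

text \<open>\<open>W\<close>, modulo equality almost everywhere in \<open>\<Omega>\<close>, has a basis of \<open>m\<close> elements.\<close>

definition has_dim_ae :: "'a::euclidean_space set \<Rightarrow> ('a \<Rightarrow> real) set \<Rightarrow> nat \<Rightarrow> bool" where
  "has_dim_ae \<Omega> W m \<longleftrightarrow>
     (\<exists>f. (\<forall>i<m. f i \<in> W) \<and>
        (\<forall>c::nat \<Rightarrow> real. (AE x in lebesgue_on \<Omega>. (\<Sum>i<m. c i * f i x) = 0) \<longrightarrow> (\<forall>i<m. c i = 0)) \<and>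
        (\<forall>w\<in>W. \<exists>c::nat \<Rightarrow> real. AE x in lebesgue_on \<Omega>. w x = (\<Sum>i<m. c i * f i x)))"

text \<open>\<open>lam\<close> lists the eigenvalues in increasing order, each one exactly as often as its
  multiplicity; in particular, numbers that are not eigenvalues do not occur. Sequences of
  eigenvalues and eigenfunctions start with index \<open>0\<close>: \<open>lam 0\<close> is the first eigenvalue.\<close>

definition eigenvalue_sequence ::
    "'a::euclidean_space set \<Rightarrow> ('a \<Rightarrow> real) set \<Rightarrow> (('a \<Rightarrow> real) \<Rightarrow> ('a \<Rightarrow> real) \<Rightarrow> real) \<Rightarrow>
     (nat \<Rightarrow> real) \<Rightarrow> bool" where
  "eigenvalue_sequence \<Omega> V a lam \<longleftrightarrow>
     mono lam \<and>
     (\<forall>\<mu>. finite {j. lam j = \<mu>} \<and> has_dim_ae \<Omega> (eigenspace \<Omega> V a \<mu>) (card {j. lam j = \<mu>}))"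

subsection \<open>The diffuse interface problem and the limit problem\<close>

definition dirichlet_form ::
    "'a::euclidean_space set \<Rightarrow> ('a \<Rightarrow> real) \<Rightarrow> ('a \<Rightarrow> real) \<Rightarrow> real" where
  "dirichlet_form \<Omega> w \<eta> = (LINT x|lebesgue_on \<Omega>. weak_grad \<Omega> w x \<bullet> weak_grad \<Omega> \<eta> x)"

definition diffuse_form ::
    "'a::euclidean_space set \<Rightarrow> (real \<Rightarrow> real) \<Rightarrow> ('a \<Rightarrow> real) \<Rightarrow>
     ('a \<Rightarrow> real) \<Rightarrow> ('a \<Rightarrow> real) \<Rightarrow> real" where
  "diffuse_form \<Omega> \<beta> \<phi> w \<eta> =
     dirichlet_form \<Omega> w \<eta> + (LINT x|lebesgue_on \<Omega>. \<beta> (\<phi> x) * w x * \<eta> x)"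

definition phase_fields ::
    "'a::euclidean_space set \<Rightarrow> 'a set \<Rightarrow> 'a set \<Rightarrow> ('a \<Rightarrow> real) set" where
  "phase_fields \<Omega> S0 S1 = {\<phi>. integrable (lebesgue_on \<Omega>) \<phi> \<and>
     (AE x in lebesgue_on \<Omega>. x \<in> S0 \<longrightarrow> \<phi> x = -1) \<and>
     (AE x in lebesgue_on \<Omega>. x \<in> S1 \<longrightarrow> \<phi> x = 1)}"

definition E_set :: "'a::euclidean_space set \<Rightarrow> ('a \<Rightarrow> real) \<Rightarrow> 'a set" where
  "E_set \<Omega> \<phi> = {x \<in> \<Omega>. \<phi> x = 1}"

definition V_space :: "'a::euclidean_space set \<Rightarrow> ('a \<Rightarrow> real) \<Rightarrow> ('a \<Rightarrow> real) set" where
  "V_space \<Omega> \<phi> = {\<eta> \<in> H10 \<Omega>. AE x in lebesgue_on \<Omega>. x \<notin> E_set \<Omega> \<phi> \<longrightarrow> \<eta> x = 0}"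

subsection \<open>Coefficients\<close>

definition C11_loc :: "(real \<Rightarrow> real) \<Rightarrow> bool" where
  "C11_loc g \<longleftrightarrow> (\<exists>g'. (\<forall>t. (g has_real_derivative g' t) (at t)) \<and>
     (\<forall>K. compact K \<longrightarrow> (\<exists>L. L-lipschitz_on K g')))"

end

theory Submission
  imports Defs "HOL-Complex_Analysis.Great_Picard"
begin

text \<open>
  The diffuse problems are treated as spectral problems for forms
  \<open>\<integral> \<nabla>u \<bullet> \<nabla>v + \<integral> q\<^sub>n u v\<close> whose weights \<open>q\<^sub>n = b\<^sub>\<epsilon>(\<phi>\<^sub>\<epsilon>)\<close> vanish in the limit on \<open>E\<^sup>\<phi>\<close> and blow up off it.

  The given orthonormal bases of eigenfunctions replace the usual embedding theorems. They lie in
  \<open>H10 \<Omega>\<close>, so test functions are dense in \<open>L2 \<Omega>\<close> and weak gradients are unique. Their eigenvalues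
  are unbounded, since otherwise oscillating test functions would have bounded Rayleigh quotients, and
  Bessel's inequality for the form then shows that bounded sequences in \<open>H10 \<Omega>\<close> with convergent
  coefficients converge in \<open>L2 \<Omega>\<close>.

  Only bounded functions are inserted as competitors: if \<open>\<bar>\<eta>\<bar> \<le> M\<close>, then the contribution of
  \<open>E\<^sup>\<phi> \<inter> {\<phi>\<^sub>\<epsilon> < 0}\<close> to \<open>\<integral> b\<^sub>\<epsilon>(\<phi>\<^sub>\<epsilon>) \<eta>\<^sup>2\<close> is at most \<open>M\<^sup>2\<close> times the upper bound of \<open>b\<^sub>\<epsilon>\<close> times \<open>O(\<epsilon>)\<close>, which
  tends to \<open>0\<close> because \<open>\<kappa> \<le> 1\<close>. Truncated eigenfunctions of the limit problem in the min-max principle give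
  \<open>limsup \<lambda>\<^sub>k\<^sup>\<epsilon> \<le> \<lambda>\<^sub>k\<^sup>0\<close>. Along a subsequence the first \<open>k + 1\<close> eigenfunctions converge in \<open>L2 \<Omega>\<close> to
  orthonormal eigenfunctions of the limit problem, and comparing their number with the multiplicities
  of the limit eigenvalues yields equality. Convergence of the energies upgrades weak to strong
  convergence in \<open>H\<^sup>1\<close>.
\<close>

subsection \<open>Linear algebra\<close>

text \<open>The set \<open>E_set \<Omega> \<phi>\<close> is in general only a set of finite
  perimeter, so smooth functions supported in it need not be dense in
  \<open>V_space \<Omega> \<phi>\<close>, and competitors have to be made from elements of that
  space. Composition with a bounded function vanishing at 0 preserves the condition of being zero
  off the set, whereas mollification need not. That limits vanish off the set takes two parameters:
  for fixed \<open>\<delta>\<close> the coefficient \<open>b \<delta>\<close> is finite, continuous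
  and eventually below the actual coefficient, so Fatou's lemma applies to it; only afterwards does
  \<open>\<delta>\<close> tend to 0 and \<open>bbar \<delta>\<close> to infinity. For the limit
  problem only eigenvalues with multiplicities are given, not a basis of eigenfunctions, so no
  min-max principle bounds the limit eigenvalue from below. This is why all eigenpairs up to index
  \<open>k\<close> are followed: if the limit of the eigenvalues of index \<open>k\<close> were
  below \<open>lam0 k\<close>, then \<open>k + 1\<close> orthonormal functions would lie in
  eigenspaces whose dimensions add up to at most \<open>k\<close>.\<close>

text \<open>Gaussian elimination, one equation per induction step. It serves three times: to find a
  min-max competitor orthogonal to the first eigenfunctions, to extend an orthonormal family, and to
  bound the size of one by a dimension.\<close>

lemma underdetermined_system:
  fixes A :: "'i \<Rightarrow> nat \<Rightarrow> real"
  assumes "finite I" "m < card I"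
  shows "\<exists>x. (\<exists>i\<in>I. x i \<noteq> 0) \<and> (\<forall>j<m. (\<Sum>i\<in>I. x i * A i j) = 0)"
  using assms
proof (induction m arbitrary: I A)
  case 0
  then obtain i where "i \<in> I" by fastforce
  then show ?case by (intro exI[of _ "\<lambda>_. 1"]) auto
next
  case (Suc m)
  show ?case
  proof (cases "\<exists>p\<in>I. A p m \<noteq> 0")
    case False
    obtain x where "\<exists>i\<in>I. x i \<noteq> 0" "\<forall>j<m. (\<Sum>i\<in>I. x i * A i j) = 0"
      using Suc.IH[of I A] Suc.prems by auto
    then show ?thesis
      using False by (intro exI[of _ x]) (auto simp: less_Suc_eq)
  next
    case True
    then obtain p where p: "p \<in> I" "A p m \<noteq> 0" by auto
    \<comment> \<open>Equation \<open>m\<close> is solved for the unknown \<open>p\<close>;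
      substituting the result into the other equations leaves a system in the unknowns
      \<open>J\<close>.\<close>
    define J where "J = I - {p}"
    have J: "finite J" "m < card J" "I = insert p J" "p \<notin> J"
      using p Suc.prems by (auto simp: J_def)
    obtain x where x: "\<exists>i\<in>J. x i \<noteq> 0"
      "\<forall>j<m. (\<Sum>i\<in>J. x i * (A i j - A i m / A p m * A p j)) = 0"
      using Suc.IH[of J "\<lambda>i j. A i j - A i m / A p m * A p j"] J by auto
    define y where "y = x(p := - (\<Sum>i\<in>J. x i * A i m) / A p m)"
    have yJ: "(\<Sum>i\<in>J. y i * A i j) = (\<Sum>i\<in>J. x i * A i j)" for j
      by (rule sum.cong) (use J in \<open>auto simp: y_def\<close>)
    have "(\<Sum>i\<in>I. y i * A i j) = (\<Sum>i\<in>J. x i * (A i j - A i m / A p m * A p j))" for j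
    proof -
      have "(\<Sum>i\<in>I. y i * A i j) = y p * A p j + (\<Sum>i\<in>J. x i * A i j)"
        using J yJ by simp
      also have "y p * A p j = - (\<Sum>i\<in>J. x i * (A i m / A p m * A p j))"
        by (simp add: y_def sum_divide_distrib sum_distrib_right sum_distrib_left mult_ac)
      finally show ?thesis
        by (simp add: algebra_simps sum_subtractf)
    qed
    moreover have "(\<Sum>i\<in>J. x i * (A i m - A i m / A p m * A p m)) = 0"
      using p by simp
    ultimately have "\<forall>j<Suc m. (\<Sum>i\<in>I. y i * A i j) = 0"
      using x(2) by (auto simp: less_Suc_eq)
    moreover have "\<exists>i\<in>I. y i \<noteq> 0"
      using x(1) J by (auto simp: y_def)
    ultimately show ?thesis by blast
  qed
qed

lemma sum_abs_squared_le:
  fixes x :: "'i \<Rightarrow> real"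
  shows "(\<Sum>i\<in>I. \<bar>x i\<bar>)\<^sup>2 \<le> real (card I) * (\<Sum>i\<in>I. (x i)\<^sup>2)"
  using Cauchy_Schwarz_ineq_sum[of "\<lambda>_. 1" "\<lambda>i. \<bar>x i\<bar>" I] by simp

subsection \<open>Semi-definite symmetric forms on spaces of functions\<close>

text \<open>Functions are not identified when they agree almost everywhere, so the forms are only
  semi-definite. Values in a real vector space let the same locale serve the \<open>L2\<close>
  products of functions and of gradients, besides the Dirichlet form, the weighted forms and their
  sums.\<close>

locale sym_form =
  fixes V :: "('x \<Rightarrow> 'b::real_vector) set" and a :: "('x \<Rightarrow> 'b) \<Rightarrow> ('x \<Rightarrow> 'b) \<Rightarrow> real"
  assumes zero_mem: "(\<lambda>x. 0) \<in> V"
    and lin_mem: "u \<in> V \<Longrightarrow> v \<in> V \<Longrightarrow> (\<lambda>x. c *\<^sub>R u x + v x) \<in> V"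
    and sym: "u \<in> V \<Longrightarrow> v \<in> V \<Longrightarrow> a u v = a v u"
    and lin: "u \<in> V \<Longrightarrow> v \<in> V \<Longrightarrow> z \<in> V \<Longrightarrow> a (\<lambda>x. c *\<^sub>R u x + v x) z = c * a u z + a v z"
    and nonneg: "u \<in> V \<Longrightarrow> 0 \<le> a u u"
begin

lemma add_mem: "u \<in> V \<Longrightarrow> v \<in> V \<Longrightarrow> (\<lambda>x. u x + v x) \<in> V"
  using lin_mem[of u v 1] by simp

lemma scale_mem: "u \<in> V \<Longrightarrow> (\<lambda>x. c *\<^sub>R u x) \<in> V"
  using lin_mem[of u "\<lambda>x. 0" c] zero_mem by simp

lemma diff_mem: "u \<in> V \<Longrightarrow> v \<in> V \<Longrightarrow> (\<lambda>x. u x - v x) \<in> V"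
  using lin_mem[of v u "-1"] by simp

lemma sum_mem: "(\<And>i. i \<in> I \<Longrightarrow> f i \<in> V) \<Longrightarrow> (\<lambda>x. \<Sum>i\<in>I. c i *\<^sub>R f i x) \<in> V"
proof (induction I rule: infinite_finite_induct)
  case (insert i I)
  then show ?case using lin_mem[of "f i" "\<lambda>x. \<Sum>i\<in>I. c i *\<^sub>R f i x" "c i"] by simp
qed (use zero_mem in auto)

lemma add_left: "u \<in> V \<Longrightarrow> v \<in> V \<Longrightarrow> z \<in> V \<Longrightarrow> a (\<lambda>x. u x + v x) z = a u z + a v z"
  using lin[of u v z 1] by simp

lemma zero_left: "z \<in> V \<Longrightarrow> a (\<lambda>x. 0) z = 0"
  using add_left[of "\<lambda>x. 0" "\<lambda>x. 0" z] zero_mem by simp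

lemma scale_left: "u \<in> V \<Longrightarrow> z \<in> V \<Longrightarrow> a (\<lambda>x. c *\<^sub>R u x) z = c * a u z"
  using lin[of u "\<lambda>x. 0" z c] zero_mem zero_left[of z] by simp

lemma diff_left: "u \<in> V \<Longrightarrow> v \<in> V \<Longrightarrow> z \<in> V \<Longrightarrow> a (\<lambda>x. u x - v x) z = a u z - a v z"
  using lin[of v u z "-1"] by simp

lemma sum_left:
  "(\<And>i. i \<in> I \<Longrightarrow> f i \<in> V) \<Longrightarrow> z \<in> V \<Longrightarrow> a (\<lambda>x. \<Sum>i\<in>I. c i *\<^sub>R f i x) z = (\<Sum>i\<in>I. c i * a (f i) z)"
proof (induction I rule: infinite_finite_induct)
  case (insert i I)
  then show ?case using lin[of "f i" "\<lambda>x. \<Sum>i\<in>I. c i *\<^sub>R f i x" z "c i"] sum_mem[of I f c] by simp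
qed (auto simp: zero_left)

lemma add_right: "u \<in> V \<Longrightarrow> v \<in> V \<Longrightarrow> z \<in> V \<Longrightarrow> a z (\<lambda>x. u x + v x) = a z u + a z v"
  using add_left[of u v z] sym add_mem by metis

lemma scale_right: "u \<in> V \<Longrightarrow> z \<in> V \<Longrightarrow> a z (\<lambda>x. c *\<^sub>R u x) = c * a z u"
  using scale_left[of u z c] sym scale_mem by metis

lemma diff_right: "u \<in> V \<Longrightarrow> v \<in> V \<Longrightarrow> z \<in> V \<Longrightarrow> a z (\<lambda>x. u x - v x) = a z u - a z v"
  using diff_left[of u v z] sym diff_mem by metis

lemma sum_right:
  assumes "\<And>i. i \<in> I \<Longrightarrow> f i \<in> V" "z \<in> V"
  shows "a z (\<lambda>x. \<Sum>i\<in>I. c i *\<^sub>R f i x) = (\<Sum>i\<in>I. c i * a z (f i))"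
  using sum_left[of I f z c] sym[OF assms(2) sum_mem[of I f c]] assms
  by (simp add: sym)

lemma sum_sum:
  assumes "\<And>i. i \<in> I \<Longrightarrow> f i \<in> V" "\<And>j. j \<in> J \<Longrightarrow> g j \<in> V"
  shows "a (\<lambda>x. \<Sum>i\<in>I. c i *\<^sub>R f i x) (\<lambda>x. \<Sum>j\<in>J. d j *\<^sub>R g j x) =
    (\<Sum>i\<in>I. \<Sum>j\<in>J. c i * d j * a (f i) (g j))"
proof -
  have "a (\<lambda>x. \<Sum>i\<in>I. c i *\<^sub>R f i x) (\<lambda>x. \<Sum>j\<in>J. d j *\<^sub>R g j x) =
      (\<Sum>i\<in>I. c i * a (f i) (\<lambda>x. \<Sum>j\<in>J. d j *\<^sub>R g j x))"
    by (intro sum_left sum_mem assms)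
  also have "\<dots> = (\<Sum>i\<in>I. c i * (\<Sum>j\<in>J. d j * a (f i) (g j)))"
    by (intro sum.cong refl arg_cong2[of _ _ _ _ "(*)"] sum_right) (use assms in auto)
  finally show ?thesis by (simp add: sum_distrib_left mult_ac)
qed

lemma square_diff:
  assumes "u \<in> V" "v \<in> V"
  shows "a (\<lambda>x. u x - v x) (\<lambda>x. u x - v x) = a u u - 2 * a u v + a v v"
  using assms by (simp add: diff_left diff_right diff_mem sym[of v u])

lemma square_add:
  assumes "u \<in> V" "v \<in> V"
  shows "a (\<lambda>x. u x + v x) (\<lambda>x. u x + v x) = a u u + 2 * a u v + a v v"
  using assms by (simp add: add_left add_right add_mem sym[of v u])

lemma Cauchy_Schwarz:
  assumes u: "u \<in> V" and v: "v \<in> V"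
  shows "(a u v)\<^sup>2 \<le> a u u * a v v"
proof -
  have *: "0 \<le> a u u + 2 * t * a u v + t\<^sup>2 * a v v" for t
    using nonneg[OF add_mem[OF u scale_mem[OF v, of t]]] u v
    by (simp add: square_add scale_mem scale_left scale_right power2_eq_square)
  show ?thesis
  proof (cases "a v v = 0")
    case True
    have "a u v = 0"
    proof (rule ccontr)
      assume "a u v \<noteq> 0"
      \<comment> \<open>With \<open>a v v = 0\<close> the quadratic in \<open>t\<close> is affine;
        the chosen \<open>t\<close> gives it the value -1.\<close>
      then show False
        using *[of "- (a u u + 1) / (2 * a u v)"] True by (simp add: field_simps)
    qed
    then show ?thesis using True by simp
  next
    case False
    then have pos: "a v v > 0" using nonneg[OF v] by simp
    have "0 \<le> (a u u + 2 * (- a u v / a v v) * a u v + (- a u v / a v v)\<^sup>2 * a v v) * a v v"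
      using pos *[of "- a u v / a v v"] by simp
    also have "\<dots> = a u u * a v v - (a u v)\<^sup>2"
      using pos by (simp add: field_simps power2_eq_square)
    finally show ?thesis by simp
  qed
qed

definition nrm :: "('x \<Rightarrow> 'b) \<Rightarrow> real" where
  "nrm u = sqrt (a u u)"

lemma nrm_nonneg [simp]: "u \<in> V \<Longrightarrow> 0 \<le> nrm u"
  by (simp add: nrm_def nonneg)

lemma nrm_squared: "u \<in> V \<Longrightarrow> (nrm u)\<^sup>2 = a u u"
  by (simp add: nrm_def nonneg)

lemma abs_le_nrm: "u \<in> V \<Longrightarrow> v \<in> V \<Longrightarrow> \<bar>a u v\<bar> \<le> nrm u * nrm v"
  using Cauchy_Schwarz[of u v] by (auto simp: nrm_def nonneg simp flip: real_sqrt_mult intro!: real_le_rsqrt)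

lemma nrm_triangle:
  assumes "u \<in> V" "v \<in> V"
  shows "nrm (\<lambda>x. u x + v x) \<le> nrm u + nrm v"
proof (rule power2_le_imp_le)
  show "(nrm (\<lambda>x. u x + v x))\<^sup>2 \<le> (nrm u + nrm v)\<^sup>2"
    using assms abs_le_nrm[OF assms]
    by (simp add: nrm_squared add_mem square_add power2_sum)
qed (use assms in simp)

lemma nrm_scale: "u \<in> V \<Longrightarrow> nrm (\<lambda>x. c *\<^sub>R u x) = \<bar>c\<bar> * nrm u"
  by (simp add: nrm_def scale_left scale_right scale_mem real_sqrt_mult flip: mult.assoc)

lemma nrm_minus_commute:
  assumes "u \<in> V" "v \<in> V"
  shows "nrm (\<lambda>x. u x - v x) = nrm (\<lambda>x. v x - u x)"
  using assms by (simp add: nrm_def square_diff sym[of v u])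

lemma nrm_triangle_diff:
  assumes "u \<in> V" "v \<in> V" "z \<in> V"
  shows "nrm (\<lambda>x. u x - v x) \<le> nrm (\<lambda>x. u x - z x) + nrm (\<lambda>x. z x - v x)"
  using nrm_triangle[of "\<lambda>x. u x - z x" "\<lambda>x. z x - v x"] assms by (simp add: diff_mem)

lemma tendsto_form:
  assumes "\<And>n. u n \<in> V" "\<And>n. v n \<in> V" "u' \<in> V" "v' \<in> V"
    and u: "(\<lambda>n. nrm (\<lambda>x. u n x - u' x)) \<longlonglongrightarrow> 0"
    and v: "(\<lambda>n. nrm (\<lambda>x. v n x - v' x)) \<longlonglongrightarrow> 0"
  shows "(\<lambda>n. a (u n) (v n)) \<longlonglongrightarrow> a u' v'"
proof -
  have eq: "a (u n) (v n) - a u' v' = a (\<lambda>x. u n x - u' x) (\<lambda>x. v n x - v' x)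
      + a (\<lambda>x. u n x - u' x) v' + a u' (\<lambda>x. v n x - v' x)" for n
    using assms by (simp add: diff_left diff_right diff_mem)
  have "(\<lambda>n. a (u n) (v n) - a u' v') \<longlonglongrightarrow> 0"
  proof (rule tendsto_0_le)
    show "(\<lambda>n. nrm (\<lambda>x. u n x - u' x) * nrm (\<lambda>x. v n x - v' x)
      + nrm (\<lambda>x. u n x - u' x) * nrm v' + nrm u' * nrm (\<lambda>x. v n x - v' x)) \<longlonglongrightarrow> 0"
      by (auto intro!: tendsto_eq_intros u v)
    show "\<forall>\<^sub>F n in sequentially. norm (a (u n) (v n) - a u' v') \<le> norm (nrm (\<lambda>x. u n x - u' x) * nrm (\<lambda>x. v n x - v' x)
      + nrm (\<lambda>x. u n x - u' x) * nrm v' + nrm u' * nrm (\<lambda>x. v n x - v' x)) * 1"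
    proof (rule always_eventually, rule allI)
      fix n
      have m: "(\<lambda>x. u n x - u' x) \<in> V" "(\<lambda>x. v n x - v' x) \<in> V"
        using assms by (auto intro: diff_mem)
      show "norm (a (u n) (v n) - a u' v') \<le> norm (nrm (\<lambda>x. u n x - u' x) * nrm (\<lambda>x. v n x - v' x)
      + nrm (\<lambda>x. u n x - u' x) * nrm v' + nrm u' * nrm (\<lambda>x. v n x - v' x)) * 1"
        using abs_le_nrm[OF m] abs_le_nrm[OF m(1) assms(4)] abs_le_nrm[OF assms(3) m(2)] m assms(3,4)
        unfolding eq real_norm_def by (smt (verit))
    qed
  qed
  then show ?thesis by (simp add: LIM_zero_iff)
qed

end

subsection \<open>The Hilbert space of square-integrable functions\<close>

abbreviation leb :: "'a::euclidean_space set \<Rightarrow> 'a measure" where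
  "leb \<equiv> lebesgue_on"

abbreviation tests :: "'a::euclidean_space set \<Rightarrow> ('a \<Rightarrow> real) set" where
  "tests \<equiv> test_functions"

abbreviation dir :: "'a::euclidean_space set \<Rightarrow> ('a \<Rightarrow> real) \<Rightarrow> ('a \<Rightarrow> real) \<Rightarrow> real" where
  "dir \<equiv> dirichlet_form"

abbreviation L2_tendsto ::
  "'a::euclidean_space set \<Rightarrow> (nat \<Rightarrow> 'a \<Rightarrow> 'b::euclidean_space) \<Rightarrow> ('a \<Rightarrow> 'b) \<Rightarrow> bool" where
  "L2_tendsto U f g \<equiv> (\<lambda>n. L2_norm U (\<lambda>x. f n x - g x)) \<longlonglongrightarrow> 0"

abbreviation meas :: "'a::euclidean_space set \<Rightarrow> ('a \<Rightarrow> 'b::topological_space) set" where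
  "meas U \<equiv> borel_measurable (leb U)"

text \<open>Agrees with \<open>L2_inner\<close> on real functions; the vector-valued version is
  there for gradients.\<close>

definition ip :: "'a::euclidean_space set \<Rightarrow> ('a \<Rightarrow> 'b::euclidean_space) \<Rightarrow> ('a \<Rightarrow> 'b) \<Rightarrow> real" where
  "ip U f g = (LINT x|leb U. f x \<bullet> g x)"

lemma L2_inner_eq_ip: "L2_inner U = ip U"
  by (simp add: fun_eq_iff L2_inner_def ip_def)

lemma L2_measurable [measurable_dest]: "f \<in> L2 U \<Longrightarrow> f \<in> meas U"
  by (simp add: L2_def)

lemma L2_integrable_square: "f \<in> L2 U \<Longrightarrow> integrable (leb U) (\<lambda>x. (norm (f x))\<^sup>2)"
  by (simp add: L2_def)

lemma norm_times_norm_le: "norm x * norm y \<le> (norm x)\<^sup>2 + (norm y)\<^sup>2"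
  using sum_squares_bound[of "norm x" "norm y"] mult_nonneg_nonneg[OF norm_ge_zero norm_ge_zero, of x y]
  by linarith

lemma L2_integrable_mult:
  fixes f :: "'a::euclidean_space \<Rightarrow> 'b::euclidean_space" and g :: "'a \<Rightarrow> 'c::euclidean_space"
  assumes "f \<in> L2 U" "g \<in> L2 U"
  shows "integrable (leb U) (\<lambda>x. norm (f x) * norm (g x))"
proof (rule Bochner_Integration.integrable_bound)
  show "integrable (leb U) (\<lambda>x. (norm (f x))\<^sup>2 + (norm (g x))\<^sup>2)"
    using assms by (auto intro: L2_integrable_square)
  show "(\<lambda>x. norm (f x) * norm (g x)) \<in> meas U"
    using assms[THEN L2_measurable] by measurable
qed (auto simp: norm_times_norm_le)

lemma L2_integrable_inner:
  fixes f g :: "'a::euclidean_space \<Rightarrow> 'b::euclidean_space"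
  assumes "f \<in> L2 U" "g \<in> L2 U"
  shows "integrable (leb U) (\<lambda>x. f x \<bullet> g x)"
proof (rule Bochner_Integration.integrable_bound[OF L2_integrable_mult[OF assms]])
  show "(\<lambda>x. f x \<bullet> g x) \<in> meas U"
    using assms[THEN L2_measurable] by measurable
qed (auto simp: Cauchy_Schwarz_ineq2)

lemma L2_integrable_times:
  fixes f g :: "'a::euclidean_space \<Rightarrow> real"
  assumes "f \<in> L2 U" "g \<in> L2 U"
  shows "integrable (leb U) (\<lambda>x. f x * g x)"
  using L2_integrable_inner[OF assms] by simp

lemma L2_bound:
  fixes f :: "'a::euclidean_space \<Rightarrow> 'b::euclidean_space" and g :: "'a \<Rightarrow> 'c::euclidean_space"
  assumes "g \<in> L2 U" "f \<in> meas U"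
    and "AE x in leb U. norm (f x) \<le> C * norm (g x)"
  shows "f \<in> L2 U"
proof -
  have "integrable (leb U) (\<lambda>x. (norm (f x))\<^sup>2)"
  proof (rule Bochner_Integration.integrable_bound)
    show "integrable (leb U) (\<lambda>x. C\<^sup>2 * (norm (g x))\<^sup>2)"
      using assms by (auto intro: L2_integrable_square)
    show "(\<lambda>x. (norm (f x))\<^sup>2) \<in> meas U"
      using assms by measurable
    show "AE x in leb U. norm ((norm (f x))\<^sup>2) \<le> norm (C\<^sup>2 * (norm (g x))\<^sup>2)"
      using assms(3)
    proof eventually_elim
      case (elim x)
      then show ?case using power_mono[OF elim, of 2] by (simp add: power_mult_distrib)
    qed
  qed
  then show ?thesis using assms by (simp add: L2_def)
qed

lemma L2_lin:
  fixes f g :: "'a::euclidean_space \<Rightarrow> 'b::euclidean_space"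
  assumes "f \<in> L2 U" "g \<in> L2 U"
  shows "(\<lambda>x. c *\<^sub>R f x + g x) \<in> L2 U"
proof -
  have [measurable]: "f \<in> meas U" "g \<in> meas U"
    using assms by (auto intro: L2_measurable)
  have "integrable (leb U) (\<lambda>x. (norm (c *\<^sub>R f x + g x))\<^sup>2)"
  proof (rule Bochner_Integration.integrable_bound)
    show "integrable (leb U) (\<lambda>x. 2 * c\<^sup>2 * (norm (f x))\<^sup>2 + 2 * (norm (g x))\<^sup>2)"
      by (intro Bochner_Integration.integrable_add integrable_mult_right L2_integrable_square assms)
    show "(\<lambda>x. (norm (c *\<^sub>R f x + g x))\<^sup>2) \<in> meas U"
      by measurable
    show "AE x in leb U. norm ((norm (c *\<^sub>R f x + g x))\<^sup>2) \<le> norm (2 * c\<^sup>2 * (norm (f x))\<^sup>2 + 2 * (norm (g x))\<^sup>2)"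
    proof (intro always_eventually allI)
      fix x
      have "(norm (c *\<^sub>R f x + g x))\<^sup>2 \<le> (norm (c *\<^sub>R f x) + norm (g x))\<^sup>2"
        by (intro power_mono norm_triangle_ineq) auto
      also have "\<dots> \<le> 2 * (norm (c *\<^sub>R f x))\<^sup>2 + 2 * (norm (g x))\<^sup>2"
        using sum_squares_bound[of "norm (c *\<^sub>R f x)" "norm (g x)"] unfolding power2_sum by linarith
      finally show "norm ((norm (c *\<^sub>R f x + g x))\<^sup>2) \<le> norm (2 * c\<^sup>2 * (norm (f x))\<^sup>2 + 2 * (norm (g x))\<^sup>2)"
        by (simp add: power_mult_distrib)
    qed
  qed
  then show ?thesis by (simp add: L2_def)
qed

lemma L2_zero: "(\<lambda>x. 0) \<in> L2 U"
  by (simp add: L2_def)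

interpretation L2: sym_form "L2 U" "ip U" for U :: "'a::euclidean_space set"
proof
  fix u v z :: "'a \<Rightarrow> 'b::euclidean_space" and c
  assume "u \<in> L2 U" "v \<in> L2 U" "z \<in> L2 U"
  then show "ip U (\<lambda>x. c *\<^sub>R u x + v x) z = c * ip U u z + ip U v z"
    by (simp add: ip_def inner_add_left L2_integrable_inner)
qed (auto simp: L2_lin L2_zero ip_def inner_commute)

lemma L2_nrm_eq: "L2.nrm U u = L2_norm U u"
  unfolding L2.nrm_def L2_norm_def ip_def by (simp add: power2_norm_eq_inner)

lemma L2_norm_nonneg [simp]: "0 \<le> L2_norm U u"
  by (simp add: L2_norm_def)

lemma L2_norm_power2: "(L2_norm U u)\<^sup>2 = (LINT x|leb U. (norm (u x))\<^sup>2)"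
  by (simp add: L2_norm_def)

lemma L2_norm_power2_ip: "(L2_norm U u)\<^sup>2 = ip U u u"
  by (simp add: L2_norm_def ip_def power2_norm_eq_inner)

lemma ip_cong_AE:
  assumes "f \<in> L2 U" "f' \<in> L2 U" "g \<in> L2 U" "g' \<in> L2 U"
    and "AE x in leb U. f x = f' x" "AE x in leb U. g x = g' x"
  shows "ip U f g = ip U f' g'"
  unfolding ip_def
proof (rule integral_cong_AE)
  show "AE x in leb U. f x \<bullet> g x = f' x \<bullet> g' x"
    using assms(5,6) by eventually_elim simp
qed (use assms(1-4)[THEN L2_measurable] in measurable)

lemma L2_norm_mono:
  fixes f :: "'a::euclidean_space \<Rightarrow> 'b::euclidean_space" and g :: "'a \<Rightarrow> 'c::euclidean_space"
  assumes "f \<in> L2 U" "g \<in> L2 U" "AE x in leb U. norm (f x) \<le> norm (g x)"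
  shows "L2_norm U f \<le> L2_norm U g"
  unfolding L2_norm_def
proof (intro real_sqrt_le_mono integral_mono_AE L2_integrable_square assms(1,2))
  show "AE x in leb U. (norm (f x))\<^sup>2 \<le> (norm (g x))\<^sup>2"
    using assms(3) by eventually_elim (auto intro: power_mono)
qed

lemma L2_norm_eq_0_AE:
  assumes "f \<in> L2 U" "L2_norm U f = 0"
  shows "AE x in leb U. f x = 0"
proof -
  have "AE x in leb U. (norm (f x))\<^sup>2 = 0"
    using assms integral_nonneg_eq_0_iff_AE[OF L2_integrable_square[OF assms(1)]]
    by (simp add: L2_norm_def)
  then show ?thesis by simp
qed

lemma L2_norm_tendsto_AE_subseq:
  fixes f :: "nat \<Rightarrow> 'a::euclidean_space \<Rightarrow> 'b::euclidean_space"
  assumes "\<And>n. f n \<in> L2 U" "g \<in> L2 U" "L2_tendsto U f g"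
  obtains r where "strict_mono (r :: nat \<Rightarrow> nat)" "AE x in leb U. (\<lambda>n. f (r n) x) \<longlonglongrightarrow> g x"
proof -
  have mem: "(\<lambda>x. f n x - g x) \<in> L2 U" for n using assms by (auto intro: L2.diff_mem)
  have "(\<lambda>n. (L2_norm U (\<lambda>x. f n x - g x))\<^sup>2) \<longlonglongrightarrow> 0"
    using tendsto_power[OF assms(3), of 2] by simp
  then have "(\<lambda>n. LINT x|leb U. norm ((norm (f n x - g x))\<^sup>2)) \<longlonglongrightarrow> 0"
    by (simp add: L2_norm_power2)
  from tendsto_L1_AE_subseq[OF L2_integrable_square[OF mem] this]
  obtain r :: "nat \<Rightarrow> nat" where r: "strict_mono r"
    "AE x in leb U. (\<lambda>n. (norm (f (r n) x - g x))\<^sup>2) \<longlonglongrightarrow> 0" by blast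
  have "AE x in leb U. (\<lambda>n. f (r n) x) \<longlonglongrightarrow> g x"
    using r(2)
  proof eventually_elim
    case (elim x)
    then have "(\<lambda>n. norm (f (r n) x - g x)) \<longlonglongrightarrow> 0"
      using tendsto_real_sqrt[OF elim] by simp
    then show ?case by (simp add: tendsto_norm_zero_iff LIM_zero_iff)
  qed
  then show ?thesis using r that by blast
qed

lemma L2_norm_tendsto_dominated:
  fixes f :: "nat \<Rightarrow> 'a::euclidean_space \<Rightarrow> 'b::euclidean_space" and h :: "'a \<Rightarrow> 'c::euclidean_space"
  assumes "\<And>n. f n \<in> meas U" "h \<in> L2 U"
    and "AE x in leb U. (\<lambda>n. f n x) \<longlonglongrightarrow> 0"
    and "\<And>n. AE x in leb U. norm (f n x) \<le> C * norm (h x)"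
  shows "(\<lambda>n. L2_norm U (f n)) \<longlonglongrightarrow> 0"
proof -
  have "(\<lambda>n. LINT x|leb U. (norm (f n x))\<^sup>2) \<longlonglongrightarrow> (LINT x|leb U. 0)"
  proof (rule integral_dominated_convergence)
    show "integrable (leb U) (\<lambda>x. C\<^sup>2 * (norm (h x))\<^sup>2)"
      using assms(2) by (auto intro: L2_integrable_square)
    show "(\<lambda>x. (norm (f n x))\<^sup>2) \<in> meas U" for n
      using assms(1) by measurable
    show "AE x in leb U. (\<lambda>n. (norm (f n x))\<^sup>2) \<longlonglongrightarrow> 0"
      using assms(3) by eventually_elim (auto intro!: tendsto_eq_intros)
    show "AE x in leb U. norm ((norm (f n x))\<^sup>2) \<le> C\<^sup>2 * (norm (h x))\<^sup>2" for n
      using assms(4)[of n]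
    proof eventually_elim
      case (elim x)
      then show ?case using power_mono[OF elim, of 2] by (simp add: power_mult_distrib)
    qed
  qed auto
  then have "(\<lambda>n. sqrt (LINT x|leb U. (norm (f n x))\<^sup>2)) \<longlonglongrightarrow> sqrt 0"
    by (intro tendsto_real_sqrt) simp
  then show ?thesis by (simp add: L2_norm_def)
qed

text \<open>Riesz-Fischer. Along a fast subsequence the squared increments remain summable in the
  mean after multiplication by \<open>2^k\<close>, so almost everywhere the increments decay
  geometrically and the subsequence converges pointwise. Fatou's lemma turns this into convergence
  in norm.\<close>

lemma L2_complete:
  fixes f :: "nat \<Rightarrow> 'a::euclidean_space \<Rightarrow> 'b::euclidean_space"
  assumes mem: "\<And>n. f n \<in> L2 U"
    and Cauchy: "\<And>e. e > 0 \<Longrightarrow> \<exists>N. \<forall>m\<ge>N. \<forall>n\<ge>N. L2_norm U (\<lambda>x. f m x - f n x) < e"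
  obtains g where "g \<in> L2 U" "L2_tendsto U f g"
proof -
  let ?M = "leb U"
  have [measurable]: "f n \<in> borel_measurable ?M" for n using mem by (rule L2_measurable)
  have diff: "(\<lambda>x. f m x - f n x) \<in> L2 U" for m n by (intro L2.diff_mem mem)
  have nn: "(\<integral>\<^sup>+x. ennreal ((norm (f m x - f n x))\<^sup>2) \<partial>?M) = ennreal ((L2_norm U (\<lambda>x. f m x - f n x))\<^sup>2)" for m n
    unfolding L2_norm_power2 by (rule nn_integral_eq_integral[OF L2_integrable_square[OF diff]]) simp
  have "\<forall>k. \<exists>N. \<forall>m\<ge>N. \<forall>n\<ge>N. L2_norm U (\<lambda>x. f m x - f n x) < (1/2)^k"
    by (intro allI Cauchy) simp
  then obtain N where N: "\<And>k m n. m \<ge> N k \<Longrightarrow> n \<ge> N k \<Longrightarrow> L2_norm U (\<lambda>x. f m x - f n x) < (1/2)^k"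
    by metis
  \<comment> \<open>The sum makes \<open>r\<close> monotone and at least \<open>N k\<close>; the
    extra summand \<open>k\<close> makes it unbounded, which Fatou's lemma needs below.\<close>
  define r where "r k = (\<Sum>i\<le>k. N i) + k" for k
  have r1: "N k \<le> r k" "k \<le> r k" "r k \<le> r (Suc k)" for k
    by (auto simp: r_def intro: member_le_sum trans_le_add1)
  define d where "d k x = f (r (Suc k)) x - f (r k) x" for k x
  have d_bound: "(\<integral>\<^sup>+x. ennreal (2^k * (norm (d k x))\<^sup>2) \<partial>?M) \<le> ennreal ((1/2)^k)" for k
  proof -
    have "(\<integral>\<^sup>+x. ennreal (2^k * (norm (d k x))\<^sup>2) \<partial>?M) =
        ennreal (2^k) * ennreal ((L2_norm U (\<lambda>x. f (r (Suc k)) x - f (r k) x))\<^sup>2)"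
      unfolding nn[symmetric] d_def by (subst nn_integral_cmult[symmetric]) (auto simp: ennreal_mult)
    also have "\<dots> = ennreal (2^k * (L2_norm U (\<lambda>x. f (r (Suc k)) x - f (r k) x))\<^sup>2)"
      by (simp add: ennreal_mult)
    also have "\<dots> \<le> ennreal (2^k * ((1/2)^k)\<^sup>2)"
      using N[of k "r (Suc k)" "r k"] r1[of k]
      by (intro ennreal_leI mult_left_mono power_mono) auto
    also have "(2::real)^k * ((1/2)^k)\<^sup>2 = (1/2)^k"
      by (simp add: power2_eq_square power_divide)
    finally show ?thesis .
  qed
  have "(\<integral>\<^sup>+x. (\<Sum>k. ennreal (2^k * (norm (d k x))\<^sup>2)) \<partial>?M) =
      (\<Sum>k. \<integral>\<^sup>+x. ennreal (2^k * (norm (d k x))\<^sup>2) \<partial>?M)"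
    by (rule nn_integral_suminf) (simp add: d_def)
  also have "\<dots> \<le> (\<Sum>k. ennreal ((1/2)^k))"
    by (rule suminf_le) (auto intro: d_bound)
  also have "\<dots> = ennreal (\<Sum>k. (1/2)^k)"
    by (rule suminf_ennreal2) auto
  finally have "(\<integral>\<^sup>+x. (\<Sum>k. ennreal (2^k * (norm (d k x))\<^sup>2)) \<partial>?M) \<noteq> \<infinity>"
    by (auto simp: top_unique)
  then have "AE x in ?M. (\<Sum>k. ennreal (2^k * (norm (d k x))\<^sup>2)) \<noteq> \<infinity>"
    by (intro nn_integral_PInf_AE) (unfold d_def, measurable)
  then have conv: "AE x in ?M. convergent (\<lambda>k. f (r k) x)"
  proof eventually_elim
    case (elim x)
    have "\<exists>C\<ge>0. y = ennreal C" if "y \<noteq> \<infinity>" for y :: ennreal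
      using that by (cases y) auto
    from this[OF elim] obtain C where C: "0 \<le> C" "(\<Sum>k. ennreal (2^k * (norm (d k x))\<^sup>2)) = ennreal C"
      by blast
    have bd: "norm (d k x) \<le> sqrt C * (1 / sqrt 2)^k" for k
    proof -
      have "ennreal (2^k * (norm (d k x))\<^sup>2) \<le> ennreal C"
        using sum_le_suminf[of "\<lambda>k. ennreal (2^k * (norm (d k x))\<^sup>2)" "{k}"] C by simp
      then have "2^k * (norm (d k x))\<^sup>2 \<le> C" using C by simp
      then have "sqrt (2^k * (norm (d k x))\<^sup>2) \<le> sqrt C" by simp
      then show ?thesis
        by (simp add: real_sqrt_mult real_sqrt_power field_simps power_divide)
    qed
    have "summable (\<lambda>k. sqrt C * (1 / sqrt 2)^k)"
      by (rule summable_mult, rule summable_geometric) simp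
    then have "summable (\<lambda>k. d k x)"
      by (rule summable_comparison_test') (rule bd)
    then have "convergent (\<lambda>n. \<Sum>k<n. d k x)" by (simp add: summable_iff_convergent)
    moreover have "(\<Sum>k<n. d k x) = f (r n) x - f (r 0) x" for n
      unfolding d_def by (rule sum_lessThan_telescope)
    ultimately have "convergent (\<lambda>n. f (r n) x - f (r 0) x)" by simp
    then show ?case using convergent_diff_const_right_iff by blast
  qed
  define g where "g x = lim (\<lambda>k. f (r k) x)" for x
  have [measurable]: "g \<in> borel_measurable ?M" unfolding g_def by measurable
  have lim: "AE x in ?M. (\<lambda>k. f (r k) x) \<longlonglongrightarrow> g x"
    using conv by eventually_elim (simp add: g_def convergent_LIMSEQ_iff)
  \<comment> \<open>Stated with \<open>nn_integral\<close> because the square of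
    \<open>f n - g\<close> is not yet known to be integrable.\<close>
  have bound: "(\<integral>\<^sup>+x. ennreal ((norm (f n x - g x))\<^sup>2) \<partial>?M) \<le> ennreal (e\<^sup>2)"
    if e: "e > 0" "\<forall>k\<ge>K. \<forall>n\<ge>K. L2_norm U (\<lambda>x. f k x - f n x) < e" "n \<ge> K" for e n K
  proof -
    have "(\<integral>\<^sup>+x. ennreal ((norm (f n x - g x))\<^sup>2) \<partial>?M) =
        (\<integral>\<^sup>+x. liminf (\<lambda>k. ennreal ((norm (f n x - f (r k) x))\<^sup>2)) \<partial>?M)"
    proof (rule nn_integral_cong_AE, use lim in eventually_elim)
      case (elim x)
      then have "(\<lambda>k. ennreal ((norm (f n x - f (r k) x))\<^sup>2)) \<longlonglongrightarrow> ennreal ((norm (f n x - g x))\<^sup>2)"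
        by (intro tendsto_intros)
      from lim_imp_Liminf[OF sequentially_bot this] show ?case by simp
    qed
    also have "\<dots> \<le> liminf (\<lambda>k. \<integral>\<^sup>+x. ennreal ((norm (f n x - f (r k) x))\<^sup>2) \<partial>?M)"
      by (rule nn_integral_liminf) measurable
    also have "\<dots> \<le> ennreal (e\<^sup>2)"
    proof (rule Liminf_le)
      show "\<forall>\<^sub>F k in sequentially. (\<integral>\<^sup>+x. ennreal ((norm (f n x - f (r k) x))\<^sup>2) \<partial>?M) \<le> ennreal (e\<^sup>2)"
        using eventually_ge_at_top[of K]
      proof eventually_elim
        case (elim k)
        then have "r k \<ge> K" using r1(2)[of k] by linarith
        then show ?case using e unfolding nn by (intro ennreal_leI power_mono) (auto intro: less_imp_le)
      qed
    qed simp
    finally show ?thesis .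
  qed
  have mem_diff: "(\<lambda>x. f n x - g x) \<in> L2 U" "L2_norm U (\<lambda>x. f n x - g x) \<le> e"
    if e: "e > 0" "\<forall>k\<ge>K. \<forall>n\<ge>K. L2_norm U (\<lambda>x. f k x - f n x) < e" "n \<ge> K" for e n K
  proof -
    have fin: "(\<integral>\<^sup>+x. ennreal ((norm (f n x - g x))\<^sup>2) \<partial>?M) < \<infinity>"
      using bound[OF that] by (rule le_less_trans) simp
    then have int: "integrable ?M (\<lambda>x. (norm (f n x - g x))\<^sup>2)"
      by (intro integrableI_bounded) auto
    then show "(\<lambda>x. f n x - g x) \<in> L2 U" by (simp add: L2_def)
    have "ennreal ((L2_norm U (\<lambda>x. f n x - g x))\<^sup>2) \<le> ennreal (e\<^sup>2)"
      using bound[OF that] nn_integral_eq_integral[OF int] by (simp add: L2_norm_power2)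
    then have "(L2_norm U (\<lambda>x. f n x - g x))\<^sup>2 \<le> e\<^sup>2" by simp
    then show "L2_norm U (\<lambda>x. f n x - g x) \<le> e"
      using e(1) by (simp add: power2_le_iff_abs_le)
  qed
  obtain K where "\<forall>k\<ge>K. \<forall>n\<ge>K. L2_norm U (\<lambda>x. f k x - f n x) < 1" using Cauchy[of 1] by auto
  then have "(\<lambda>x. f K x - g x) \<in> L2 U" using mem_diff(1)[of 1 K K] by auto
  from L2.diff_mem[OF mem[of K] this] have g: "g \<in> L2 U" by simp
  have "L2_tendsto U f g"
  proof (rule LIMSEQ_I)
    fix e :: real assume "e > 0"
    then obtain K where K: "\<forall>k\<ge>K. \<forall>n\<ge>K. L2_norm U (\<lambda>x. f k x - f n x) < e/2" using Cauchy[of "e/2"] by auto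
    then have "\<forall>n\<ge>K. L2_norm U (\<lambda>x. f n x - g x) \<le> e/2" using mem_diff(2)[of "e/2" K] \<open>e > 0\<close> by auto
    then show "\<exists>no. \<forall>n\<ge>no. norm (L2_norm U (\<lambda>x. f n x - g x) - 0) < e"
      using \<open>e > 0\<close> by (intro exI[of _ K]) fastforce
  qed
  with g show ?thesis using that by blast
qed

subsection \<open>Smooth functions and integration by parts\<close>

definition pd :: "'a::euclidean_space \<Rightarrow> ('a \<Rightarrow> real) \<Rightarrow> 'a \<Rightarrow> real" where
  "pd i f x = frechet_derivative f (at x) i"

lemma C_k_Suc:
  "C_k (Suc k) (f :: 'a::euclidean_space \<Rightarrow> real) \<longleftrightarrow> (\<forall>x. f differentiable at x) \<and> (\<forall>i\<in>Basis. C_k k (pd i f))"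
  by (simp add: pd_def[abs_def])

lemma C_k_Suc_imp: "C_k (Suc k) (f :: 'a::euclidean_space \<Rightarrow> real) \<Longrightarrow> C_k k f"
proof (induction k arbitrary: f)
  case 0
  then show ?case
    by (auto simp: continuous_on_eq_continuous_at intro: differentiable_imp_continuous_within)
next
  case (Suc k)
  then show ?case by (metis C_k_Suc)
qed

lemma pd_unique: "(f has_derivative f') (at x) \<Longrightarrow> pd i f x = f' i"
  by (simp add: pd_def frechet_derivative_at[symmetric])

lemma has_derivative_pd_expand:
  "f differentiable at x \<Longrightarrow> (f has_derivative frechet_derivative f (at x)) (at x)"
  by (simp add: frechet_derivative_works)

lemma pd_lin:
  assumes "f differentiable at x" "g differentiable at x"
  shows "pd i (\<lambda>x. c * f x + g x) x = c * pd i f x + pd i g x"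
proof -
  note [derivative_intros] = assms[THEN has_derivative_pd_expand]
  have "((\<lambda>x. c * f x + g x) has_derivative (\<lambda>h. c * frechet_derivative f (at x) h + frechet_derivative g (at x) h)) (at x)"
    by (auto intro!: derivative_eq_intros)
  from pd_unique[OF this] show ?thesis by (simp add: pd_def)
qed

lemma pd_mult:
  assumes "f differentiable at x" "g differentiable at x"
  shows "pd i (\<lambda>x. f x * g x) x = f x * pd i g x + pd i f x * g x"
proof -
  note [derivative_intros] = assms[THEN has_derivative_pd_expand]
  have "((\<lambda>x. f x * g x) has_derivative (\<lambda>h. f x * frechet_derivative g (at x) h + frechet_derivative f (at x) h * g x)) (at x)"
    by (auto intro!: derivative_eq_intros)
  from pd_unique[OF this] show ?thesis by (simp add: pd_def)
qed

lemma pd_sin: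
  assumes "f differentiable at x"
  shows "pd i (\<lambda>x. sin (f x)) x = cos (f x) * pd i f x"
proof -
  note [derivative_intros] = assms[THEN has_derivative_pd_expand]
  have "((\<lambda>x. sin (f x)) has_derivative (\<lambda>h. cos (f x) * frechet_derivative f (at x) h)) (at x)"
    by (auto intro!: derivative_eq_intros)
  from pd_unique[OF this] show ?thesis by (simp add: pd_def)
qed

lemma pd_cos:
  assumes "f differentiable at x"
  shows "pd i (\<lambda>x. cos (f x)) x = - 1 * sin (f x) * pd i f x"
proof -
  note [derivative_intros] = assms[THEN has_derivative_pd_expand]
  have "((\<lambda>x. cos (f x)) has_derivative (\<lambda>h. - sin (f x) * frechet_derivative f (at x) h)) (at x)"
    by (auto intro!: derivative_eq_intros)
  from pd_unique[OF this] show ?thesis by (simp add: pd_def)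
qed

lemma differentiable_lin:
  fixes f g :: "'a::euclidean_space \<Rightarrow> real"
  assumes "f differentiable at x" "g differentiable at x"
  shows "(\<lambda>x. c * f x + g x) differentiable at x"
  using assms by (intro differentiable_add differentiable_mult differentiable_const)

lemma C_k_lin:
  fixes f g :: "'a::euclidean_space \<Rightarrow> real"
  shows "C_k k f \<Longrightarrow> C_k k g \<Longrightarrow> C_k k (\<lambda>x. c * f x + g x)"
proof (induction k arbitrary: f g)
  case 0
  then show ?case by (auto intro!: continuous_intros)
next
  case (Suc k)
  have "pd i (\<lambda>x. c * f x + g x) = (\<lambda>x. c * pd i f x + pd i g x)" for i
    using Suc.prems by (intro ext pd_lin) auto
  then show ?case using Suc unfolding C_k_Suc by (auto intro: differentiable_lin)
qed

lemma C_k_mult: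
  fixes f g :: "'a::euclidean_space \<Rightarrow> real"
  shows "C_k k f \<Longrightarrow> C_k k g \<Longrightarrow> C_k k (\<lambda>x. f x * g x)"
proof (induction k arbitrary: f g)
  case 0
  then show ?case by (auto intro!: continuous_intros)
next
  case (Suc k)
  have eq: "pd i (\<lambda>x. f x * g x) = (\<lambda>x. f x * pd i g x + pd i f x * g x)" for i
    using Suc.prems by (intro ext pd_mult) auto
  have "C_k k (\<lambda>x. f x * pd i g x + pd i f x * g x)" if "i \<in> Basis" for i
  proof -
    have "C_k k f" "C_k k g" using Suc.prems by (auto intro: C_k_Suc_imp simp del: C_k.simps)
    moreover have "C_k k (pd i f)" "C_k k (pd i g)" using Suc.prems that unfolding C_k_Suc by auto
    ultimately show ?thesis
      using C_k_lin[OF Suc.IH[of f "pd i g"] Suc.IH[of "pd i f" g], of 1] by simp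
  qed
  then show ?case using Suc.prems unfolding C_k_Suc eq by auto
qed

lemma C_k_const: "C_k k (\<lambda>x::'a::euclidean_space. c::real)"
proof (induction k arbitrary: c)
  case (Suc k)
  have "pd i (\<lambda>x::'a. c) = (\<lambda>x. 0)" for i
    by (rule ext) (simp add: pd_def)
  then show ?case unfolding C_k_Suc using Suc by simp
qed simp

lemma C_k_inner: "C_k k (\<lambda>x::'a::euclidean_space. x \<bullet> e)"
proof (cases k)
  case (Suc k')
  have "pd i (\<lambda>x::'a. x \<bullet> e) = (\<lambda>x. i \<bullet> e)" for i
    by (intro ext pd_unique) (auto intro!: derivative_eq_intros)
  then show ?thesis unfolding Suc C_k_Suc by (simp add: C_k_const)
qed (auto intro!: continuous_intros)

lemma C_k_sin_cos:
  fixes f :: "'a::euclidean_space \<Rightarrow> real"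
  shows "C_k k f \<Longrightarrow> C_k k (\<lambda>x. sin (f x)) \<and> C_k k (\<lambda>x. cos (f x))"
proof (induction k)
  case 0
  then show ?case by (auto intro!: continuous_intros)
next
  case (Suc k)
  have s: "pd i (\<lambda>x. sin (f x)) = (\<lambda>x. cos (f x) * pd i f x)"
    and c: "pd i (\<lambda>x. cos (f x)) = (\<lambda>x. - 1 * sin (f x) * pd i f x)" for i
    using Suc.prems by (intro ext pd_sin pd_cos; auto)+
  have IH: "C_k k (\<lambda>x. sin (f x))" "C_k k (\<lambda>x. cos (f x))" using Suc C_k_Suc_imp by blast+
  have d: "(\<lambda>x. sin (f x)) differentiable at x" "(\<lambda>x. cos (f x)) differentiable at x" for x
    using Suc.prems has_derivative_sin[OF has_derivative_pd_expand[of f x]]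
      has_derivative_cos[OF has_derivative_pd_expand[of f x]]
    unfolding differentiable_def C_k_Suc by blast+
  have "C_k k (pd i f)" if "i \<in> Basis" for i using Suc.prems that unfolding C_k_Suc by auto
  then show ?case unfolding C_k_Suc s c using d IH by (intro conjI allI ballI C_k_mult C_k_const) auto
qed

definition smooth :: "('a::euclidean_space \<Rightarrow> real) \<Rightarrow> bool" where
  "smooth f \<longleftrightarrow> (\<forall>k. C_k k f)"

lemma smooth_continuous: "smooth f \<Longrightarrow> continuous_on UNIV f"
  unfolding smooth_def by (metis C_k.simps(1))

lemma smooth_differentiable: "smooth f \<Longrightarrow> f differentiable at x"
  unfolding smooth_def by (metis C_k_Suc)

lemma smooth_pd: "smooth f \<Longrightarrow> i \<in> Basis \<Longrightarrow> smooth (pd i f)"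
  unfolding smooth_def by (metis C_k_Suc)

lemma smooth_lin: "smooth f \<Longrightarrow> smooth g \<Longrightarrow> smooth (\<lambda>x. c * f x + g x)"
  unfolding smooth_def by (auto intro: C_k_lin)

lemma smooth_mult: "smooth f \<Longrightarrow> smooth g \<Longrightarrow> smooth (\<lambda>x. f x * g x)"
  unfolding smooth_def by (auto intro: C_k_mult)

lemma smooth_const: "smooth (\<lambda>x. c)"
  unfolding smooth_def by (auto intro: C_k_const)

lemma smooth_inner: "smooth (\<lambda>x. x \<bullet> e)"
  unfolding smooth_def by (auto intro: C_k_inner)

lemma smooth_sin: "smooth f \<Longrightarrow> smooth (\<lambda>x. sin (f x))"
  and smooth_cos: "smooth f \<Longrightarrow> smooth (\<lambda>x. cos (f x))"
  unfolding smooth_def by (auto dest: C_k_sin_cos)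

text \<open>Any compact set outside of which the function vanishes will do, so supports of sums,
  products and derivatives need not be computed.\<close>

lemma compactly_supported_in_iff:
  "compactly_supported_in U f \<longleftrightarrow> (\<exists>K. compact K \<and> K \<subseteq> U \<and> (\<forall>x. x \<notin> K \<longrightarrow> f x = 0))"
proof
  assume "compactly_supported_in U f"
  then show "\<exists>K. compact K \<and> K \<subseteq> U \<and> (\<forall>x. x \<notin> K \<longrightarrow> f x = 0)"
    unfolding compactly_supported_in_def using closure_subset[of "{x. f x \<noteq> 0}"] by blast
next
  assume "\<exists>K. compact K \<and> K \<subseteq> U \<and> (\<forall>x. x \<notin> K \<longrightarrow> f x = 0)"
  then obtain K where K: "compact K" "K \<subseteq> U" "\<forall>x. x \<notin> K \<longrightarrow> f x = 0" by blast
  then have "closure {x. f x \<noteq> 0} \<subseteq> K"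
    by (intro closure_minimal compact_imp_closed) auto
  moreover from this have "compact (closure {x. f x \<noteq> 0})"
    using compact_Int_closed[OF K(1) closed_closure[of "{x. f x \<noteq> 0}"]] by (simp add: Int_absorb1)
  ultimately show "compactly_supported_in U f"
    unfolding compactly_supported_in_def using K by auto
qed

lemma test_functions_iff:
  "f \<in> tests U \<longleftrightarrow> smooth f \<and> (\<exists>K. compact K \<and> K \<subseteq> U \<and> (\<forall>x. x \<notin> K \<longrightarrow> f x = 0))"
  by (simp add: test_functions_def smooth_def compactly_supported_in_iff)

lemma test_zero: "(\<lambda>x. 0) \<in> tests U"
  unfolding test_functions_iff by (auto intro: smooth_const exI[of _ "{}"])

lemma test_lin:
  assumes "f \<in> tests U" "g \<in> tests U"
  shows "(\<lambda>x. c * f x + g x) \<in> tests U"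
proof -
  obtain K L where "compact K" "K \<subseteq> U" "\<forall>x. x \<notin> K \<longrightarrow> f x = 0" "compact L" "L \<subseteq> U" "\<forall>x. x \<notin> L \<longrightarrow> g x = 0"
    using assms unfolding test_functions_iff by blast
  then show ?thesis
    using assms unfolding test_functions_iff by (auto intro!: smooth_lin exI[of _ "K \<union> L"])
qed

lemma test_mult: "f \<in> tests U \<Longrightarrow> smooth g \<Longrightarrow> (\<lambda>x. f x * g x) \<in> tests U"
  unfolding test_functions_iff by (auto intro!: smooth_mult)

lemma test_sin: "f \<in> tests U \<Longrightarrow> (\<lambda>x. sin (f x)) \<in> tests U"
  unfolding test_functions_iff by (auto intro!: smooth_sin)

lemma pd_eq_0_outside:
  assumes "compact K" "\<forall>x. x \<notin> K \<longrightarrow> f x = 0" "x \<notin> K"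
  shows "pd i f x = 0"
proof -
  have "open (- K)" "x \<in> - K" using assms by (auto intro: compact_imp_closed open_Compl)
  then have "(f has_derivative (\<lambda>_. 0)) (at x)"
    using assms(2) by (intro has_derivative_transform_within_open[of "\<lambda>_. 0" "\<lambda>_. 0" x UNIV "- K" f]) auto
  from pd_unique[OF this] show ?thesis by simp
qed

lemma test_pd: "f \<in> tests U \<Longrightarrow> i \<in> Basis \<Longrightarrow> pd i f \<in> tests U"
  unfolding test_functions_iff using pd_eq_0_outside smooth_pd by blast

lemma test_continuous: "f \<in> tests U \<Longrightarrow> continuous_on UNIV f"
  unfolding test_functions_iff using smooth_continuous by blast

text \<open>The reduction to \<open>lborel\<close> gives access to translation invariance, on which
  integration by parts rests.\<close>

lemma continuous_compact_support:
  fixes f :: "'a::euclidean_space \<Rightarrow> 'b::euclidean_space"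
  assumes cont: "continuous_on UNIV f" and K: "compact K" "K \<subseteq> U" "\<forall>x. x \<notin> K \<longrightarrow> f x = 0"
    and U: "U \<in> sets lebesgue"
  shows "integrable lborel f" "integrable (leb U) f"
    "(LINT x|leb U. f x) = (LINT x|lborel. f x)"
proof -
  have eqK: "(\<lambda>x. indicator K x *\<^sub>R f x) = f" and eq: "(\<lambda>x. indicator U x *\<^sub>R f x) = f"
    using K by (auto simp: indicator_def fun_eq_iff)
  show 1: "integrable lborel f"
    using borel_integrable_compact[of K f] K continuous_on_subset[OF cont] eqK by (simp add: set_integrable_def)
  then have 2: "integrable lebesgue f" by (simp add: integrable_completion)
  show "integrable (leb U) f"
    using 2 U by (subst integrable_restrict_space) (auto simp: eq)
  show "(LINT x|leb U. f x) = (LINT x|lborel. f x)"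
    using 1 U by (subst integral_restrict_space) (auto simp: eq integral_completion)
qed

lemma continuous_compact_support_L2:
  fixes f :: "'a::euclidean_space \<Rightarrow> 'b::euclidean_space"
  assumes "continuous_on UNIV f" "compact K" "K \<subseteq> U" "\<forall>x. x \<notin> K \<longrightarrow> f x = 0"
    and "U \<in> sets lebesgue"
  shows "f \<in> L2 U"
proof -
  have "f \<in> meas U"
    using continuous_compact_support(2)[OF assms] by (rule borel_measurable_integrable)
  moreover have "integrable (leb U) (\<lambda>x. (norm (f x))\<^sup>2)"
    by (rule continuous_compact_support(2)[of _ K]) (use assms in \<open>auto intro!: continuous_intros\<close>)
  ultimately show ?thesis by (simp add: L2_def)
qed

lemma test_L2: "U \<in> sets lebesgue \<Longrightarrow> f \<in> tests U \<Longrightarrow> f \<in> L2 U"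
  using continuous_compact_support_L2[OF test_continuous] unfolding test_functions_iff by blast

text \<open>The derivative is the limit of difference quotients, whose integrals vanish by translation
  invariance.\<close>

lemma integral_pd_eq_0:
  fixes f :: "'a::euclidean_space \<Rightarrow> real"
  assumes f: "f \<in> tests U" and i: "i \<in> Basis"
  shows "(LINT x|lborel. pd i f x) = 0"
proof -
  obtain K where K: "compact K" "K \<subseteq> U" "\<forall>x. x \<notin> K \<longrightarrow> f x = 0"
    using f unfolding test_functions_iff by blast
  have smooth: "smooth f" using f unfolding test_functions_iff by blast
  have contf: "continuous_on UNIV f" "continuous_on UNIV (pd i f)"
    using f i test_pd test_continuous by blast+
  have intf: "integrable lborel f"
    using continuous_compact_support(1)[of f K UNIV] contf(1) K by auto
  have pd0: "pd i f x = 0" if "x \<notin> K" for x using pd_eq_0_outside K that by blast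
  have "compact (pd i f ` K)"
    using contf(2) K(1) by (metis compact_continuous_image continuous_on_subset subset_UNIV)
  then have "bounded (pd i f ` K)" by (rule compact_imp_bounded)
  then obtain B0 where B0: "\<And>x. x \<in> K \<Longrightarrow> \<bar>pd i f x\<bar> \<le> B0"
    unfolding bounded_iff by auto
  define B where "B = \<bar>B0\<bar>"
  have B: "\<bar>pd i f x\<bar> \<le> B" for x
    using B0[of x] pd0[of x] unfolding B_def by (cases "x \<in> K") auto
  define t where "t n = inverse (real (Suc n))" for n
  have t: "0 < t n" "t n \<le> 1" for n by (auto simp: t_def field_simps)
  have t0: "filterlim t (at 0) sequentially"
    unfolding filterlim_at using LIMSEQ_inverse_real_of_nat t(1)
    by (auto simp: t_def[abs_def] simp del: of_nat_Suc intro!: always_eventually)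
  define q where "q n x = (f (x + t n *\<^sub>R i) - f x) / t n" for n x
  have deriv: "((\<lambda>s. f (x + s *\<^sub>R i)) has_real_derivative pd i f (x + s *\<^sub>R i)) (at s)" for x s
  proof -
    have d: "(f has_derivative frechet_derivative f (at (x + s *\<^sub>R i))) (at (x + s *\<^sub>R i))"
      using smooth by (intro has_derivative_pd_expand smooth_differentiable)
    have "((\<lambda>s. f (x + s *\<^sub>R i)) has_derivative (\<lambda>h. frechet_derivative f (at (x + s *\<^sub>R i)) (h *\<^sub>R i))) (at s)"
      by (rule has_derivative_compose[of "\<lambda>s. x + s *\<^sub>R i" "\<lambda>h. h *\<^sub>R i" s UNIV, OF _ d])
         (auto intro!: derivative_eq_intros)
    moreover have "(\<lambda>h. frechet_derivative f (at (x + s *\<^sub>R i)) (h *\<^sub>R i)) = (*) (pd i f (x + s *\<^sub>R i))"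
      by (rule ext) (simp add: pd_def linear_cmul[OF has_derivative_linear[OF d]])
    ultimately show ?thesis by (simp add: has_field_derivative_def)
  qed
  have q_lim: "(\<lambda>n. q n x) \<longlonglongrightarrow> pd i f x" for x
  proof -
    have "((\<lambda>h. (f (x + h *\<^sub>R i) - f x) / h) \<longlongrightarrow> pd i f x) (at 0)"
      using deriv[of x 0] by (simp add: DERIV_def)
    from filterlim_compose[OF this t0] show ?thesis by (simp add: q_def)
  qed
  have q_bound: "\<bar>q n x\<bar> \<le> B" for n x
  proof -
    obtain z where "f (x + t n *\<^sub>R i) - f (x + 0 *\<^sub>R i) = (t n - 0) * pd i f (x + z *\<^sub>R i)"
      using MVT2[of 0 "t n" "\<lambda>s. f (x + s *\<^sub>R i)" "\<lambda>s. pd i f (x + s *\<^sub>R i)"] deriv t(1)[of n] by blast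
    then have "q n x = pd i f (x + z *\<^sub>R i)" using t(1)[of n] by (simp add: q_def)
    then show ?thesis using B by simp
  qed
  \<comment> \<open>Since \<open>t n \<le> 1\<close>, all difference quotients vanish outside the
    unit neighbourhood of \<open>K\<close>; this one compact set yields the dominating
    function.\<close>
  define K' where "K' = {x + y |x y. x \<in> K \<and> y \<in> cball 0 1}"
  have K': "compact K'" unfolding K'_def by (intro compact_sums K) auto
  have qK': "q n x = 0" if "x \<notin> K'" for n x
  proof -
    have "x \<notin> K" using that unfolding K'_def by force
    moreover have "x + t n *\<^sub>R i \<notin> K"
    proof
      assume "x + t n *\<^sub>R i \<in> K"
      moreover have "norm (- (t n *\<^sub>R i)) \<le> 1" using t[of n] i by simp
      ultimately have "x \<in> K'" unfolding K'_def
        by (intro CollectI exI[of _ "x + t n *\<^sub>R i"] exI[of _ "- (t n *\<^sub>R i)"]) auto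
      then show False using that by simp
    qed
    ultimately show ?thesis using K by (simp add: q_def)
  qed
  have meas: "f \<in> borel_measurable borel" "pd i f \<in> borel_measurable borel"
    using contf by (auto intro: borel_measurable_continuous_onI)
  have int0: "(LINT x|lborel. q n x) = 0" for n
  proof -
    have "(LINT x|lborel. f x) = (LINT x|distr lborel borel ((+) (t n *\<^sub>R i)). f x)"
      by (simp add: lborel_distr_plus)
    also have "\<dots> = (LINT x|lborel. f (t n *\<^sub>R i + x))"
      using meas by (subst integral_distr) auto
    finally have 1: "(LINT x|lborel. f (x + t n *\<^sub>R i)) = (LINT x|lborel. f x)" by (simp add: add.commute)
    have "integrable (distr lborel borel ((+) (t n *\<^sub>R i))) f"
      using intf by (simp add: lborel_distr_plus)
    then have "integrable lborel (\<lambda>x. f (x + t n *\<^sub>R i))"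
      using meas by (subst (asm) integrable_distr_eq) (auto simp: add.commute)
    with intf 1 show ?thesis by (simp add: q_def)
  qed
  have "(\<lambda>n. LINT x|lborel. q n x) \<longlonglongrightarrow> (LINT x|lborel. pd i f x)"
  proof (rule integral_dominated_convergence)
    show "integrable lborel (\<lambda>x. B * indicat_real K' x)"
      using K' emeasure_bounded_finite[OF compact_imp_bounded[OF K']]
      by (intro integrable_mult_right integrable_real_indicator) (auto intro: borel_compact)
    show "AE x in lborel. norm (q n x) \<le> B * indicat_real K' x" for n
      using q_bound[of n] qK'[of _ n] by (auto simp: indicator_def)
  qed (use meas q_lim in \<open>auto simp: q_def\<close>)
  then show ?thesis by (simp add: int0 LIMSEQ_const_iff)
qed

lemma integration_by_parts:
  assumes U: "U \<in> sets lebesgue" and f: "f \<in> tests U" and g: "g \<in> tests U" and i: "i \<in> Basis"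
  shows "(LINT x|leb U. f x * pd i g x) = - (LINT x|leb U. pd i f x * g x)"
proof -
  have sm: "smooth f" "smooth g" using f g unfolding test_functions_iff by auto
  have t: "(\<lambda>x. f x * g x) \<in> tests U" using test_mult f sm by blast
  have "pd i (\<lambda>x. f x * g x) \<in> tests U" using test_pd t i by blast
  then have "(LINT x|leb U. pd i (\<lambda>x. f x * g x) x) = (LINT x|lborel. pd i (\<lambda>x. f x * g x) x)"
    using continuous_compact_support(3)[OF test_continuous, of "pd i (\<lambda>x. f x * g x)"] U
    unfolding test_functions_iff by blast
  also have "\<dots> = 0" by (rule integral_pd_eq_0[OF t i])
  also have "pd i (\<lambda>x. f x * g x) = (\<lambda>x. f x * pd i g x + pd i f x * g x)"
    using sm by (intro ext pd_mult smooth_differentiable)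
  finally have "(LINT x|leb U. f x * pd i g x + pd i f x * g x) = 0" .
  moreover have "integrable (leb U) (\<lambda>x. f x * pd i g x)" "integrable (leb U) (\<lambda>x. pd i f x * g x)"
    using f g i U by (auto intro!: L2_integrable_times test_L2 test_pd)
  ultimately show ?thesis by simp
qed

subsection \<open>Sobolev spaces\<close>

lemma tendsto_0_squeeze:
  fixes f g :: "nat \<Rightarrow> real"
  assumes "g \<longlonglongrightarrow> 0" "\<And>n. 0 \<le> f n" "\<And>n. f n \<le> g n"
  shows "f \<longlonglongrightarrow> 0"
  by (rule tendsto_sandwich[OF _ _ tendsto_const assms(1)]) (use assms(2,3) in simp_all)

definition grad :: "('a::euclidean_space \<Rightarrow> real) \<Rightarrow> 'a \<Rightarrow> 'a" where
  "grad f x = (\<Sum>i\<in>Basis. pd i f x *\<^sub>R i)"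

lemma grad_inner: "i \<in> Basis \<Longrightarrow> grad f x \<bullet> i = pd i f x"
  by (simp add: grad_def inner_sum_left inner_Basis if_distrib[of "(*) _"] cong: if_cong)

lemma grad_eqI: "(\<And>i. i \<in> Basis \<Longrightarrow> pd i f x = v \<bullet> i) \<Longrightarrow> grad f x = v"
  by (rule euclidean_eqI) (simp add: grad_inner)

lemma is_weak_gradient_pd:
  "is_weak_gradient U u g \<longleftrightarrow> g \<in> L2 U \<and>
     (\<forall>p\<in>tests U. \<forall>i\<in>Basis.
        (LINT x|leb U. u x * pd i p x) = - (LINT x|leb U. (g x \<bullet> i) * p x))"
  by (simp add: is_weak_gradient_def pd_def)

lemma weak_gradient_L2: "is_weak_gradient U u g \<Longrightarrow> g \<in> L2 U"
  by (simp add: is_weak_gradient_def)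

lemma L2_inner_const:
  fixes g :: "'a::euclidean_space \<Rightarrow> 'b::euclidean_space"
  assumes "g \<in> L2 U" shows "(\<lambda>x. g x \<bullet> i) \<in> L2 U"
proof (rule L2_bound[OF assms, of _ "norm i"])
  show "(\<lambda>x. g x \<bullet> i) \<in> meas U"
    using L2_measurable[OF assms] by measurable
  show "AE x in leb U. norm (g x \<bullet> i) \<le> norm i * norm (g x)"
    using Cauchy_Schwarz_ineq2[of "g _" i] by (simp add: mult.commute[of "norm i"])
qed

lemma weak_grad_is: "u \<in> H1 U \<Longrightarrow> is_weak_gradient U u (weak_grad U u)"
  unfolding H1_def weak_grad_def by (auto intro: someI[of "is_weak_gradient U u"])

lemma H1_L2: "u \<in> H1 U \<Longrightarrow> u \<in> L2 U"
  by (simp add: H1_def)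

lemma weak_grad_L2: "u \<in> H1 U \<Longrightarrow> weak_grad U u \<in> L2 U"
  using weak_grad_is weak_gradient_L2 by blast

lemma H1I: "u \<in> L2 U \<Longrightarrow> is_weak_gradient U u g \<Longrightarrow> u \<in> H1 U"
  by (auto simp: H1_def)

lemma H10_H1: "u \<in> H10 U \<Longrightarrow> u \<in> H1 U"
  by (simp add: H10_def)

lemma weak_gradient_lin:
  assumes U: "U \<in> sets lebesgue" and u: "u \<in> L2 U" "is_weak_gradient U u g"
    and v: "v \<in> L2 U" "is_weak_gradient U v h"
  shows "is_weak_gradient U (\<lambda>x. c *\<^sub>R u x + v x) (\<lambda>x. c *\<^sub>R g x + h x)"
  unfolding is_weak_gradient_pd
proof (intro conjI ballI)
  have g: "g \<in> L2 U" "h \<in> L2 U" using u v weak_gradient_L2 by auto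
  then show "(\<lambda>x. c *\<^sub>R g x + h x) \<in> L2 U" by (rule L2_lin)
  fix p and i :: 'a assume p: "p \<in> tests U" and i: "i \<in> Basis"
  have L: "p \<in> L2 U" "pd i p \<in> L2 U" using p i U by (auto intro: test_L2 test_pd)
  have "(LINT x|leb U. (c *\<^sub>R u x + v x) * pd i p x) =
      c * (LINT x|leb U. u x * pd i p x) + (LINT x|leb U. v x * pd i p x)"
    using u v L by (simp add: algebra_simps L2_integrable_times)
  also have "\<dots> = c * - (LINT x|leb U. (g x \<bullet> i) * p x) + - (LINT x|leb U. (h x \<bullet> i) * p x)"
    using u v p i unfolding is_weak_gradient_pd by simp
  also have "\<dots> = - (LINT x|leb U. c * ((g x \<bullet> i) * p x) + (h x \<bullet> i) * p x)"
    using g L by (simp add: L2_integrable_times L2_inner_const)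
  finally show "(LINT x|leb U. (c *\<^sub>R u x + v x) * pd i p x) =
      - (LINT x|leb U. (c *\<^sub>R g x + h x) \<bullet> i * p x)"
    by (simp add: inner_add_left algebra_simps)
qed

lemma grad_test:
  assumes "f \<in> tests U" "U \<in> sets lebesgue"
  shows "grad f \<in> L2 U" "is_weak_gradient U f (grad f)"
proof -
  obtain K where K: "compact K" "K \<subseteq> U" "\<forall>x. x \<notin> K \<longrightarrow> f x = 0"
    using assms unfolding test_functions_iff by blast
  have cont: "continuous_on UNIV (grad f)"
    unfolding grad_def using assms test_pd test_continuous by (fastforce intro!: continuous_intros)
  have "\<forall>x. x \<notin> K \<longrightarrow> grad f x = 0"
    unfolding grad_def using pd_eq_0_outside[OF K(1,3)] by simp
  then show L: "grad f \<in> L2 U"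
    using continuous_compact_support_L2[OF cont K(1,2) _ assms(2)] by blast
  show "is_weak_gradient U f (grad f)"
    unfolding is_weak_gradient_pd using L integration_by_parts[OF assms(2,1)] by (simp add: grad_inner)
qed

text \<open>Density of the test functions in \<open>L2 U\<close> makes weak gradients unique. It is an assumption here
  because in the application it is immediate: there, functions in \<open>H10 U\<close> form an orthonormal basis.\<close>

locale sobolev =
  fixes U :: "'a::euclidean_space set"
  assumes lebesgue: "U \<in> sets lebesgue"
    and dense: "f \<in> L2 U \<Longrightarrow> (\<And>p. p \<in> tests U \<Longrightarrow> ip U f p = 0) \<Longrightarrow>
      AE x in leb U. (f x :: real) = 0"
begin

lemma weak_gradient_unique:
  assumes g: "is_weak_gradient U u g" and h: "is_weak_gradient U u h"
  shows "AE x in leb U. g x = h x"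
proof -
  have L: "g \<in> L2 U" "h \<in> L2 U" using g h weak_gradient_L2 by auto
  have "AE x in leb U. g x \<bullet> i - h x \<bullet> i = 0" if i: "i \<in> Basis" for i
  proof (rule dense)
    show "(\<lambda>x. g x \<bullet> i - h x \<bullet> i) \<in> L2 U" using L by (intro L2.diff_mem L2_inner_const)
    fix p assume p: "p \<in> tests U"
    have "ip U (\<lambda>x. g x \<bullet> i - h x \<bullet> i) p = (LINT x|leb U. (g x \<bullet> i) * p x) - (LINT x|leb U. (h x \<bullet> i) * p x)"
      using L2.diff_left[OF L2_inner_const[OF L(1), of i] L2_inner_const[OF L(2), of i] test_L2[OF lebesgue p]]
      by (simp add: ip_def)
    also have "\<dots> = 0"
    proof -
      have "(LINT x|leb U. u x * pd i p x) = - (LINT x|leb U. (g x \<bullet> i) * p x)"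
        "(LINT x|leb U. u x * pd i p x) = - (LINT x|leb U. (h x \<bullet> i) * p x)"
        using g h p i unfolding is_weak_gradient_pd by blast+
      then show ?thesis by linarith
    qed
    finally show "ip U (\<lambda>x. g x \<bullet> i - h x \<bullet> i) p = 0" .
  qed
  then have "AE x in leb U. \<forall>i\<in>Basis. g x \<bullet> i - h x \<bullet> i = 0"
    by (intro AE_finite_allI) auto
  then show ?thesis by eventually_elim (auto intro: euclidean_eqI)
qed

lemma weak_grad_AE:
  assumes "u \<in> L2 U" "is_weak_gradient U u g"
  shows "AE x in leb U. weak_grad U u x = g x"
  using weak_gradient_unique weak_grad_is H1I assms by blast

lemma H1_lin: "u \<in> H1 U \<Longrightarrow> v \<in> H1 U \<Longrightarrow> (\<lambda>x. c *\<^sub>R u x + v x) \<in> H1 U"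
  by (rule H1I[OF L2_lin weak_gradient_lin[OF lebesgue]]) (auto intro: weak_grad_is H1_L2)

lemma H1_zero: "(\<lambda>x. 0) \<in> H1 U"
  using grad_test[OF test_zero lebesgue] L2_zero H1I by blast

lemma dirichlet_form_ip: "dir U u v = ip U (weak_grad U u) (weak_grad U v)"
  by (simp add: dirichlet_form_def ip_def)

text \<open>\<open>weak_grad\<close> is a choice by \<open>SOME\<close> and hence not literally
  linear. Uniqueness almost everywhere allows any weak gradient in its place, which is how
  bilinearity of the form is obtained.\<close>

lemma dirichlet_form_eq:
  assumes "u \<in> L2 U" "is_weak_gradient U u g" "v \<in> L2 U" "is_weak_gradient U v h"
  shows "dir U u v = ip U g h"
  unfolding dirichlet_form_ip
  by (rule ip_cong_AE) (use assms in \<open>auto intro: weak_grad_AE weak_gradient_L2 weak_grad_L2 H1I\<close>)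

sublocale D: sym_form "H1 U" "dir U"
proof
  fix u v z :: "'a \<Rightarrow> real" and c
  assume *: "u \<in> H1 U" "v \<in> H1 U" "z \<in> H1 U"
  have "dir U (\<lambda>x. c *\<^sub>R u x + v x) z = ip U (\<lambda>x. c *\<^sub>R weak_grad U u x + weak_grad U v x) (weak_grad U z)"
    by (intro dirichlet_form_eq L2_lin weak_gradient_lin weak_grad_is H1_L2 lebesgue *)
  then show "dir U (\<lambda>x. c *\<^sub>R u x + v x) z = c * dir U u z + dir U v z"
    using * by (simp add: L2.lin weak_grad_L2 dirichlet_form_ip)
qed (auto simp: H1_zero dirichlet_form_ip weak_grad_L2 L2.sym L2.nonneg intro: H1_lin[simplified])

text \<open>The inner product behind \<open>H1_norm\<close>, introduced so that the triangle
  inequality comes from the locale of forms.\<close>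

definition h1 :: "('a \<Rightarrow> real) \<Rightarrow> ('a \<Rightarrow> real) \<Rightarrow> real" where
  "h1 u v = ip U u v + dir U u v"

sublocale h1: sym_form "H1 U" h1
proof
  fix u v z :: "'a \<Rightarrow> real" and c
  assume *: "u \<in> H1 U" "v \<in> H1 U" "z \<in> H1 U"
  then show "h1 (\<lambda>x. c *\<^sub>R u x + v x) z = c * h1 u z + h1 v z"
    unfolding h1_def by (simp only: L2.lin D.lin H1_L2) (simp add: algebra_simps)
qed (auto simp: H1_zero h1_def H1_L2 L2.sym L2.nonneg D.sym D.nonneg intro: H1_lin[simplified])

lemma D_nrm: "D.nrm u = L2_norm U (weak_grad U u)"
  unfolding D.nrm_def dirichlet_form_ip L2_norm_power2_ip[symmetric] by simp

lemma h1_nrm: "h1.nrm u = H1_norm U u"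
  unfolding h1.nrm_def h1_def dirichlet_form_ip H1_norm_def L2_norm_power2_ip ..

lemma L2_norm_le_H1_norm: "L2_norm U u \<le> H1_norm U u"
  unfolding H1_norm_def by (rule real_le_rsqrt) simp

lemma grad_le_H1_norm: "D.nrm u \<le> H1_norm U u"
  unfolding H1_norm_def D_nrm by (rule real_le_rsqrt) simp

lemma H1_norm_nonneg: "0 \<le> H1_norm U u"
  by (simp add: H1_norm_def)

lemma H1_norm_le: "H1_norm U u \<le> L2_norm U u + D.nrm u"
  unfolding H1_norm_def D_nrm by (rule sqrt_sum_squares_le_sum) auto

lemma test_H1: "p \<in> tests U \<Longrightarrow> p \<in> H1 U"
  using grad_test test_L2 lebesgue H1I by blast

lemma test_H10: "p \<in> tests U \<Longrightarrow> p \<in> H10 U"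
  unfolding H10_def using test_H1 h1.zero_left[OF h1.zero_mem]
  by (auto intro!: exI[of _ "\<lambda>_. p"] simp: h1_nrm[symmetric] h1.nrm_def)

lemma H1_norm_tendsto_iff:
  assumes "\<And>n. u n \<in> H1 U" "v \<in> H1 U"
  shows "(\<lambda>n. H1_norm U (\<lambda>x. u n x - v x)) \<longlonglongrightarrow> 0 \<longleftrightarrow>
    L2_tendsto U u v \<and> (\<lambda>n. D.nrm (\<lambda>x. u n x - v x)) \<longlonglongrightarrow> 0"
proof (intro iffI conjI)
  assume *: "(\<lambda>n. H1_norm U (\<lambda>x. u n x - v x)) \<longlonglongrightarrow> 0"
  show "L2_tendsto U u v"
    by (rule tendsto_0_squeeze[OF *]) (simp_all add: L2_norm_le_H1_norm)
  show "(\<lambda>n. D.nrm (\<lambda>x. u n x - v x)) \<longlonglongrightarrow> 0"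
    by (rule tendsto_0_squeeze[OF *], simp add: D_nrm, rule grad_le_H1_norm)
next
  assume *: "L2_tendsto U u v \<and> (\<lambda>n. D.nrm (\<lambda>x. u n x - v x)) \<longlonglongrightarrow> 0"
  have "(\<lambda>n. L2_norm U (\<lambda>x. u n x - v x) + D.nrm (\<lambda>x. u n x - v x)) \<longlonglongrightarrow> 0"
    using tendsto_add[OF conjunct1[OF *] conjunct2[OF *]] by simp
  then show "(\<lambda>n. H1_norm U (\<lambda>x. u n x - v x)) \<longlonglongrightarrow> 0"
    by (rule tendsto_0_squeeze) (rule H1_norm_nonneg, rule H1_norm_le)
qed

lemma D_nrm_diff:
  assumes "u \<in> L2 U" "is_weak_gradient U u g" "v \<in> L2 U" "is_weak_gradient U v h"
  shows "D.nrm (\<lambda>x. u x - v x) = L2_norm U (\<lambda>x. g x - h x)"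
proof -
  have "(\<lambda>x. u x - v x) \<in> L2 U" using assms by (intro L2.diff_mem)
  moreover have "is_weak_gradient U (\<lambda>x. u x - v x) (\<lambda>x. g x - h x)"
    using weak_gradient_lin[OF lebesgue assms(3,4,1,2), of "-1"] by simp
  ultimately show ?thesis
    unfolding D.nrm_def L2_nrm_eq[symmetric] L2.nrm_def by (simp add: dirichlet_form_eq)
qed

lemma H10_lin:
  assumes "u \<in> H10 U" "v \<in> H10 U"
  shows "(\<lambda>x. c *\<^sub>R u x + v x) \<in> H10 U"
proof -
  obtain p \<xi> where p: "\<And>n. p n \<in> tests U" "(\<lambda>n. H1_norm U (\<lambda>x. p n x - u x)) \<longlonglongrightarrow> 0"
    and \<xi>: "\<And>n. \<xi> n \<in> tests U" "(\<lambda>n. H1_norm U (\<lambda>x. \<xi> n x - v x)) \<longlonglongrightarrow> 0"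
    using assms unfolding H10_def by auto
  have uv: "u \<in> H1 U" "v \<in> H1 U" using assms H10_H1 by auto
  have le: "H1_norm U (\<lambda>x. (c * p n x + \<xi> n x) - (c *\<^sub>R u x + v x)) \<le>
      \<bar>c\<bar> * H1_norm U (\<lambda>x. p n x - u x) + H1_norm U (\<lambda>x. \<xi> n x - v x)" for n
  proof -
    have m: "(\<lambda>x. p n x - u x) \<in> H1 U" "(\<lambda>x. \<xi> n x - v x) \<in> H1 U"
      using p(1) \<xi>(1) uv test_H1 by (auto intro: h1.diff_mem)
    from h1.nrm_triangle[OF h1.scale_mem[OF m(1), of c] m(2)] h1.nrm_scale[OF m(1), of c]
    show ?thesis by (simp add: h1_nrm algebra_simps)
  qed
  have "(\<lambda>n. \<bar>c\<bar> * H1_norm U (\<lambda>x. p n x - u x) + H1_norm U (\<lambda>x. \<xi> n x - v x)) \<longlonglongrightarrow> 0"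
    using tendsto_add[OF tendsto_mult_left[OF p(2), of "\<bar>c\<bar>"] \<xi>(2)] by simp
  then have "(\<lambda>n. H1_norm U (\<lambda>x. (c * p n x + \<xi> n x) - (c *\<^sub>R u x + v x))) \<longlonglongrightarrow> 0"
    by (rule tendsto_0_squeeze) (rule H1_norm_nonneg, rule le)
  moreover have "(\<lambda>x. c * p n x + \<xi> n x) \<in> tests U" for n using p \<xi> by (intro test_lin)
  ultimately show ?thesis unfolding H10_def using H1_lin[OF uv] by (auto intro!: exI[of _ "\<lambda>n x. c * p n x + \<xi> n x"])
qed

lemma H10_zero: "(\<lambda>x. 0) \<in> H10 U"
  using test_H10 test_zero by blast

text \<open>The weak gradient is a closed operator: both sides of the integration by parts identity
  pass to \<open>L2\<close> limits. That \<open>u\<close> stays in \<open>H10 U\<close> follows by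
  choosing for each \<open>n\<close> a test function within \<open>1 / (n + 1)\<close> of
  \<open>v n\<close>. The limit \<open>h\<close> of the gradients is not assumed to be a weak
  gradient beforehand.\<close>

lemma H10_closed:
  assumes v: "\<And>n. v n \<in> H10 U" "\<And>n. is_weak_gradient U (v n) (g n)" and u: "u \<in> L2 U" and h: "h \<in> L2 U"
    and vu: "L2_tendsto U v u" and gh: "L2_tendsto U g h"
  shows "u \<in> H10 U" "is_weak_gradient U u h" "(\<lambda>n. H1_norm U (\<lambda>x. v n x - u x)) \<longlonglongrightarrow> 0"
proof -
  have v1: "v n \<in> H1 U" "v n \<in> L2 U" "g n \<in> L2 U" for n
    using v H10_H1 H1_L2 weak_gradient_L2 by blast+
  show wg: "is_weak_gradient U u h"
    unfolding is_weak_gradient_pd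
  proof (intro conjI h ballI)
    fix p and i :: 'a assume p: "p \<in> tests U" and i: "i \<in> Basis"
    have L: "p \<in> L2 U" "pd i p \<in> L2 U" using p i lebesgue by (auto intro: test_L2 test_pd)
    have "(\<lambda>n. ip U (v n) (pd i p)) \<longlonglongrightarrow> ip U u (pd i p)"
      by (rule L2.tendsto_form) (use v1 u L vu in \<open>auto simp: L2_nrm_eq L2_norm_def\<close>)
    moreover have "(\<lambda>n. ip U (\<lambda>x. g n x \<bullet> i) p) \<longlonglongrightarrow> ip U (\<lambda>x. h x \<bullet> i) p"
    proof (rule L2.tendsto_form)
      have le: "L2_norm U (\<lambda>x. g n x \<bullet> i - h x \<bullet> i) \<le> L2_norm U (\<lambda>x. g n x - h x)" for n
        using v1 h i Basis_le_norm[OF i]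
        by (intro L2_norm_mono L2.diff_mem L2_inner_const) (auto simp flip: inner_diff_left)
      show "(\<lambda>n. L2.nrm U (\<lambda>x. g n x \<bullet> i - h x \<bullet> i)) \<longlonglongrightarrow> 0"
        by (rule tendsto_0_squeeze[OF gh]) (simp_all add: L2_nrm_eq le)
    qed (use v1 h L in \<open>auto simp: L2_nrm_eq L2_inner_const L2_norm_def\<close>)
    moreover have "ip U (v n) (pd i p) = - ip U (\<lambda>x. g n x \<bullet> i) p" for n
      using v(2)[of n] p i unfolding is_weak_gradient_pd by (simp add: ip_def)
    ultimately have "(\<lambda>n. - ip U (\<lambda>x. g n x \<bullet> i) p) \<longlonglongrightarrow> ip U u (pd i p)"
      "(\<lambda>n. - ip U (\<lambda>x. g n x \<bullet> i) p) \<longlonglongrightarrow> - ip U (\<lambda>x. h x \<bullet> i) p"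
      by (auto intro: tendsto_minus)
    from LIMSEQ_unique[OF this] show "(LINT x|leb U. u x * pd i p x) = - (LINT x|leb U. h x \<bullet> i * p x)"
      by (simp add: ip_def)
  qed
  then have u1: "u \<in> H1 U" using u H1I by blast
  show conv: "(\<lambda>n. H1_norm U (\<lambda>x. v n x - u x)) \<longlonglongrightarrow> 0"
    using H1_norm_tendsto_iff[OF v1(1) u1] vu gh D_nrm_diff[OF v1(2) v(2) u wg] by simp
  have "\<exists>p. p \<in> tests U \<and> H1_norm U (\<lambda>x. p x - v n x) < inverse (real (Suc n))" for n
  proof -
    obtain p where p: "\<And>m. p m \<in> tests U" "(\<lambda>m. H1_norm U (\<lambda>x. p m x - v n x)) \<longlonglongrightarrow> 0"
      using v(1)[of n] unfolding H10_def by auto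
    from order_tendstoD(2)[OF p(2), of "inverse (real (Suc n))"] obtain m
      where "H1_norm U (\<lambda>x. p m x - v n x) < inverse (real (Suc n))"
      by (auto simp: eventually_sequentially)
    then show ?thesis using p by blast
  qed
  then obtain p where p: "\<And>n. p n \<in> tests U"
    "\<And>n. H1_norm U (\<lambda>x. p n x - v n x) < inverse (real (Suc n))" by metis
  have "(\<lambda>n. H1_norm U (\<lambda>x. p n x - u x)) \<longlonglongrightarrow> 0"
  proof (rule tendsto_0_squeeze)
    show "(\<lambda>n. inverse (real (Suc n)) + H1_norm U (\<lambda>x. v n x - u x)) \<longlonglongrightarrow> 0"
      using tendsto_add[OF LIMSEQ_inverse_real_of_nat conv] by simp
    show "H1_norm U (\<lambda>x. p n x - u x) \<le> inverse (real (Suc n)) + H1_norm U (\<lambda>x. v n x - u x)" for n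
      using h1.nrm_triangle_diff[OF test_H1[OF p(1)] u1 v1(1), of n n] p(2)[of n]
      unfolding h1_nrm by linarith
  qed (rule H1_norm_nonneg)
  then show "u \<in> H10 U" unfolding H10_def using u1 p(1) by blast
qed

lemma H10_approx:
  assumes "u \<in> H10 U"
  obtains p where "\<And>n. p n \<in> tests U" "L2_tendsto U p u"
    "(\<lambda>n. L2_norm U (\<lambda>x. grad (p n) x - weak_grad U u x)) \<longlonglongrightarrow> 0"
    "AE x in leb U. (\<lambda>n. p n x) \<longlonglongrightarrow> u x"
proof -
  have u1: "u \<in> H1 U" using assms H10_H1 by auto
  obtain p where p: "\<And>n. p n \<in> tests U" "(\<lambda>n. H1_norm U (\<lambda>x. p n x - u x)) \<longlonglongrightarrow> 0"
    using assms unfolding H10_def by auto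
  have L: "p n \<in> L2 U" for n using p(1) test_L2 lebesgue by blast
  have 1: "L2_tendsto U p u" "(\<lambda>n. D.nrm (\<lambda>x. p n x - u x)) \<longlonglongrightarrow> 0"
    using H1_norm_tendsto_iff[OF test_H1[OF p(1)] u1] p(2) by auto
  have 2: "(\<lambda>n. L2_norm U (\<lambda>x. grad (p n) x - weak_grad U u x)) \<longlonglongrightarrow> 0"
    using 1(2) D_nrm_diff[OF L grad_test(2)[OF p(1) lebesgue] H1_L2[OF u1] weak_grad_is[OF u1]] by simp
  obtain r where r: "strict_mono (r :: nat \<Rightarrow> nat)" "AE x in leb U. (\<lambda>n. p (r n) x) \<longlonglongrightarrow> u x"
    using L2_norm_tendsto_AE_subseq[OF L H1_L2[OF u1] 1(1)] by blast
  show ?thesis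
    by (rule that[of "\<lambda>n. p (r n)"])
       (use p(1) r LIMSEQ_subseq_LIMSEQ[OF 1(1) r(1)] LIMSEQ_subseq_LIMSEQ[OF 2 r(1)] in \<open>simp_all add: o_def\<close>)
qed

text \<open>Unlike cutting off at a level, this truncation maps test functions to test functions.\<close>

definition trunc :: "real \<Rightarrow> real \<Rightarrow> real" where
  "trunc c t = sin (c * t) / c"

lemma trunc_diff_le: "c > 0 \<Longrightarrow> \<bar>trunc c s - trunc c t\<bar> \<le> \<bar>s - t\<bar>"
proof -
  assume c: "c > 0"
  have "\<bar>sin (c * s) - sin (c * t)\<bar> = 2 * \<bar>sin ((c * s - c * t) / 2)\<bar> * \<bar>cos ((c * s + c * t) / 2)\<bar>"
    by (simp add: sin_diff_sin abs_mult)
  also have "\<dots> \<le> 2 * \<bar>(c * s - c * t) / 2\<bar> * 1"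
    by (intro mult_mono abs_sin_x_le_abs_x abs_cos_le_one) auto
  also have "\<dots> = c * \<bar>s - t\<bar>" using c by (simp add: abs_mult flip: right_diff_distrib)
  finally show ?thesis using c by (simp add: trunc_def field_simps flip: diff_divide_distrib)
qed

lemma trunc_0 [simp]: "trunc c 0 = 0"
  by (simp add: trunc_def)

lemma trunc_le: "c > 0 \<Longrightarrow> \<bar>trunc c t\<bar> \<le> \<bar>t\<bar>"
  using trunc_diff_le[of c t 0] by simp

lemma trunc_bound: "c > 0 \<Longrightarrow> \<bar>trunc c t\<bar> \<le> 1 / c"
  by (simp add: trunc_def divide_right_mono)

lemma trunc_test:
  assumes "p \<in> tests U" "c > 0"
  shows "(\<lambda>x. trunc c (p x)) \<in> tests U"
    "grad (\<lambda>x. trunc c (p x)) = (\<lambda>x. cos (c * p x) *\<^sub>R grad p x)"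
proof -
  have cp: "(\<lambda>x. c * p x) \<in> tests U" using test_lin[OF assms(1) test_zero, of c] by simp
  show "(\<lambda>x. trunc c (p x)) \<in> tests U"
    using test_lin[OF test_sin[OF cp] test_zero, of "1/c"] by (simp add: trunc_def)
  have sm: "smooth p" "smooth (\<lambda>x. c * p x)" "smooth (\<lambda>x. sin (c * p x))" "smooth (\<lambda>x. 0)"
    using assms(1) cp test_sin[OF cp] smooth_const unfolding test_functions_iff by auto
  note d = sm[THEN smooth_differentiable]
  have 0: "pd i (\<lambda>x. 0) x = 0" for i x :: 'a by (simp add: pd_def)
  have "pd i (\<lambda>x. trunc c (p x)) x = cos (c * p x) * pd i p x" for i x
    using pd_lin[OF d(3,4), of i "1/c" x] pd_sin[OF d(2), of i x] pd_lin[OF d(1,4), of i c x] assms(2)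
    by (simp add: 0 trunc_def)
  then show "grad (\<lambda>x. trunc c (p x)) = (\<lambda>x. cos (c * p x) *\<^sub>R grad p x)"
    by (intro ext grad_eqI) (simp add: grad_inner)
qed

lemma L2_cos_scaleR:
  fixes g :: "'a \<Rightarrow> 'b::euclidean_space"
  assumes "g \<in> L2 U" "f \<in> meas U"
  shows "(\<lambda>x. cos (f x) *\<^sub>R g x) \<in> L2 U"
proof (rule L2_bound[OF assms(1), of _ 1])
  have [measurable]: "g \<in> meas U" "f \<in> meas U"
    using assms L2_measurable by auto
  show "(\<lambda>x. cos (f x) *\<^sub>R g x) \<in> meas U"
    by (intro borel_measurable_scaleR borel_measurable_continuous_on[of cos]) (auto intro!: continuous_intros)
qed (auto intro!: mult_left_le_one_le)

lemma trunc_L2: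
  assumes "u \<in> L2 U" "c > 0"
  shows "(\<lambda>x. trunc c (u x)) \<in> L2 U"
proof (rule L2_bound[OF assms(1), of _ 1])
  show "(\<lambda>x. trunc c (u x)) \<in> meas U"
    unfolding trunc_def using L2_measurable[OF assms(1)] assms(2)
    by (intro borel_measurable_continuous_on[of "\<lambda>t. sin (c * t) / c"]) (auto intro!: continuous_intros)
qed (use trunc_le[OF assms(2)] in auto)

text \<open>The chain rule, as \<open>cos (c * t)\<close> is the derivative of
  \<open>trunc c\<close>. It is classical for test functions \<open>p n\<close>. In the limit the
  error splits into \<open>cos (c * p n x)\<close> times the difference of the gradients, controlled
  by \<open>\<bar>cos\<bar> \<le> 1\<close>, and the difference of the cosines times the fixed
  gradient of \<open>u\<close>, controlled by dominated convergence.\<close>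

lemma trunc_H10:
  assumes u: "u \<in> H10 U" and c: "c > 0"
  shows "(\<lambda>x. trunc c (u x)) \<in> H10 U"
    "is_weak_gradient U (\<lambda>x. trunc c (u x)) (\<lambda>x. cos (c * u x) *\<^sub>R weak_grad U u x)"
proof -
  have uL: "u \<in> L2 U" "weak_grad U u \<in> L2 U" using u H10_H1 H1_L2 weak_grad_L2 by blast+
  obtain p where p: "\<And>n. p n \<in> tests U" "L2_tendsto U p u"
    "(\<lambda>n. L2_norm U (\<lambda>x. grad (p n) x - weak_grad U u x)) \<longlonglongrightarrow> 0"
    "AE x in leb U. (\<lambda>n. p n x) \<longlonglongrightarrow> u x"
    using H10_approx[OF u] by blast
  have L: "p n \<in> L2 U" "grad (p n) \<in> L2 U" for n using p(1) test_L2 grad_test lebesgue by blast+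
  have [measurable]: "(\<lambda>x. c * p n x) \<in> meas U" "(\<lambda>x. c * u x) \<in> meas U" for n
    using L2_measurable[OF L(1)] L2_measurable[OF uL(1)] by auto
  have [measurable]: "weak_grad U u \<in> meas U"
    using L2_measurable uL by auto
  have cosm: "(\<lambda>x. cos (f x)) \<in> meas U" if "f \<in> meas U" for f :: "'a \<Rightarrow> real"
    by (rule borel_measurable_continuous_on[OF _ that]) (intro continuous_intros)
  have A: "(\<lambda>n. L2_norm U (\<lambda>x. (cos (c * p n x) - cos (c * u x)) *\<^sub>R weak_grad U u x)) \<longlonglongrightarrow> 0"
  proof (rule L2_norm_tendsto_dominated[OF _ uL(2), of _ 2])
    show "AE x in leb U. (\<lambda>n. (cos (c * p n x) - cos (c * u x)) *\<^sub>R weak_grad U u x) \<longlonglongrightarrow> 0"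
      using p(4) by eventually_elim (auto intro!: tendsto_eq_intros)
    show "AE x in leb U. norm ((cos (c * p n x) - cos (c * u x)) *\<^sub>R weak_grad U u x) \<le> 2 * norm (weak_grad U u x)" for n
    proof (intro always_eventually allI)
      fix x
      have "\<bar>cos (c * p n x) - cos (c * u x)\<bar> \<le> 2"
        using abs_cos_le_one[of "c * p n x"] abs_cos_le_one[of "c * u x"] by linarith
      then show "norm ((cos (c * p n x) - cos (c * u x)) *\<^sub>R weak_grad U u x) \<le> 2 * norm (weak_grad U u x)"
        by (simp add: mult_right_mono)
    qed
  qed (use cosm in measurable)
  have B: "(\<lambda>n. L2_norm U (\<lambda>x. cos (c * p n x) *\<^sub>R grad (p n) x - cos (c * u x) *\<^sub>R weak_grad U u x)) \<longlonglongrightarrow> 0"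
  proof (rule tendsto_0_squeeze)
    show "(\<lambda>n. L2_norm U (\<lambda>x. grad (p n) x - weak_grad U u x) +
        L2_norm U (\<lambda>x. (cos (c * p n x) - cos (c * u x)) *\<^sub>R weak_grad U u x)) \<longlonglongrightarrow> 0"
      using tendsto_add[OF p(3) A] by simp
    show "L2_norm U (\<lambda>x. cos (c * p n x) *\<^sub>R grad (p n) x - cos (c * u x) *\<^sub>R weak_grad U u x) \<le>
        L2_norm U (\<lambda>x. grad (p n) x - weak_grad U u x) +
        L2_norm U (\<lambda>x. (cos (c * p n x) - cos (c * u x)) *\<^sub>R weak_grad U u x)" for n
    proof -
      have d: "(\<lambda>x. grad (p n) x - weak_grad U u x) \<in> L2 U" using L uL by (intro L2.diff_mem)
      then have m: "(\<lambda>x. cos (c * p n x) *\<^sub>R (grad (p n) x - weak_grad U u x)) \<in> L2 U"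
        by (rule L2_cos_scaleR) measurable
      have m2: "(\<lambda>x. (cos (c * p n x) - cos (c * u x)) *\<^sub>R weak_grad U u x) \<in> L2 U"
        using L2.diff_mem[OF L2_cos_scaleR[of "weak_grad U u" "\<lambda>x. c * p n x"] L2_cos_scaleR[of "weak_grad U u" "\<lambda>x. c * u x"]] uL
        by (simp add: scaleR_diff_left)
      have "L2_norm U (\<lambda>x. cos (c * p n x) *\<^sub>R grad (p n) x - cos (c * u x) *\<^sub>R weak_grad U u x) \<le>
          L2_norm U (\<lambda>x. cos (c * p n x) *\<^sub>R (grad (p n) x - weak_grad U u x)) +
          L2_norm U (\<lambda>x. (cos (c * p n x) - cos (c * u x)) *\<^sub>R weak_grad U u x)"
        using L2.nrm_triangle[OF m m2] by (simp add: L2_nrm_eq algebra_simps)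
      also have "L2_norm U (\<lambda>x. cos (c * p n x) *\<^sub>R (grad (p n) x - weak_grad U u x)) \<le> L2_norm U (\<lambda>x. grad (p n) x - weak_grad U u x)"
        using m d by (rule L2_norm_mono) (auto intro!: mult_left_le_one_le)
      finally show ?thesis by simp
    qed
  qed simp
  have C: "(\<lambda>n. L2_norm U (\<lambda>x. trunc c (p n x) - trunc c (u x))) \<longlonglongrightarrow> 0"
  proof (rule tendsto_0_squeeze[OF p(2)])
    show "L2_norm U (\<lambda>x. trunc c (p n x) - trunc c (u x)) \<le> L2_norm U (\<lambda>x. p n x - u x)" for n
      using L uL c trunc_diff_le[OF c] by (intro L2_norm_mono L2.diff_mem trunc_L2) auto
  qed simp
  have wg: "is_weak_gradient U (\<lambda>x. trunc c (p n x)) (\<lambda>x. cos (c * p n x) *\<^sub>R grad (p n) x)" for n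
    using grad_test(2)[OF trunc_test(1)[OF p(1) c] lebesgue] trunc_test(2)[OF p(1) c] by simp
  note closed = H10_closed[OF test_H10[OF trunc_test(1)[OF p(1) c]] wg trunc_L2[OF uL(1) c] L2_cos_scaleR[OF uL(2)] C B]
  show "(\<lambda>x. trunc c (u x)) \<in> H10 U"
    "is_weak_gradient U (\<lambda>x. trunc c (u x)) (\<lambda>x. cos (c * u x) *\<^sub>R weak_grad U u x)"
    by (rule closed; measurable)+
qed

lemma trunc_tendsto: "(\<lambda>n. trunc (inverse (real (Suc n))) t) \<longlonglongrightarrow> t"
proof -
  have "((\<lambda>c. sin (c * t) / c) \<longlongrightarrow> t) (at 0)"
  proof -
    have "((\<lambda>c. sin (c * t)) has_real_derivative cos (0 * t) * t) (at 0)"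
      by (auto intro!: derivative_eq_intros)
    then show ?thesis by (simp add: DERIV_def)
  qed
  moreover have "filterlim (\<lambda>n. inverse (real (Suc n))) (at 0) sequentially"
    unfolding filterlim_at using LIMSEQ_inverse_real_of_nat by (auto simp del: of_nat_Suc intro!: always_eventually)
  ultimately show ?thesis unfolding trunc_def by (rule filterlim_compose)
qed

text \<open>Dominated convergence twice: the truncations tend to \<open>u\<close> pointwise and the
  factor \<open>cos (c * u x)\<close> in the gradient tends to 1; the differences are at most twice
  \<open>u\<close> and twice its gradient in norm.\<close>

lemma trunc_H1_tendsto:
  assumes u: "u \<in> H10 U"
  shows "(\<lambda>n. H1_norm U (\<lambda>x. trunc (inverse (real (Suc n))) (u x) - u x)) \<longlonglongrightarrow> 0"
proof -
  define c where "c n = inverse (real (Suc n))" for n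
  have c: "c n > 0" for n by (simp add: c_def)
  have c0: "c \<longlonglongrightarrow> 0" unfolding c_def[abs_def] by (rule LIMSEQ_inverse_real_of_nat)
  have u1: "u \<in> H1 U" "u \<in> L2 U" "weak_grad U u \<in> L2 U" using u H10_H1 H1_L2 weak_grad_L2 by blast+
  have [measurable]: "u \<in> meas U" "weak_grad U u \<in> meas U"
    using u1 L2_measurable by blast+
  have t1: "(\<lambda>x. trunc (c n) (u x)) \<in> H1 U" for n using trunc_H10[OF u c] H10_H1 by blast
  have cosm: "(\<lambda>x. cos (c n * u x)) \<in> meas U" for n
    by (intro borel_measurable_continuous_on[of cos]) (auto intro!: continuous_intros)
  have "(\<lambda>n. L2_norm U (\<lambda>x. trunc (c n) (u x) - u x)) \<longlonglongrightarrow> 0"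
  proof (rule L2_norm_tendsto_dominated[OF _ u1(2), of _ 2])
    show "(\<lambda>x. trunc (c n) (u x) - u x) \<in> meas U" for n
      using L2_measurable[OF trunc_L2[OF u1(2) c]] by measurable
    show "AE x in leb U. (\<lambda>n. trunc (c n) (u x) - u x) \<longlonglongrightarrow> 0"
      using trunc_tendsto by (auto simp: LIM_zero_iff c_def)
    show "AE x in leb U. norm (trunc (c n) (u x) - u x) \<le> 2 * norm (u x)" for n
    proof (intro always_eventually allI)
      fix x show "norm (trunc (c n) (u x) - u x) \<le> 2 * norm (u x)"
        using trunc_le[OF c, of n "u x"] by simp
    qed
  qed
  moreover have "(\<lambda>n. L2_norm U (\<lambda>x. cos (c n * u x) *\<^sub>R weak_grad U u x - weak_grad U u x)) \<longlonglongrightarrow> 0"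
  proof (rule L2_norm_tendsto_dominated[OF _ u1(3), of _ 2])
    show "(\<lambda>x. cos (c n * u x) *\<^sub>R weak_grad U u x - weak_grad U u x) \<in> meas U" for n
      using cosm by measurable
    have "(\<lambda>n. cos (c n * u x) *\<^sub>R weak_grad U u x - weak_grad U u x) \<longlonglongrightarrow> cos (0 * u x) *\<^sub>R weak_grad U u x - weak_grad U u x" for x
      by (intro tendsto_intros c0)
    then show "AE x in leb U. (\<lambda>n. cos (c n * u x) *\<^sub>R weak_grad U u x - weak_grad U u x) \<longlonglongrightarrow> 0"
      by simp
    show "AE x in leb U. norm (cos (c n * u x) *\<^sub>R weak_grad U u x - weak_grad U u x) \<le> 2 * norm (weak_grad U u x)" for n
    proof (intro always_eventually allI)
      fix x
      have "norm (cos (c n * u x) *\<^sub>R weak_grad U u x - weak_grad U u x) \<le> norm (cos (c n * u x) *\<^sub>R weak_grad U u x) + norm (weak_grad U u x)"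
        by (rule norm_triangle_ineq4)
      also have "norm (cos (c n * u x) *\<^sub>R weak_grad U u x) \<le> norm (weak_grad U u x)"
        by (auto intro!: mult_left_le_one_le)
      finally show "norm (cos (c n * u x) *\<^sub>R weak_grad U u x - weak_grad U u x) \<le> 2 * norm (weak_grad U u x)" by simp
    qed
  qed
  ultimately have "(\<lambda>n. H1_norm U (\<lambda>x. trunc (c n) (u x) - u x)) \<longlonglongrightarrow> 0"
    using H1_norm_tendsto_iff[OF t1 u1(1)] D_nrm_diff[OF H1_L2[OF t1] trunc_H10(2)[OF u c] u1(2) weak_grad_is[OF u1(1)]]
    by simp
  then show ?thesis by (simp add: c_def)
qed

end

subsection \<open>Forms diagonalised by an orthonormal basis\<close>

text \<open>The \<open>e j\<close> are complete in \<open>L2 U\<close> only, and nothing is assumed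
  about convergence of expansions in the norm of \<open>a\<close>. Hence Parseval's identity holds
  for \<open>ip\<close>, but only Bessel's inequality is derived for \<open>a\<close>.\<close>

locale spectral = sym_form V a
  for V :: "('a::euclidean_space \<Rightarrow> real) set" and a +
  fixes U :: "'a set" and e :: "nat \<Rightarrow> 'a \<Rightarrow> real" and l :: "nat \<Rightarrow> real"
  assumes V_L2: "V \<subseteq> L2 U"
    and onb: "orthonormal_basis_L2 U e"
    and e_mem: "e j \<in> V"
    and eigen: "v \<in> V \<Longrightarrow> a (e j) v = l j * ip U (e j) v"
    and mono: "mono l"
begin

definition coef :: "('a \<Rightarrow> real) \<Rightarrow> nat \<Rightarrow> real" where
  "coef f j = ip U f (e j)"

lemma e_L2: "e j \<in> L2 U"
  using e_mem V_L2 by blast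

lemma e_orthonormal: "ip U (e i) (e j) = (if i = j then 1 else 0)"
  using onb by (simp add: orthonormal_basis_L2_def L2_inner_eq_ip)

lemma a_e: "a (e i) (e j) = (if i = j then l j else 0)"
  using eigen[OF e_mem] e_orthonormal by simp

lemma eigen_right: "v \<in> V \<Longrightarrow> a v (e j) = l j * coef v j"
  using eigen[of v j] sym[OF _ e_mem] L2.sym[OF e_L2] V_L2 by (auto simp: coef_def)

lemma l_nonneg: "0 \<le> l j"
  using nonneg[OF e_mem[of j]] by (simp add: a_e)

lemma ip_expansion:
  assumes "finite I"
  shows "ip U (\<lambda>x. \<Sum>j\<in>I. c j *\<^sub>R e j x) (\<lambda>x. \<Sum>j\<in>I. c j *\<^sub>R e j x) = (\<Sum>j\<in>I. (c j)\<^sup>2)"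
  using assms by (subst L2.sum_sum) (auto simp: e_L2 e_orthonormal power2_eq_square if_distrib cong: if_cong)

lemma a_expansion:
  assumes "finite I"
  shows "a (\<lambda>x. \<Sum>j\<in>I. c j *\<^sub>R e j x) (\<lambda>x. \<Sum>j\<in>I. c j *\<^sub>R e j x) = (\<Sum>j\<in>I. l j * (c j)\<^sup>2)"
  using assms by (subst sum_sum) (auto simp: e_mem a_e power2_eq_square mult_ac if_distrib cong: if_cong)

lemma expansion_tendsto:
  "f \<in> L2 U \<Longrightarrow> (\<lambda>N. L2_norm U (\<lambda>x. f x - (\<Sum>j<N. coef f j *\<^sub>R e j x))) \<longlonglongrightarrow> 0"
  using onb by (simp add: orthonormal_basis_L2_def L2_inner_eq_ip coef_def)

lemma parseval:
  assumes f: "f \<in> L2 U"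
  shows "(\<lambda>N. \<Sum>j<N. (coef f j)\<^sup>2) \<longlonglongrightarrow> ip U f f"
proof -
  have "(L2_norm U (\<lambda>x. f x - (\<Sum>j<N. coef f j *\<^sub>R e j x)))\<^sup>2 = ip U f f - (\<Sum>j<N. (coef f j)\<^sup>2)" for N
  proof -
    have m: "(\<lambda>x. \<Sum>j<N. coef f j *\<^sub>R e j x) \<in> L2 U" by (intro L2.sum_mem e_L2)
    have "ip U f (\<lambda>x. \<Sum>j<N. coef f j *\<^sub>R e j x) = (\<Sum>j<N. (coef f j)\<^sup>2)"
      by (subst L2.sum_right[OF e_L2 f]) (simp add: coef_def power2_eq_square)
    then show ?thesis
      unfolding L2_norm_power2_ip by (simp only: L2.square_diff[OF f m] ip_expansion finite_lessThan)
  qed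
  moreover have "(\<lambda>N. (L2_norm U (\<lambda>x. f x - (\<Sum>j<N. coef f j *\<^sub>R e j x)))\<^sup>2) \<longlonglongrightarrow> 0"
    using tendsto_power[OF expansion_tendsto[OF f], of 2] by simp
  ultimately have "(\<lambda>N. ip U f f - (\<Sum>j<N. (coef f j)\<^sup>2)) \<longlonglongrightarrow> 0" by simp
  from tendsto_diff[OF tendsto_const[of "ip U f f"] this] show ?thesis by simp
qed

text \<open>The eigenvalue equation gives \<open>a v (e j) = l j * coef v j\<close>, so the bound is
  nonnegativity of \<open>a\<close> on \<open>v\<close> minus its partial expansion.\<close>

lemma bessel:
  assumes v: "v \<in> V"
  shows "(\<Sum>j<N. l j * (coef v j)\<^sup>2) \<le> a v v"
proof -
  have m: "(\<lambda>x. \<Sum>j<N. coef v j *\<^sub>R e j x) \<in> V" by (intro sum_mem e_mem)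
  have "a v (\<lambda>x. \<Sum>j<N. coef v j *\<^sub>R e j x) = (\<Sum>j<N. l j * (coef v j)\<^sup>2)"
    by (subst sum_right[OF e_mem v]) (simp add: eigen_right[OF v] power2_eq_square mult_ac)
  with nonneg[OF diff_mem[OF v m]] show ?thesis
    by (simp only: square_diff[OF v m] a_expansion finite_lessThan)
qed

lemma parseval_le:
  assumes "f \<in> L2 U" "\<And>N. (\<Sum>j<N. (coef f j)\<^sup>2) \<le> C"
  shows "ip U f f \<le> C"
  by (rule LIMSEQ_le_const2[OF parseval[OF assms(1)]]) (use assms(2) in blast)

text \<open>The modes from \<open>J\<close> on have eigenvalues at least \<open>l J\<close>, so
  Bessel's inequality bounds their share of the norm by the energy over \<open>l J\<close>. With
  unbounded eigenvalues this is the source of compactness.\<close>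

lemma ip_le_tail:
  assumes v: "v \<in> V" and J: "l J > 0"
  shows "ip U v v \<le> (\<Sum>j<J. (coef v j)\<^sup>2) + a v v / l J"
proof (rule parseval_le)
  fix N
  have "(\<Sum>j<N. (coef v j)\<^sup>2) \<le> (\<Sum>j<N+J. (coef v j)\<^sup>2)"
    by (rule sum_mono2) auto
  also have "\<dots> = (\<Sum>j<J. (coef v j)\<^sup>2) + (\<Sum>j\<in>{J..<N+J}. (coef v j)\<^sup>2)"
    by (simp add: lessThan_atLeast0 sum.atLeastLessThan_concat)
  also have "(\<Sum>j\<in>{J..<N+J}. (coef v j)\<^sup>2) \<le> (\<Sum>j\<in>{J..<N+J}. l j * (coef v j)\<^sup>2 / l J)"
  proof (rule sum_mono)
    fix j assume "j \<in> {J..<N+J}"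
    then have "l J \<le> l j" using mono by (simp add: monoD)
    then show "(coef v j)\<^sup>2 \<le> l j * (coef v j)\<^sup>2 / l J"
      using J by (simp add: pos_le_divide_eq mult.commute[of _ "l J"] mult_right_mono)
  qed
  also have "\<dots> \<le> (\<Sum>j<N+J. l j * (coef v j)\<^sup>2 / l J)"
    by (rule sum_mono2) (use J l_nonneg in auto)
  also have "\<dots> \<le> a v v / l J"
    using bessel[OF v, of "N + J"] J by (simp add: divide_right_mono flip: sum_divide_distrib)
  finally show "(\<Sum>j<N. (coef v j)\<^sup>2) \<le> (\<Sum>j<J. (coef v j)\<^sup>2) + a v v / l J" by simp
qed (use v V_L2 in blast)

lemma rayleigh:
  assumes v: "v \<in> V" and 0: "\<And>j. j < k \<Longrightarrow> coef v j = 0"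
  shows "l k * ip U v v \<le> a v v"
proof (cases "l k = 0")
  case True
  then show ?thesis using nonneg[OF v] by simp
next
  case False
  then have "l k > 0" using l_nonneg[of k] by simp
  then show ?thesis using ip_le_tail[OF v, of k] 0 by (simp add: field_simps)
qed

text \<open>Among the combinations of \<open>k + 1\<close> functions there is a nonzero one
  orthogonal to the first \<open>k\<close> eigenfunctions, to which \<open>rayleigh\<close> applies.
  Truncation and penalty spoil exact orthogonality of the competitors, hence the tolerance
  \<open>\<delta>\<close>; the factor \<open>k + 1\<close> comes from comparing the square of the
  sum of the \<open>\<bar>x i\<bar>\<close> with the sum of squares.\<close>

lemma min_max_almost_orthonormal:
  fixes f :: "nat \<Rightarrow> 'a \<Rightarrow> real"
  assumes f: "\<And>i. i \<le> k \<Longrightarrow> f i \<in> V" and \<Lambda>: "\<And>i. i \<le> k \<Longrightarrow> \<mu> i \<le> \<Lambda>"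
    and gram: "\<And>i j. i \<le> k \<Longrightarrow> j \<le> k \<Longrightarrow> \<bar>ip U (f i) (f j) - (if i = j then 1 else 0)\<bar> \<le> \<delta>"
    and form: "\<And>i j. i \<le> k \<Longrightarrow> j \<le> k \<Longrightarrow> \<bar>a (f i) (f j) - (if i = j then \<mu> i else 0)\<bar> \<le> \<delta>"
  shows "l k * (1 - (k + 1) * \<delta>) \<le> \<Lambda> + (k + 1) * \<delta>"
proof -
  obtain x where x: "\<exists>i\<in>{..k}. x i \<noteq> 0" "\<forall>j<k. (\<Sum>i\<le>k. x i * ip U (f i) (e j)) = 0"
    using underdetermined_system[of "{..k}" k "\<lambda>i j. ip U (f i) (e j)"] by auto
  define u where "u = (\<lambda>y. \<Sum>i\<le>k. x i *\<^sub>R f i y)"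
  define X where "X = (\<Sum>i\<le>k. (x i)\<^sup>2)"
  have X: "X > 0" unfolding X_def using x(1) by (auto intro!: sum_pos2)
  have fL: "f i \<in> L2 U" if "i \<le> k" for i using f that V_L2 by blast
  have \<delta>: "\<delta> \<ge> 0" using gram[of 0 0] by linarith
  have u: "u \<in> V" unfolding u_def by (rule sum_mem) (use f in auto)
  have "coef u j = 0" if "j < k" for j
    unfolding coef_def u_def using x(2) that by (subst L2.sum_left) (auto simp: fL e_L2)
  then have ray: "l k * ip U u u \<le> a u u" by (rule rayleigh[OF u])
  have perturb: "\<bar>(\<Sum>i\<le>k. \<Sum>j\<le>k. x i * x j * A i j) - (\<Sum>i\<le>k. B i * (x i)\<^sup>2)\<bar> \<le> (k + 1) * \<delta> * X"
    if "\<And>i j. i \<le> k \<Longrightarrow> j \<le> k \<Longrightarrow> \<bar>A i j - (if i = j then B i else 0)\<bar> \<le> \<delta>" for A B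
  proof -
    have "(\<Sum>i\<le>k. \<Sum>j\<le>k. x i * x j * A i j) - (\<Sum>i\<le>k. B i * (x i)\<^sup>2) =
        (\<Sum>i\<le>k. \<Sum>j\<le>k. x i * x j * (A i j - (if i = j then B i else 0)))"
    proof -
      have "x i * x j * (A i j - (if i = j then B i else 0)) = x i * x j * A i j - (if j = i then B i * (x i)\<^sup>2 else 0)" for i j
        by (auto simp: power2_eq_square algebra_simps)
      then show ?thesis by (simp add: sum_subtractf)
    qed
    also have "\<bar>\<dots>\<bar> \<le> (\<Sum>i\<le>k. \<Sum>j\<le>k. \<bar>x i\<bar> * \<bar>x j\<bar> * \<delta>)"
      by (intro order_trans[OF sum_abs] sum_mono, unfold abs_mult, rule mult_left_mono[OF that]) auto
    also have "\<dots> = \<delta> * (\<Sum>i\<le>k. \<bar>x i\<bar>)\<^sup>2"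
      by (simp add: power2_eq_square sum_product sum_distrib_left mult_ac)
    also have "\<dots> \<le> \<delta> * (real (card {..k}) * (\<Sum>i\<le>k. (x i)\<^sup>2))"
      by (intro mult_left_mono sum_abs_squared_le \<delta>)
    finally show ?thesis by (simp add: X_def mult_ac)
  qed
  have uu: "ip U u u = (\<Sum>i\<le>k. \<Sum>j\<le>k. x i * x j * ip U (f i) (f j))"
    and auu: "a u u = (\<Sum>i\<le>k. \<Sum>j\<le>k. x i * x j * a (f i) (f j))"
    unfolding u_def by (subst L2.sum_sum sum_sum; use fL f in auto)+
  have "X - (k + 1) * \<delta> * X \<le> ip U u u"
    using perturb[of "\<lambda>i j. ip U (f i) (f j)" "\<lambda>_. 1"] gram unfolding uu X_def by simp
  then have "l k * (X - (k + 1) * \<delta> * X) \<le> a u u"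
    using ray mult_left_mono[OF _ l_nonneg] by (meson order_trans)
  also have "a u u \<le> (\<Sum>i\<le>k. \<mu> i * (x i)\<^sup>2) + (k + 1) * \<delta> * X"
    using perturb[of "\<lambda>i j. a (f i) (f j)" \<mu>] form unfolding auu by simp
  also have "(\<Sum>i\<le>k. \<mu> i * (x i)\<^sup>2) \<le> \<Lambda> * X"
    unfolding X_def sum_distrib_left by (intro sum_mono mult_right_mono \<Lambda>) auto
  finally have "(l k * (1 - (k + 1) * \<delta>)) * X \<le> (\<Lambda> + (k + 1) * \<delta>) * X"
    by (simp add: algebra_simps)
  then show ?thesis using X by (simp add: add.commute)
qed

end

subsection \<open>Compactness from a spectral basis\<close>

definition laplacian :: "('a::euclidean_space \<Rightarrow> real) \<Rightarrow> 'a \<Rightarrow> real" where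
  "laplacian f x = (\<Sum>i\<in>Basis. pd i (pd i f) x)"

lemma test_sum:
  "(\<And>i. i \<in> I \<Longrightarrow> f i \<in> tests U) \<Longrightarrow> (\<lambda>x. \<Sum>i\<in>I. f i x) \<in> tests U"
proof (induction I rule: infinite_finite_induct)
  case (insert i I)
  then show ?case using test_lin[of "f i" U "\<lambda>x. \<Sum>i\<in>I. f i x" 1] by simp
qed (auto simp: test_zero)

lemma test_laplacian: "f \<in> tests U \<Longrightarrow> laplacian f \<in> tests U"
  unfolding laplacian_def[abs_def] by (intro test_sum test_pd)

context sobolev
begin

text \<open>With both derivatives moved to the test function, the form becomes continuous in
  \<open>u\<close> for \<open>L2\<close> convergence alone.\<close>

lemma dirichlet_form_test:
  assumes u: "u \<in> H1 U" and p: "p \<in> tests U"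
  shows "dir U u p = - ip U u (laplacian p)"
proof -
  have L: "weak_grad U u \<in> L2 U" "u \<in> L2 U" "is_weak_gradient U u (weak_grad U u)"
    using u weak_grad_L2 H1_L2 weak_grad_is by auto
  have pdp: "pd i p \<in> tests U" "pd i (pd i p) \<in> tests U" if "i \<in> Basis" for i
    using p that test_pd by blast+
  have "dir U u p = ip U (weak_grad U u) (grad p)"
    using L grad_test[OF p lebesgue] test_L2[OF lebesgue p] by (intro dirichlet_form_eq) auto
  also have "\<dots> = (LINT x|leb U. (\<Sum>i\<in>Basis. (weak_grad U u x \<bullet> i) * pd i p x))"
    unfolding ip_def by (simp add: grad_def inner_sum_right mult.commute)
  also have "\<dots> = (\<Sum>i\<in>Basis. LINT x|leb U. (weak_grad U u x \<bullet> i) * pd i p x)"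
    by (intro Bochner_Integration.integral_sum L2_integrable_times L2_inner_const L test_L2 lebesgue pdp)
  also have "\<dots> = (\<Sum>i\<in>Basis. - (LINT x|leb U. u x * pd i (pd i p) x))"
    using L(3) pdp unfolding is_weak_gradient_pd by (intro sum.cong) auto
  also have "\<dots> = - (LINT x|leb U. (\<Sum>i\<in>Basis. u x * pd i (pd i p) x))"
    by (subst Bochner_Integration.integral_sum)
       (auto simp: sum_negf intro!: L2_integrable_times L test_L2 lebesgue pdp)
  also have "\<dots> = - ip U u (laplacian p)"
    unfolding ip_def laplacian_def by (simp add: sum_distrib_left)
  finally show ?thesis .
qed

lemma dirichlet_form_test_tendsto:
  assumes u: "\<And>n. u n \<in> H1 U" "v \<in> H1 U" "L2_tendsto U u v"
    and p: "p \<in> tests U"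
  shows "(\<lambda>n. dir U (u n) p) \<longlonglongrightarrow> dir U v p"
proof -
  have "(\<lambda>n. ip U (u n) (laplacian p)) \<longlonglongrightarrow> ip U v (laplacian p)"
    by (rule L2.tendsto_form)
       (use u H1_L2 test_L2[OF lebesgue test_laplacian[OF p]] in \<open>auto simp: L2_nrm_eq L2_norm_def\<close>)
  then show ?thesis using u p by (simp add: dirichlet_form_test tendsto_minus)
qed

text \<open>Weak convergence of the gradients: against test functions by the previous lemma, against
  \<open>\<eta>\<close> by density, the error being controlled by the uniform energy bound.\<close>

lemma dirichlet_form_weak_tendsto:
  assumes u: "\<And>n. u n \<in> H1 U" "v \<in> H1 U" "L2_tendsto U u v"
    and C: "\<And>n. dir U (u n) (u n) \<le> C" and \<eta>: "\<eta> \<in> H10 U"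
  shows "(\<lambda>n. dir U (u n) \<eta>) \<longlonglongrightarrow> dir U v \<eta>"
proof (rule LIMSEQ_I)
  fix r :: real assume r: "r > 0"
  \<comment> \<open>The two norms bound the approximation error on either side of the limit; the
    summand 1 keeps \<open>B\<close> positive.\<close>
  define B where "B = sqrt C + D.nrm v + 1"
  have C0: "0 \<le> C" using C[of 0] D.nonneg[OF u(1)[of 0]] by linarith
  have B: "B > 0" using C0 D.nrm_nonneg[OF u(2)] by (simp add: B_def add_nonneg_pos)
  have nu: "D.nrm (u n) \<le> sqrt C" for n using C unfolding D.nrm_def by simp
  obtain p where p: "\<And>n. p n \<in> tests U" "(\<lambda>n. H1_norm U (\<lambda>x. p n x - \<eta> x)) \<longlonglongrightarrow> 0"
    using \<eta> unfolding H10_def by auto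
  obtain m where m: "H1_norm U (\<lambda>x. p m x - \<eta> x) < r / (2 * B)"
    using order_tendstoD(2)[OF p(2), of "r / (2 * B)"] r B by (auto simp: eventually_sequentially)
  have \<eta>1: "\<eta> \<in> H1 U" "p m \<in> H1 U" using \<eta> H10_H1 p test_H1 by auto
  define d where "d = D.nrm (\<lambda>x. \<eta> x - p m x)"
  have d: "0 \<le> d" "d < r / (2 * B)"
    using m grad_le_H1_norm[of "\<lambda>x. p m x - \<eta> x"] D.nrm_minus_commute[OF \<eta>1] D.nrm_nonneg[OF D.diff_mem[OF \<eta>1]]
    by (auto simp: d_def)
  from LIMSEQ_D[OF dirichlet_form_test_tendsto[OF u p(1)[of m]], of "r/2"] r obtain N where
    N: "\<And>n. n \<ge> N \<Longrightarrow> \<bar>dir U (u n) (p m) - dir U v (p m)\<bar> < r / 2" by auto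
  have "\<bar>dir U (u n) \<eta> - dir U v \<eta>\<bar> < r" if "n \<ge> N" for n
  proof -
    have eq: "dir U z \<eta> = dir U z (p m) + dir U z (\<lambda>x. \<eta> x - p m x)" if "z \<in> H1 U" for z
      using D.diff_right[OF \<eta>1 that] by simp
    have "\<bar>dir U (u n) (\<lambda>x. \<eta> x - p m x)\<bar> \<le> sqrt C * d"
      using order_trans[OF D.abs_le_nrm[OF u(1) D.diff_mem[OF \<eta>1]] mult_right_mono[OF nu]] d unfolding d_def by blast
    moreover have "\<bar>dir U v (\<lambda>x. \<eta> x - p m x)\<bar> \<le> D.nrm v * d"
      using D.abs_le_nrm[OF u(2) D.diff_mem[OF \<eta>1]] unfolding d_def .
    moreover have "sqrt C * d + D.nrm v * d \<le> B * d" using d by (simp add: B_def algebra_simps)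
    moreover have "B * d < r / 2" using d(2) B by (simp add: field_simps)
    ultimately show ?thesis using N[OF that] eq[OF u(1), of n] eq[OF u(2)]
      by linarith
  qed
  then show "\<exists>N. \<forall>n\<ge>N. norm (dir U (u n) \<eta> - dir U v \<eta>) < r" by auto
qed

end

text \<open>\<open>dirichlet_le\<close> lets bounds on \<open>a\<close> control gradients. The
  instances are the Dirichlet form plus a nonnegative weight.\<close>

locale dirichlet_spectral = sobolev U + S: spectral "H10 U" a U e l
  for U :: "'a::euclidean_space set" and a e l +
  assumes dirichlet_le: "u \<in> H10 U \<Longrightarrow> dir U u u \<le> a u u"
begin

lemma H10_L2: "u \<in> H10 U \<Longrightarrow> u \<in> L2 U"
  using H10_H1 H1_L2 by blast

text \<open>The bound is clear for partial expansions of \<open>p\<close>, but these converge to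
  \<open>p\<close> in \<open>L2\<close> only. So the limit is taken in \<open>dir U (u N) p\<close>,
  where this is enough, and Cauchy-Schwarz leaves one factor \<open>D.nrm p\<close> to
  cancel.\<close>

lemma test_form_bounded:
  assumes L: "\<And>j. l j \<le> L" and p: "p \<in> tests U"
  shows "dir U p p \<le> L * ip U p p"
proof -
  have p0: "p \<in> H10 U" "p \<in> H1 U" "p \<in> L2 U" using p test_H10 test_H1 test_L2 lebesgue by auto
  define u where "u N = (\<lambda>x. \<Sum>j<N. S.coef p j *\<^sub>R e j x)" for N
  have u: "u N \<in> H10 U" "u N \<in> H1 U" for N
    unfolding u_def by (rule S.sum_mem[OF S.e_mem], rule H10_H1[OF S.sum_mem[OF S.e_mem]])
  have L0: "0 \<le> L" using S.l_nonneg[of 0] L[of 0] by linarith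
  have "dir U (u N) (u N) \<le> L * ip U p p" for N
  proof -
    have "dir U (u N) (u N) \<le> (\<Sum>j<N. l j * (S.coef p j)\<^sup>2)"
      using dirichlet_le[OF u(1)[of N]] unfolding u_def by (simp only: S.a_expansion finite_lessThan)
    also have "\<dots> \<le> L * (\<Sum>j<N. (S.coef p j)\<^sup>2)"
      unfolding sum_distrib_left by (intro sum_mono mult_right_mono L) auto
    also have "(\<Sum>j<N. (S.coef p j)\<^sup>2) \<le> ip U p p"
      by (rule incseq_le[OF _ S.parseval[OF p0(3)]]) (auto simp: incseq_def intro!: sum_mono2)
    finally show ?thesis using L0 by (simp add: mult_left_mono)
  qed
  then have nu: "D.nrm (u N) \<le> sqrt (L * ip U p p)" for N
    unfolding D.nrm_def by simp
  have "L2_tendsto U u p"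
    using S.expansion_tendsto[OF p0(3)] L2.nrm_minus_commute[OF p0(3) H10_L2[OF u(1)]]
    by (simp add: u_def L2_nrm_eq)
  from dirichlet_form_test_tendsto[OF u(2) p0(2) this p]
  have lim: "(\<lambda>N. dir U (u N) p) \<longlonglongrightarrow> dir U p p" .
  have "dir U p p \<le> sqrt (L * ip U p p) * D.nrm p"
  proof (rule LIMSEQ_le_const2[OF lim], intro exI allI impI)
    fix N
    show "dir U (u N) p \<le> sqrt (L * ip U p p) * D.nrm p"
      using D.abs_le_nrm[OF u(2) p0(2), of N] mult_right_mono[OF nu D.nrm_nonneg[OF p0(2)], of N] by linarith
  qed
  then have *: "(D.nrm p) * D.nrm p \<le> sqrt (L * ip U p p) * D.nrm p"
    using D.nrm_squared[OF p0(2)] by (simp add: power2_eq_square)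
  have "D.nrm p \<le> sqrt (L * ip U p p)"
  proof (cases "D.nrm p = 0")
    case True
    then show ?thesis using L0 L2.nonneg[OF p0(3)] by simp
  next
    case False
    then have "D.nrm p > 0" using D.nrm_nonneg[OF p0(2)] by simp
    then show ?thesis using * by simp
  qed
  then show ?thesis by (simp add: D.nrm_def)
qed

text \<open>If the eigenvalues stayed bounded, so would the Rayleigh quotients of the oscillating functions
  \<open>p sin (M x\<^sub>i)\<close> and \<open>p cos (M x\<^sub>i)\<close>.\<close>

lemma l_at_top: "filterlim l at_top sequentially"
proof (rule ccontr)
  assume *: "\<not> filterlim l at_top sequentially"
  have "\<exists>L. \<forall>j. l j \<le> L"
  proof (rule ccontr)
    assume "\<nexists>L. \<forall>j. l j \<le> L"
    then have "\<exists>j. Z \<le> l j" for Z by (metis linear)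
    then have "\<forall>\<^sub>F j in sequentially. Z \<le> l j" for Z
      using S.mono unfolding eventually_sequentially by (meson monoD order_trans)
    then show False using * unfolding filterlim_at_top by blast
  qed
  then obtain L where L: "\<And>j. l j \<le> L" by blast
  \<comment> \<open>A test function close to \<open>e 0\<close>, which has norm 1, is not
    null.\<close>
  obtain p where p: "p \<in> tests U" "ip U p p > 0"
  proof -
    obtain p where p: "\<And>n. p n \<in> tests U" "(\<lambda>n. L2_norm U (\<lambda>x. p n x - e 0 x)) \<longlonglongrightarrow> 0"
      using H10_approx[OF S.e_mem[of 0]] by blast
    have "(\<lambda>n. ip U (p n) (p n)) \<longlonglongrightarrow> ip U (e 0) (e 0)"
      by (rule L2.tendsto_form) (use p test_L2 lebesgue S.e_L2 in \<open>auto simp: L2_nrm_eq\<close>)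
    then have "(\<lambda>n. ip U (p n) (p n)) \<longlonglongrightarrow> 1" by (simp add: S.e_orthonormal)
    from order_tendstoD(1)[OF this, of 0] p(1) that show ?thesis
      by (auto simp: eventually_sequentially)
  qed
  obtain i :: 'a where i: "i \<in> Basis" using nonempty_Basis by blast
  \<comment> \<open>Then \<open>M\<^sup>2 = \<bar>L\<bar> + 1\<close> exceeds \<open>L\<close>. Sine
    and cosine are used as a pair because the squares of \<open>f\<close> and \<open>g\<close> add
    up to that of \<open>p\<close>, while in the sum of the squared derivatives the mixed terms
    cancel and \<open>M\<^sup>2\<close> times the square of \<open>p\<close> remains.\<close>
  define M where "M = sqrt (\<bar>L\<bar> + 1)"
  define s where "s = (\<lambda>x. M * (x \<bullet> i))"
  have sm: "smooth s" unfolding s_def using smooth_lin[OF smooth_inner smooth_const[of 0], of M] by simp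
  have pds: "pd i s x = M" for x
    unfolding s_def by (rule pd_unique[of _ "\<lambda>h. M * (h \<bullet> i)", THEN trans]) (use i in \<open>auto intro!: derivative_eq_intros\<close>)
  define f g where "f = (\<lambda>x. p x * sin (s x))" and "g = (\<lambda>x. p x * cos (s x))"
  have fg: "f \<in> tests U" "g \<in> tests U"
    unfolding f_def g_def by (intro test_mult p smooth_sin smooth_cos sm)+
  have d: "p differentiable at x" "(\<lambda>x. sin (s x)) differentiable at x" "(\<lambda>x. cos (s x)) differentiable at x"
    "s differentiable at x" for x
    using p(1) sm by (auto simp: test_functions_iff intro!: smooth_differentiable smooth_sin smooth_cos)
  have pdf: "pd i f x = p x * (cos (s x) * M) + pd i p x * sin (s x)"
    and pdg: "pd i g x = p x * (- sin (s x) * M) + pd i p x * cos (s x)" for x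
    unfolding f_def g_def using pd_mult[OF d(1,2)] pd_mult[OF d(1,3)] pd_sin[OF d(4)] pd_cos[OF d(4)] pds by simp_all
  have L2s: "f \<in> L2 U" "g \<in> L2 U" "pd i f \<in> L2 U" "pd i g \<in> L2 U" "p \<in> L2 U"
    using fg i p lebesgue by (auto intro!: test_L2 test_pd)
  have D_ge: "ip U (pd i h) (pd i h) \<le> dir U h h" if h: "h \<in> tests U" for h
  proof -
    have "pd i h \<in> L2 U" "grad h \<in> L2 U" using h i lebesgue test_L2 test_pd grad_test by blast+
    then have "L2_norm U (pd i h) \<le> L2_norm U (grad h)"
      by (rule L2_norm_mono) (use i Basis_le_norm[OF i] grad_inner[OF i] in \<open>auto simp flip: real_norm_def grad_inner\<close>)
    then have "(L2_norm U (pd i h))\<^sup>2 \<le> (L2_norm U (grad h))\<^sup>2" by (rule power_mono) simp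
    then show ?thesis
      unfolding L2_norm_power2_ip
      using dirichlet_form_eq[of h "grad h" h "grad h"] grad_test[OF h lebesgue] test_L2[OF lebesgue h] by simp
  qed
  have int: "integrable (leb U) (\<lambda>x. f x * f x)" "integrable (leb U) (\<lambda>x. g x * g x)"
    "integrable (leb U) (\<lambda>x. pd i f x * pd i f x)" "integrable (leb U) (\<lambda>x. pd i g x * pd i g x)"
    "integrable (leb U) (\<lambda>x. p x * p x)"
    using L2s by (auto intro!: L2_integrable_times)
  have sumfg: "ip U f f + ip U g g = ip U p p"
  proof -
    have "f x * f x + g x * g x = p x * p x" for x
    proof -
      have "f x * f x + g x * g x = p x * p x * ((sin (s x))\<^sup>2 + (cos (s x))\<^sup>2)"
        unfolding f_def g_def by (simp only: power2_eq_square algebra_simps)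
      then show ?thesis by simp
    qed
    then show ?thesis using int by (simp add: ip_def flip: Bochner_Integration.integral_add)
  qed
  have "M\<^sup>2 * ip U p p = (LINT x|leb U. M\<^sup>2 * (p x * p x))" by (simp add: ip_def)
  also have "\<dots> \<le> (LINT x|leb U. pd i f x * pd i f x + pd i g x * pd i g x)"
  proof (rule integral_mono)
    fix x
    have "pd i f x * pd i f x + pd i g x * pd i g x =
        (M\<^sup>2 * (p x * p x) + pd i p x * pd i p x) * ((sin (s x))\<^sup>2 + (cos (s x))\<^sup>2)"
      unfolding pdf pdg by algebra
    then show "M\<^sup>2 * (p x * p x) \<le> pd i f x * pd i f x + pd i g x * pd i g x" by simp
  qed (use int in auto)
  also have "\<dots> = ip U (pd i f) (pd i f) + ip U (pd i g) (pd i g)"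
    using int by (simp add: ip_def)
  also have "\<dots> \<le> L * ip U f f + L * ip U g g"
    using D_ge[OF fg(1)] D_ge[OF fg(2)] test_form_bounded[OF L fg(1)] test_form_bounded[OF L fg(2)] by linarith
  also have "\<dots> = L * ip U p p" unfolding sumfg[symmetric] by (simp add: algebra_simps)
  finally have "M\<^sup>2 \<le> L" using p(2) by simp
  then show False unfolding M_def by simp
qed

text \<open>This takes the place of Rellich's theorem. Low modes converge by assumption, high modes
  are uniformly small by \<open>ip_le_tail\<close>. The \<open>L2\<close> limit lies in
  \<open>H10 U\<close> because its expansion converges in the Dirichlet norm as well: the sums of
  \<open>l j\<close> times its squared coefficients inherit the bound \<open>C\<close>.\<close>

theorem H10_compact:
  assumes f: "\<And>n. f n \<in> H10 U" and C: "\<And>n. a (f n) (f n) \<le> C"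
    and conv: "\<And>j. (\<lambda>n. ip U (f n) (e j)) \<longlonglongrightarrow> c j"
  obtains u where "u \<in> H10 U" "L2_tendsto U f u"
    "\<And>\<eta>. \<eta> \<in> H10 U \<Longrightarrow> (\<lambda>n. dir U (f n) \<eta>) \<longlonglongrightarrow> dir U u \<eta>"
proof -
  have C0: "0 \<le> C" using C[of 0] S.nonneg[OF f[of 0]] by linarith
  have fL: "f n \<in> L2 U" for n using f H10_L2 by blast
  have nf: "S.nrm (f n) \<le> sqrt C" for n using C unfolding S.nrm_def by simp
  have Cauchy: "\<exists>N. \<forall>m\<ge>N. \<forall>n\<ge>N. L2_norm U (\<lambda>x. f m x - f n x) < r" if r: "r > 0" for r
  proof -
    \<comment> \<open>A difference of two members has energy at most \<open>4 * C\<close>, so its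
      tail contributes at most half of \<open>r\<^sup>2\<close>; the low modes contribute less than
      the other half, namely twice \<open>r\<^sup>2 / 8\<close> for each of the two members.\<close>
    obtain J where J: "l J \<ge> max 1 (8 * C / r\<^sup>2 + 1)"
      using l_at_top unfolding filterlim_at_top eventually_sequentially by blast
    have J0: "l J > 0" "8 * C / r\<^sup>2 < l J" using J by auto
    have "(\<lambda>n. \<Sum>j<J. (ip U (f n) (e j) - c j)\<^sup>2) \<longlonglongrightarrow> (\<Sum>j<J. (c j - c j)\<^sup>2)"
      by (intro tendsto_intros conv)
    then have "(\<lambda>n. \<Sum>j<J. (ip U (f n) (e j) - c j)\<^sup>2) \<longlonglongrightarrow> 0" by simp
    from order_tendstoD(2)[OF this, of "r\<^sup>2 / 8"] r obtain N where
      N: "\<And>n. n \<ge> N \<Longrightarrow> (\<Sum>j<J. (ip U (f n) (e j) - c j)\<^sup>2) < r\<^sup>2 / 8"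
      by (auto simp: eventually_sequentially)
    have "L2_norm U (\<lambda>x. f m x - f n x) < r" if mn: "m \<ge> N" "n \<ge> N" for m n
    proof -
      have d: "(\<lambda>x. f m x - f n x) \<in> H10 U" using f by (intro S.diff_mem)
      have "S.nrm (\<lambda>x. f m x - f n x) \<le> 2 * sqrt C"
        using S.nrm_triangle[OF f[of m] S.scale_mem[OF f[of n], of "-1"]] S.nrm_scale[OF f[of n], of "-1"] nf[of m] nf[of n]
        by simp
      then have "(S.nrm (\<lambda>x. f m x - f n x))\<^sup>2 \<le> (2 * sqrt C)\<^sup>2"
        by (rule power_mono) (rule S.nrm_nonneg[OF d])
      then have 1: "a (\<lambda>x. f m x - f n x) (\<lambda>x. f m x - f n x) \<le> 4 * C"
        using C0 by (simp add: S.nrm_squared[OF d] power_mult_distrib)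
      have sq: "(p - q)\<^sup>2 \<le> 2 * p\<^sup>2 + 2 * q\<^sup>2" for p q :: real
        using zero_le_power2[of "p + q"] by (simp add: power2_sum power2_diff)
      have "(\<Sum>j<J. (S.coef (\<lambda>x. f m x - f n x) j)\<^sup>2) \<le>
          (\<Sum>j<J. 2 * (ip U (f m) (e j) - c j)\<^sup>2 + 2 * (ip U (f n) (e j) - c j)\<^sup>2)"
      proof (rule sum_mono)
        fix j
        have "S.coef (\<lambda>x. f m x - f n x) j = (ip U (f m) (e j) - c j) - (ip U (f n) (e j) - c j)"
          unfolding S.coef_def using fL S.e_L2 by (simp add: L2.diff_left)
        then show "(S.coef (\<lambda>x. f m x - f n x) j)\<^sup>2 \<le> 2 * (ip U (f m) (e j) - c j)\<^sup>2 + 2 * (ip U (f n) (e j) - c j)\<^sup>2"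
          using sq[of "ip U (f m) (e j) - c j" "ip U (f n) (e j) - c j"] by simp
      qed
      also have "\<dots> < r\<^sup>2 / 2"
        using N[OF mn(1)] N[OF mn(2)] by (simp add: sum.distrib flip: sum_distrib_left)
      finally have 2: "(\<Sum>j<J. (S.coef (\<lambda>x. f m x - f n x) j)\<^sup>2) < r\<^sup>2 / 2" .
      have "a (\<lambda>x. f m x - f n x) (\<lambda>x. f m x - f n x) / l J \<le> 4 * C / l J"
        using 1 J0 by (simp add: divide_right_mono)
      also have "\<dots> \<le> r\<^sup>2 / 2" using J0 r by (simp add: field_simps)
      finally have "ip U (\<lambda>x. f m x - f n x) (\<lambda>x. f m x - f n x) < r\<^sup>2"
        using S.ip_le_tail[OF d J0(1)] 2 by linarith
      then have "(L2_norm U (\<lambda>x. f m x - f n x))\<^sup>2 < r\<^sup>2" by (simp add: L2_norm_power2_ip)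
      then show ?thesis using r by (simp add: power2_less_imp_less)
    qed
    then show ?thesis by blast
  qed
  obtain u where u: "u \<in> L2 U" "L2_tendsto U f u"
    using L2_complete[OF fL Cauchy] by blast
  have coef_lim: "(\<lambda>n. S.coef (f n) j) \<longlonglongrightarrow> S.coef u j" for j
    unfolding S.coef_def
    by (rule L2.tendsto_form) (use fL u S.e_L2 L2_zero in \<open>auto simp: L2_nrm_eq L2_norm_def\<close>)
  \<comment> \<open>\<open>T\<close> is increasing and bounded, hence Cauchy, and its increments
    dominate the squared Dirichlet norms of the increments of the expansion of
    \<open>u\<close>.\<close>
  define T where "T N = (\<Sum>j<N. l j * (S.coef u j)\<^sup>2)" for N
  have T_le: "T N \<le> C" for N
  proof (rule LIMSEQ_le_const2)
    show "(\<lambda>n. \<Sum>j<N. l j * (S.coef (f n) j)\<^sup>2) \<longlonglongrightarrow> T N"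
      unfolding T_def by (intro tendsto_intros coef_lim)
    show "\<exists>M. \<forall>n\<ge>M. (\<Sum>j<N. l j * (S.coef (f n) j)\<^sup>2) \<le> C"
      using S.bessel[OF f] C order_trans by blast
  qed
  have "incseq T" unfolding T_def by (intro incseq_SucI) (simp add: S.l_nonneg)
  then obtain t where "T \<longlonglongrightarrow> t" using incseq_convergent[of T C] T_le by blast
  then have "convergent T" by (rule convergentI)
  then have T_Cauchy: "Cauchy T" by (simp add: Cauchy_convergent_iff)
  define v where "v N = (\<lambda>x. \<Sum>j<N. S.coef u j *\<^sub>R e j x)" for N
  have v: "v N \<in> H10 U" "v N \<in> H1 U" "v N \<in> L2 U" for N
  proof -
    show "v N \<in> H10 U" unfolding v_def by (rule S.sum_mem[OF S.e_mem])
    then show "v N \<in> H1 U" "v N \<in> L2 U" by (auto intro: H10_H1 H10_L2)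
  qed
  have v_diff: "D.nrm (\<lambda>x. v M x - v N x) \<le> sqrt (T M - T N)" if "N \<le> M" for M N
  proof -
    have "sum q {..<M} - sum q {..<N} = sum q {N..<M}" for q :: "nat \<Rightarrow> real"
      using sum_diff_nat_ivl[of 0 N M q] that by (simp add: lessThan_atLeast0)
    then have eq: "(\<lambda>x. v M x - v N x) = (\<lambda>x. \<Sum>j\<in>{N..<M}. S.coef u j *\<^sub>R e j x)"
      and T: "T M - T N = (\<Sum>j\<in>{N..<M}. l j * (S.coef u j)\<^sup>2)"
      unfolding v_def T_def by simp_all
    have "dir U (\<lambda>x. v M x - v N x) (\<lambda>x. v M x - v N x) \<le> T M - T N"
      using dirichlet_le[OF S.diff_mem[OF v(1)[of M] v(1)[of N]]]
      unfolding T eq by (simp only: S.a_expansion finite_atLeastLessThan)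
    then show ?thesis unfolding D.nrm_def by simp
  qed
  have grads: "weak_grad U (v N) \<in> L2 U" for N using v weak_grad_L2 by blast
  have "\<exists>N. \<forall>m\<ge>N. \<forall>n\<ge>N. L2_norm U (\<lambda>x. weak_grad U (v m) x - weak_grad U (v n) x) < r" if r: "r > 0" for r
  proof -
    obtain N where N: "\<And>m n. m \<ge> N \<Longrightarrow> n \<ge> N \<Longrightarrow> \<bar>T m - T n\<bar> < r\<^sup>2"
      using CauchyD[OF T_Cauchy, of "r\<^sup>2"] r by auto
    have *: "D.nrm (\<lambda>x. v m x - v n x) < r" if "n \<ge> N" "n \<le> m" for m n
    proof -
      have "sqrt (T m - T n) < sqrt (r\<^sup>2)" using N[of m n] that by (intro real_sqrt_less_mono) auto
      then show ?thesis using v_diff[OF that(2)] r by simp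
    qed
    have "D.nrm (\<lambda>x. v m x - v n x) < r" if "m \<ge> N" "n \<ge> N" for m n
      using *[of n m] *[of m n] that D.nrm_minus_commute[OF v(2) v(2), of m n] by (cases "n \<le> m") auto
    then show ?thesis
      using D_nrm_diff[OF v(3) weak_grad_is[OF v(2)] v(3) weak_grad_is[OF v(2)]] by auto
  qed
  then obtain g where g: "g \<in> L2 U" "(\<lambda>n. L2_norm U (\<lambda>x. weak_grad U (v n) x - g x)) \<longlonglongrightarrow> 0"
    using L2_complete[of "\<lambda>n. weak_grad U (v n)", OF grads] by blast
  have "L2_tendsto U v u"
    using S.expansion_tendsto[OF u(1)] L2.nrm_minus_commute[OF u(1) v(3)]
    by (simp add: v_def L2_nrm_eq)
  from H10_closed(1)[OF v(1) weak_grad_is[OF v(2)] u(1) g(1) this g(2)] have u0: "u \<in> H10 U" .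
  show ?thesis
  proof (rule that[OF u0 u(2)])
    fix \<eta> assume "\<eta> \<in> H10 U"
    then show "(\<lambda>n. dir U (f n) \<eta>) \<longlonglongrightarrow> dir U u \<eta>"
      using dirichlet_form_weak_tendsto[OF H10_H1[OF f] H10_H1[OF u0] u(2)] dirichlet_le[OF f] C order_trans by blast
  qed
qed

end

subsection \<open>Counting eigenvalues\<close>

text \<open>Gram-Schmidt by counting: while \<open>card J < m\<close>, some nonzero combination of
  the \<open>m\<close> basis functions is orthogonal to the family found so far. The arbitrary index
  set \<open>J\<close> lets an eigenspace be indexed by the positions of its eigenvalue in the
  list.\<close>

lemma orthonormal_family_of_dim:
  assumes W: "sym_form W (ip U)" "W \<subseteq> L2 U" and dim: "has_dim_ae U W m"
    and J: "finite J" "card J \<le> m"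
  shows "\<exists>g. (\<forall>j\<in>J. g j \<in> W) \<and> (\<forall>i\<in>J. \<forall>j\<in>J. ip U (g i) (g j) = (if i = j then 1 else 0))"
  using J
proof (induction J rule: finite_induct)
  case empty
  then show ?case by simp
next
  case (insert p J)
  interpret W: sym_form W "ip U" by (rule W)
  obtain g where g: "\<And>j. j \<in> J \<Longrightarrow> g j \<in> W"
    "\<And>i j. i \<in> J \<Longrightarrow> j \<in> J \<Longrightarrow> ip U (g i) (g j) = (if i = j then 1 else 0)"
    using insert by auto
  obtain f where f: "\<And>i. i < m \<Longrightarrow> f i \<in> W"
    "\<And>c::nat \<Rightarrow> real. AE x in leb U. (\<Sum>i<m. c i * f i x) = 0 \<Longrightarrow> \<forall>i<m. c i = 0"
    using dim unfolding has_dim_ae_def by auto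
  obtain h where h: "bij_betw h {..<card J} J"
    using ex_bij_betw_nat_finite[OF insert(1)] by (auto simp: lessThan_atLeast0)
  obtain x where x: "\<exists>i\<in>{..<m}. x i \<noteq> 0" "\<forall>j<card J. (\<Sum>i<m. x i * ip U (f i) (g (h j))) = 0"
    using underdetermined_system[of "{..<m}" "card J" "\<lambda>i j. ip U (f i) (g (h j))"] insert by auto
  define u where "u = (\<lambda>y. \<Sum>i<m. x i *\<^sub>R f i y)"
  have u: "u \<in> W" unfolding u_def using f by (intro W.sum_mem) auto
  have ug: "ip U u (g j) = 0" if "j \<in> J" for j
  proof -
    have "j \<in> h ` {..<card J}" using h that by (simp add: bij_betw_def)
    then obtain j' where "j' < card J" "h j' = j" by blast
    then show ?thesis unfolding u_def using x(2) f g that by (subst W.sum_left) auto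
  qed
  have "ip U u u \<noteq> 0"
  proof
    assume "ip U u u = 0"
    then have "(L2_norm U u)\<^sup>2 = 0" by (simp add: L2_norm_power2_ip)
    then have "AE y in leb U. u y = 0"
      using u W(2) by (intro L2_norm_eq_0_AE) auto
    then show False using f(2)[of x] x(1) by (auto simp: u_def)
  qed
  then have pos: "W.nrm u > 0" using W.nonneg[OF u] by (simp add: W.nrm_def)
  define g' where "g' = g(p := (\<lambda>y. inverse (W.nrm u) *\<^sub>R u y))"
  have "ip U (\<lambda>y. inverse (W.nrm u) *\<^sub>R u y) (\<lambda>y. inverse (W.nrm u) *\<^sub>R u y) =
      inverse (W.nrm u) * (inverse (W.nrm u) * (W.nrm u)\<^sup>2)"
    by (simp only: W.scale_left W.scale_right W.scale_mem u W.nrm_squared)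
  also have "\<dots> = 1" using pos by (simp add: power2_eq_square field_simps)
  finally have 1: "ip U (g' p) (g' p) = 1" by (simp add: g'_def)
  have g'p: "g' p \<in> W" unfolding g'_def using W.scale_mem[OF u] by simp
  have 2: "ip U (g' p) (g j) = 0" "ip U (g j) (g' p) = 0" if "j \<in> J" for j
  proof -
    show "ip U (g' p) (g j) = 0"
      using W.scale_left[OF u g(1)[OF that], of "inverse (W.nrm u)"] ug[OF that] by (simp add: g'_def)
    then show "ip U (g j) (g' p) = 0" using W.sym[OF g'p g(1)[OF that]] by simp
  qed
  have eq: "g' j = g j" if "j \<in> J" for j using that insert(2) by (auto simp: g'_def)
  show ?case
    by (rule exI[of _ g']) (use 1 2 g g'p eq insert(2) in auto)
qed

text \<open>A larger family would have a nontrivial combination vanishing almost everywhere,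
  although its squared norm is the sum of the squared coefficients.\<close>

lemma card_orthonormal_le_dim:
  fixes g :: "'j \<Rightarrow> 'a::euclidean_space \<Rightarrow> real"
  assumes W: "W \<subseteq> L2 U" and dim: "has_dim_ae U W m" and J: "finite J"
    and g: "\<And>j. j \<in> J \<Longrightarrow> g j \<in> W"
      "\<And>i j. i \<in> J \<Longrightarrow> j \<in> J \<Longrightarrow> ip U (g i) (g j) = (if i = j then 1 else 0)"
  shows "card J \<le> m"
proof (rule ccontr)
  assume "\<not> card J \<le> m"
  obtain f where f: "\<forall>w\<in>W. \<exists>c::nat \<Rightarrow> real. AE x in leb U. w x = (\<Sum>i<m. c i * f i x)"
    using dim unfolding has_dim_ae_def by (elim exE conjE) (rule that)
  have "\<forall>j\<in>J. \<exists>c::nat \<Rightarrow> real. AE x in leb U. g j x = (\<Sum>i<m. c i * f i x)"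
    using f g by blast
  then obtain c where c: "\<And>j. j \<in> J \<Longrightarrow> AE x in leb U. g j x = (\<Sum>i<m. c j i * f i x)"
    by metis
  obtain y where y: "\<exists>j\<in>J. y j \<noteq> 0" "\<forall>i<m. (\<Sum>j\<in>J. y j * c j i) = 0"
    using underdetermined_system[OF J, of m c] \<open>\<not> card J \<le> m\<close> by auto
  define u where "u = (\<lambda>x. \<Sum>j\<in>J. y j *\<^sub>R g j x)"
  have gL: "g j \<in> L2 U" if "j \<in> J" for j using g that W by blast
  have "AE x in leb U. \<forall>j\<in>J. g j x = (\<Sum>i<m. c j i * f i x)"
    using c J by (intro AE_finite_allI) auto
  then have u0: "AE x in leb U. u x = 0"
  proof eventually_elim
    case (elim x)
    have "u x = (\<Sum>j\<in>J. \<Sum>i<m. (y j * c j i) * f i x)"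
      unfolding u_def using elim by (simp add: sum_distrib_left mult_ac)
    also have "\<dots> = (\<Sum>i<m. (\<Sum>j\<in>J. y j * c j i) * f i x)"
      by (subst sum.swap) (simp add: sum_distrib_right)
    finally show ?case using y by simp
  qed
  have "u \<in> L2 U" unfolding u_def using gL by (intro L2.sum_mem)
  then have "ip U u u = ip U (\<lambda>x. 0 :: real) (\<lambda>x. 0)"
    using u0 L2_zero by (intro ip_cong_AE) auto
  then have "ip U u u = 0" by (simp add: ip_def)
  moreover have "ip U u u = (\<Sum>j\<in>J. (y j)\<^sup>2)"
  proof -
    have "ip U u u = (\<Sum>i\<in>J. \<Sum>j\<in>J. y i * y j * ip U (g i) (g j))"
      unfolding u_def using gL by (intro L2.sum_sum)
    also have "\<dots> = (\<Sum>i\<in>J. \<Sum>j\<in>J. if i = j then y i * y j else 0)"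
      by (intro sum.cong refl) (simp add: g(2))
    finally show ?thesis using J by (simp add: power2_eq_square)
  qed
  ultimately show False using y(1) J by (auto simp: sum_nonneg_eq_0_iff)
qed

text \<open>The counterpart of \<open>spectral\<close> for the limit problem, where no basis of
  eigenfunctions is at hand.\<close>

locale form_in_L2 = sym_form V a for V :: "('a::euclidean_space \<Rightarrow> real) set" and a +
  fixes U :: "'a set"
  assumes sub_L2: "V \<subseteq> L2 U"
begin

lemma eigenspace_iff: "w \<in> eigenspace U V a \<mu> \<longleftrightarrow> w \<in> V \<and> (\<forall>\<eta>\<in>V. a w \<eta> = \<mu> * ip U w \<eta>)"
  by (simp add: eigenspace_def L2_inner_eq_ip)

lemma eigenspace_sym_form: "sym_form (eigenspace U V a \<mu>) (ip U)"
proof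
  fix u v z :: "'a \<Rightarrow> real" and c
  have L: "f \<in> L2 U" if "f \<in> V" for f using that sub_L2 by blast
  show "(\<lambda>x. 0) \<in> eigenspace U V a \<mu>"
    using zero_mem by (auto simp: eigenspace_iff zero_left L2.zero_left[OF L])
  assume *: "u \<in> eigenspace U V a \<mu>" "v \<in> eigenspace U V a \<mu>"
  then have uv: "u \<in> V" "v \<in> V" "u \<in> L2 U" "v \<in> L2 U" using L by (auto simp: eigenspace_iff)
  show "(\<lambda>x. c *\<^sub>R u x + v x) \<in> eigenspace U V a \<mu>"
    unfolding eigenspace_iff
  proof (intro conjI ballI)
    show "(\<lambda>x. c *\<^sub>R u x + v x) \<in> V" by (rule lin_mem[OF uv(1,2)])
    fix \<eta> assume \<eta>: "\<eta> \<in> V"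
    show "a (\<lambda>x. c *\<^sub>R u x + v x) \<eta> = \<mu> * ip U (\<lambda>x. c *\<^sub>R u x + v x) \<eta>"
      unfolding lin[OF uv(1,2) \<eta>] L2.lin[OF uv(3,4) L[OF \<eta>]] using * \<eta>
      by (simp add: eigenspace_iff algebra_simps)
  qed
  show "ip U u v = ip U v u" using uv by (intro L2.sym)
  show "0 \<le> ip U u u" using uv by (intro L2.nonneg)
  assume "z \<in> eigenspace U V a \<mu>"
  then show "ip U (\<lambda>x. c *\<^sub>R u x + v x) z = c * ip U u z + ip U v z"
    using uv L by (intro L2.lin) (auto simp: eigenspace_iff)
qed

lemma eigenspace_orthogonal:
  assumes "u \<in> eigenspace U V a \<mu>" "v \<in> eigenspace U V a \<nu>" "\<mu> \<noteq> \<nu>"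
  shows "ip U u v = 0"
proof -
  have uv: "u \<in> V" "v \<in> V" "u \<in> L2 U" "v \<in> L2 U" using assms sub_L2 by (auto simp: eigenspace_iff)
  have "\<mu> * ip U u v = \<nu> * ip U v u"
    using assms uv sym[OF uv(1,2)] by (simp add: eigenspace_iff)
  then show ?thesis using assms(3) L2.sym[OF uv(3,4)] by simp
qed

text \<open>Within one eigenspace the multiplicity supplies the family; functions to different
  eigenvalues are orthogonal by symmetry of the form.\<close>

lemma orthonormal_eigenfunctions:
  assumes "eigenvalue_sequence U V a l"
  obtains v where "\<And>j. v j \<in> eigenspace U V a (l j)"
    "\<And>i j. ip U (v i) (v j) = (if i = j then 1 else 0)"
proof -
  have W: "eigenspace U V a \<mu> \<subseteq> L2 U" for \<mu> using sub_L2 by (auto simp: eigenspace_iff)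
  have "\<forall>\<mu>. \<exists>g. (\<forall>j\<in>{j. l j = \<mu>}. g j \<in> eigenspace U V a \<mu>) \<and>
    (\<forall>i\<in>{j. l j = \<mu>}. \<forall>j\<in>{j. l j = \<mu>}. ip U (g i) (g j) = (if i = j then 1 else 0))"
  proof
    fix \<mu>
    show "\<exists>g. (\<forall>j\<in>{j. l j = \<mu>}. g j \<in> eigenspace U V a \<mu>) \<and>
    (\<forall>i\<in>{j. l j = \<mu>}. \<forall>j\<in>{j. l j = \<mu>}. ip U (g i) (g j) = (if i = j then 1 else 0))"
      by (rule orthonormal_family_of_dim[OF eigenspace_sym_form W])
         (use assms in \<open>auto simp: eigenvalue_sequence_def\<close>)
  qed
  then obtain g where "\<forall>\<mu>. (\<forall>j\<in>{j. l j = \<mu>}. g \<mu> j \<in> eigenspace U V a \<mu>) \<and>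
    (\<forall>i\<in>{j. l j = \<mu>}. \<forall>j\<in>{j. l j = \<mu>}. ip U (g \<mu> i) (g \<mu> j) = (if i = j then 1 else 0))"
    by (rule choice[THEN exE])
  then have g: "\<And>\<mu> j. l j = \<mu> \<Longrightarrow> g \<mu> j \<in> eigenspace U V a \<mu>"
    "\<And>\<mu> i j. l i = \<mu> \<Longrightarrow> l j = \<mu> \<Longrightarrow> ip U (g \<mu> i) (g \<mu> j) = (if i = j then 1 else 0)"
    by simp_all
  show ?thesis
  proof (rule that[of "\<lambda>j. g (l j) j"])
    show "g (l j) j \<in> eigenspace U V a (l j)" for j by (rule g) simp
    show "ip U (g (l i) i) (g (l j) j) = (if i = j then 1 else 0)" for i j
    proof (cases "l i = l j")
      case True
      then show ?thesis using g(2)[of i "l j" j] by simp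
    next
      case False
      then show ?thesis using eigenspace_orthogonal[OF g(1) g(1) False] by auto
    qed
  qed
qed

text \<open>Pigeonhole principle: if \<open>\<mu> k < l k\<close>, all positions at which
  \<open>l\<close> takes a value \<open>\<mu> j\<close> lie below \<open>k\<close>, so the
  eigenspaces in question have total dimension at most \<open>k\<close>, yet contain
  \<open>k + 1\<close> orthonormal functions. A \<open>\<mu> j\<close> missing from the list needs
  no separate case, as its eigenspace has dimension 0.\<close>

lemma eigenvalue_le_of_orthonormal_eigenfunctions:
  assumes l: "eigenvalue_sequence U V a l"
    and u: "\<And>j. j \<le> k \<Longrightarrow> u j \<in> eigenspace U V a (\<mu> j)"
      "\<And>i j. i \<le> k \<Longrightarrow> j \<le> k \<Longrightarrow> ip U (u i) (u j) = (if i = j then 1 else 0)"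
    and \<mu>: "\<And>j. j \<le> k \<Longrightarrow> \<mu> j \<le> \<mu> k"
  shows "l k \<le> \<mu> k"
proof (rule ccontr)
  assume "\<not> l k \<le> \<mu> k"
  then have less: "\<mu> k < l k" by simp
  have l': "mono l" "\<And>\<nu>. finite {j. l j = \<nu>}" "\<And>\<nu>. has_dim_ae U (eigenspace U V a \<nu>) (card {j. l j = \<nu>})"
    using l by (auto simp: eigenvalue_sequence_def)
  have W: "eigenspace U V a \<nu> \<subseteq> L2 U" for \<nu> using sub_L2 by (auto simp: eigenspace_iff)
  have "{..k} = (\<Union>\<nu>\<in>\<mu> ` {..k}. {j\<in>{..k}. \<mu> j = \<nu>})" by auto
  then have "card {..k} = card (\<Union>\<nu>\<in>\<mu> ` {..k}. {j\<in>{..k}. \<mu> j = \<nu>})" by (rule arg_cong)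
  also have "\<dots> \<le> (\<Sum>\<nu>\<in>\<mu> ` {..k}. card {j\<in>{..k}. \<mu> j = \<nu>})"
    by (rule card_UN_le) simp
  also have "\<dots> \<le> (\<Sum>\<nu>\<in>\<mu> ` {..k}. card {j. l j = \<nu>})"
  proof (rule sum_mono)
    fix \<nu>
    show "card {j\<in>{..k}. \<mu> j = \<nu>} \<le> card {j. l j = \<nu>}"
      by (rule card_orthonormal_le_dim[OF W l'(3), of _ u]) (use u in auto)
  qed
  also have "\<dots> = card (\<Union>\<nu>\<in>\<mu> ` {..k}. {j. l j = \<nu>})"
    by (subst card_UN_disjoint) (use l'(2) in auto)
  also have "\<dots> \<le> card {..<k}"
  proof (rule card_mono)
    show "(\<Union>\<nu>\<in>\<mu> ` {..k}. {j. l j = \<nu>}) \<subseteq> {..<k}"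
    proof clarsimp
      fix i j assume "i \<le> k" "l j = \<mu> i"
      then have "l j < l k" using \<mu>[of i] less by simp
      then show "j < k" using l'(1) by (metis monoD not_le)
    qed
  qed simp
  finally show False by simp
qed

end

subsection \<open>Spectral limit of penalised forms\<close>

definition weighted :: "'a::euclidean_space set \<Rightarrow> ('a \<Rightarrow> real) \<Rightarrow> ('a \<Rightarrow> real) \<Rightarrow> ('a \<Rightarrow> real) \<Rightarrow> real" where
  "weighted U q u v = (LINT x|leb U. q x * u x * v x)"

lemma diffuse_form_eq:
  "diffuse_form U \<beta> \<phi> = (\<lambda>u v. dir U u v + weighted U (\<lambda>x. \<beta> (\<phi> x)) u v)"
  by (simp add: fun_eq_iff diffuse_form_def weighted_def)

text \<open>The bound may depend on the weight; along the sequence of penalties it is allowed to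
  blow up. It holds almost everywhere only, like the bound on the phase fields.\<close>

definition bounded_weight :: "'a::euclidean_space set \<Rightarrow> ('a \<Rightarrow> real) \<Rightarrow> bool" where
  "bounded_weight U q \<longleftrightarrow> q \<in> meas U \<and>
    (\<exists>K. AE x in leb U. 0 \<le> q x \<and> q x \<le> K)"

lemma weighted_integrable:
  assumes q: "bounded_weight U q" and "u \<in> L2 U" "v \<in> L2 U"
  shows "integrable (leb U) (\<lambda>x. q x * u x * v x)"
proof -
  obtain K where K: "AE x in leb U. 0 \<le> q x \<and> q x \<le> K" using q by (auto simp: bounded_weight_def)
  show ?thesis
  proof (rule Bochner_Integration.integrable_bound)
    show "integrable (leb U) (\<lambda>x. K * (norm (u x) * norm (v x)))"
      using L2_integrable_mult[OF assms(2,3)] by (rule integrable_mult_right)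
    show "(\<lambda>x. q x * u x * v x) \<in> meas U"
      using q assms(2,3)[THEN L2_measurable] by (auto simp: bounded_weight_def)
    show "AE x in leb U. norm (q x * u x * v x) \<le> norm (K * (norm (u x) * norm (v x)))"
      using K by eventually_elim (auto simp: abs_mult mult.assoc intro!: mult_right_mono)
  qed
qed

lemma weighted_sym_form:
  assumes q: "bounded_weight U q"
  shows "sym_form (L2 U) (weighted U q)"
proof
  fix u v z :: "'a \<Rightarrow> real" and c
  assume *: "u \<in> L2 U" "v \<in> L2 U" "z \<in> L2 U"
  have "weighted U q (\<lambda>x. c *\<^sub>R u x + v x) z = (LINT x|leb U. c * (q x * u x * z x) + q x * v x * z x)"
    unfolding weighted_def by (intro Bochner_Integration.integral_cong) (auto simp: algebra_simps)
  also have "\<dots> = c * weighted U q u z + weighted U q v z"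
    using * weighted_integrable[OF q] by (simp add: weighted_def)
  finally show "weighted U q (\<lambda>x. c *\<^sub>R u x + v x) z = c * weighted U q u z + weighted U q v z" .
next
  fix u :: "'a \<Rightarrow> real"
  show "0 \<le> weighted U q u u"
    unfolding weighted_def
  proof (rule integral_nonneg_AE)
    show "AE x in leb U. 0 \<le> q x * u x * u x"
      using q unfolding bounded_weight_def by (auto elim!: AE_mp simp: mult.assoc)
  qed
qed (auto simp: L2_zero weighted_def mult_ac intro: L2_lin[where 'b = real, simplified])

lemma weighted_bound:
  assumes q: "bounded_weight U q"
  obtains K where "K \<ge> 0" "\<And>u. u \<in> L2 U \<Longrightarrow> weighted U q u u \<le> K * ip U u u"
proof -
  obtain K where K: "AE x in leb U. 0 \<le> q x \<and> q x \<le> K" using q by (auto simp: bounded_weight_def)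
  have "weighted U q u u \<le> \<bar>K\<bar> * ip U u u" if u: "u \<in> L2 U" for u
  proof -
    have "weighted U q u u \<le> (LINT x|leb U. \<bar>K\<bar> * (u x * u x))"
      unfolding weighted_def
    proof (rule integral_mono_AE)
      show "AE x in leb U. q x * u x * u x \<le> \<bar>K\<bar> * (u x * u x)"
        using K by eventually_elim (auto simp: mult.assoc intro!: mult_right_mono)
    qed (use weighted_integrable[OF q u u] L2_integrable_times[OF u u] in auto)
    then show ?thesis by (simp add: ip_def)
  qed
  then show ?thesis using that[of "\<bar>K\<bar>"] by simp
qed

text \<open>\<open>recovery\<close> and \<open>barrier\<close> are the limsup and liminf halves of
  the convergence of the penalties; as assumptions they separate the spectral argument from the
  coefficients. \<open>barrier\<close> is stated along subsequences because it is applied after an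
  extraction.\<close>

locale penalised_limit = sobolev U for U :: "'a::euclidean_space set" +
  fixes E :: "'a set" and q :: "nat \<Rightarrow> 'a \<Rightarrow> real" and w :: "nat \<Rightarrow> nat \<Rightarrow> 'a \<Rightarrow> real"
    and l :: "nat \<Rightarrow> nat \<Rightarrow> real" and V and l0 :: "nat \<Rightarrow> real"
  assumes V_def: "V = {\<eta> \<in> H10 U. AE x in leb U. x \<notin> E \<longrightarrow> \<eta> x = 0}"
    and weight: "bounded_weight U (q n)"
    and spec: "dirichlet_spectral U (\<lambda>u v. dir U u v + weighted U (q n) u v) (w n) (l n)"
    and spec0: "eigenvalue_sequence U V (dir U) l0"
    and recovery: "\<eta> \<in> V \<Longrightarrow> (\<And>x. \<bar>\<eta> x\<bar> \<le> M) \<Longrightarrow> (\<lambda>n. weighted U (q n) \<eta> \<eta>) \<longlonglongrightarrow> 0"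
    and barrier: "strict_mono r \<Longrightarrow> (\<And>n. f n \<in> H10 U) \<Longrightarrow> u \<in> H10 U \<Longrightarrow>
      (\<And>n. weighted U (q (r n)) (f n) (f n) \<le> C) \<Longrightarrow> L2_tendsto U f u \<Longrightarrow> u \<in> V"
begin

sublocale B: sym_form "L2 U" "weighted U (q n)" for n
  by (rule weighted_sym_form[OF weight])

sublocale P: dirichlet_spectral U "\<lambda>u v. dir U u v + weighted U (q n) u v" "w n" "l n" for n
  by (rule spec)

lemma V_H10: "\<eta> \<in> V \<Longrightarrow> \<eta> \<in> H10 U" "\<eta> \<in> V \<Longrightarrow> \<eta> \<in> H1 U" "\<eta> \<in> V \<Longrightarrow> \<eta> \<in> L2 U"
  unfolding V_def using H10_H1 H1_L2 by blast+

sublocale V: form_in_L2 V "dir U" U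
proof
  fix u v z :: "'a \<Rightarrow> real" and c
  show "(\<lambda>x. 0) \<in> V" unfolding V_def using H10_zero by simp
  assume *: "u \<in> V" "v \<in> V"
  then have "AE x in leb U. x \<notin> E \<longrightarrow> u x = 0" "AE x in leb U. x \<notin> E \<longrightarrow> v x = 0"
    by (auto simp: V_def)
  then have "AE x in leb U. x \<notin> E \<longrightarrow> c *\<^sub>R u x + v x = 0" by eventually_elim auto
  then show "(\<lambda>x. c *\<^sub>R u x + v x) \<in> V" unfolding V_def using H10_lin[OF V_H10(1) V_H10(1)] * by blast
  assume "z \<in> V"
  then show "dir U (\<lambda>x. c *\<^sub>R u x + v x) z = c * dir U u z + dir U v z"
    using * V_H10 by (intro D.lin)
qed (auto intro: D.sym D.nonneg V_H10)

lemma trunc_V: "\<eta> \<in> V \<Longrightarrow> c > 0 \<Longrightarrow> (\<lambda>x. trunc c (\<eta> x)) \<in> V"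
  using trunc_H10 unfolding V_def by (auto elim!: AE_mp)

text \<open>Approximation within \<open>V\<close> by functions of modulus at most
  \<open>m + 1\<close>, to which \<open>recovery\<close> applies.\<close>

definition cut :: "nat \<Rightarrow> ('a \<Rightarrow> real) \<Rightarrow> 'a \<Rightarrow> real" where
  "cut m \<eta> x = trunc (inverse (real (Suc m))) (\<eta> x)"

lemma cut_V: "\<eta> \<in> V \<Longrightarrow> cut m \<eta> \<in> V"
  unfolding cut_def[abs_def] by (rule trunc_V) auto

lemma cut_tendsto:
  assumes "\<eta> \<in> V"
  shows "(\<lambda>m. L2.nrm U (\<lambda>x. cut m \<eta> x - \<eta> x)) \<longlonglongrightarrow> 0" "(\<lambda>m. D.nrm (\<lambda>x. cut m \<eta> x - \<eta> x)) \<longlonglongrightarrow> 0"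
  using trunc_H1_tendsto[OF V_H10(1)[OF assms]]
    H1_norm_tendsto_iff[of "\<lambda>m. cut m \<eta>" \<eta>] V_H10(2)[OF cut_V[OF assms]] V_H10(2)[OF assms]
  by (simp_all add: cut_def L2_nrm_eq)

lemma cut_recovery: "\<eta> \<in> V \<Longrightarrow> (\<lambda>n. weighted U (q n) (cut m \<eta>) (cut m \<eta>)) \<longlonglongrightarrow> 0"
  by (rule recovery[OF cut_V, where M = "1 / inverse (real (Suc m))"])
     (auto simp: cut_def intro!: trunc_bound simp del: of_nat_Suc)

text \<open>As the weights may blow up, \<open>L2\<close> bounds are of no help; Cauchy-Schwarz for
  the weighted form itself uses bounded penalty of one factor and vanishing penalty of the
  other.\<close>

lemma weighted_mixed_tendsto:
  assumes "\<And>n. u n \<in> L2 U" "\<And>n. v n \<in> L2 U" and C: "\<And>n. weighted U (q (r n)) (u n) (u n) \<le> C"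
    and v: "(\<lambda>n. weighted U (q (r n)) (v n) (v n)) \<longlonglongrightarrow> 0"
  shows "(\<lambda>n. weighted U (q (r n)) (u n) (v n)) \<longlonglongrightarrow> 0"
proof -
  have "(\<lambda>n. C * weighted U (q (r n)) (v n) (v n)) \<longlonglongrightarrow> 0"
    using tendsto_mult_left[OF v, of C] by simp
  then have "(\<lambda>n. (weighted U (q (r n)) (u n) (v n))\<^sup>2) \<longlonglongrightarrow> 0"
  proof (rule tendsto_0_squeeze)
    fix n
    have "(weighted U (q (r n)) (u n) (v n))\<^sup>2 \<le> weighted U (q (r n)) (u n) (u n) * weighted U (q (r n)) (v n) (v n)"
      by (rule B.Cauchy_Schwarz) (use assms in auto)
    also have "\<dots> \<le> C * weighted U (q (r n)) (v n) (v n)"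
      by (intro mult_right_mono C B.nonneg assms)
    finally show "(weighted U (q (r n)) (u n) (v n))\<^sup>2 \<le> C * weighted U (q (r n)) (v n) (v n)" .
  qed simp
  then show ?thesis using tendsto_real_sqrt[of "\<lambda>n. (weighted U (q (r n)) (u n) (v n))\<^sup>2" 0]
    by (simp add: tendsto_rabs_zero_iff)
qed

text \<open>The min-max principle, applied to truncated eigenfunctions of the limit problem.\<close>

lemma limsup_eigenvalue:
  assumes \<epsilon>: "\<epsilon> > 0"
  shows "\<forall>\<^sub>F n in sequentially. l n k \<le> l0 k + \<epsilon>"
proof -
  obtain v where v: "\<And>j. v j \<in> eigenspace U V (dir U) (l0 j)"
    "\<And>i j. ip U (v i) (v j) = (if i = j then 1 else 0)"
    using V.orthonormal_eigenfunctions[OF spec0] by blast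
  have vV: "v j \<in> V" for j using v by (auto simp: V.eigenspace_iff)
  have Dv: "dir U (v i) (v j) = (if i = j then l0 i else 0)" for i j
    using v vV by (auto simp: V.eigenspace_iff)
  have mono: "mono l0" using spec0 by (simp add: eigenvalue_sequence_def)
  have l0: "l0 k \<ge> 0" using Dv[of k k] D.nonneg[OF V_H10(2)[OF vV[of k]]] by simp
  \<comment> \<open>Chosen so that
    \<open>(k + 1) * \<delta> * (1 + l0 k + \<epsilon>) = \<epsilon>\<close>, which turns the bound
    of the min-max lemma into exactly \<open>l0 k + \<epsilon>\<close>.\<close>
  define \<delta> where "\<delta> = \<epsilon> / ((real k + 1) * (1 + l0 k + \<epsilon>))"
  have A: "1 + l0 k + \<epsilon> > 0" using \<epsilon> l0 by simp
  have "(real k + 1) * \<delta> = \<epsilon> / (1 + l0 k + \<epsilon>)" by (simp add: \<delta>_def)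
  then have \<delta>: "\<delta> > 0" "(real k + 1) * \<delta> * (1 + l0 k + \<epsilon>) = \<epsilon>" "(real k + 1) * \<delta> < 1"
    using \<epsilon> l0 A by (simp_all add: \<delta>_def)
  have "\<forall>\<^sub>F m in sequentially. \<forall>i\<in>{..k}. \<forall>j\<in>{..k}.
      \<bar>ip U (cut m (v i)) (cut m (v j)) - (if i = j then 1 else 0)\<bar> < \<delta> / 2 \<and>
      \<bar>dir U (cut m (v i)) (cut m (v j)) - (if i = j then l0 i else 0)\<bar> < \<delta> / 2"
  proof (intro eventually_ball_finite ballI eventually_conj)
    fix i j
    have "(\<lambda>m. ip U (cut m (v i)) (cut m (v j))) \<longlonglongrightarrow> ip U (v i) (v j)"
      by (rule L2.tendsto_form) (use vV V_H10 cut_V cut_tendsto in auto)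
    from tendstoD[OF this, of "\<delta> / 2"] \<delta>(1)
    show "\<forall>\<^sub>F m in sequentially. \<bar>ip U (cut m (v i)) (cut m (v j)) - (if i = j then 1 else 0)\<bar> < \<delta> / 2"
      by (simp add: v dist_real_def)
    have "(\<lambda>m. dir U (cut m (v i)) (cut m (v j))) \<longlonglongrightarrow> dir U (v i) (v j)"
      by (rule D.tendsto_form) (use vV V_H10 cut_V cut_tendsto in auto)
    from tendstoD[OF this, of "\<delta> / 2"] \<delta>(1)
    show "\<forall>\<^sub>F m in sequentially. \<bar>dir U (cut m (v i)) (cut m (v j)) - (if i = j then l0 i else 0)\<bar> < \<delta> / 2"
      by (simp add: Dv dist_real_def)
  qed auto
  \<comment> \<open>The truncation level is fixed before \<open>n\<close> grows, since
    \<open>recovery\<close> acts at each level separately. The other half of \<open>\<delta>\<close>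
    is left for the penalty.\<close>
  then obtain m where m: "\<And>i j. i \<le> k \<Longrightarrow> j \<le> k \<Longrightarrow>
      \<bar>ip U (cut m (v i)) (cut m (v j)) - (if i = j then 1 else 0)\<bar> < \<delta> / 2 \<and>
      \<bar>dir U (cut m (v i)) (cut m (v j)) - (if i = j then l0 i else 0)\<bar> < \<delta> / 2"
    by (auto simp: eventually_sequentially)
  have "\<forall>\<^sub>F n in sequentially. \<forall>i\<in>{..k}. \<forall>j\<in>{..k}. \<bar>weighted U (q n) (cut m (v i)) (cut m (v j))\<bar> < \<delta> / 2"
  proof (intro eventually_ball_finite ballI)
    fix i j
    have c: "cut m (v i) \<in> L2 U" "cut m (v j) \<in> L2 U" using vV V_H10 cut_V by auto
    have bnd: "Bseq (\<lambda>n. weighted U (q n) (cut m (v i)) (cut m (v i)))"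
      using cut_recovery[OF vV] convergentI convergent_imp_Bseq by blast
    then obtain C where C: "\<And>n. \<bar>weighted U (q n) (cut m (v i)) (cut m (v i))\<bar> \<le> C"
      unfolding Bseq_def by auto
    have "(\<lambda>n. weighted U (q (id n)) (cut m (v i)) (cut m (v j))) \<longlonglongrightarrow> 0"
      by (rule weighted_mixed_tendsto[of _ _ id C])
         (use c cut_recovery[OF vV] C in \<open>auto intro: order_trans[OF abs_ge_self]\<close>)
    from tendstoD[OF this, of "\<delta> / 2"] \<delta>(1)
    show "\<forall>\<^sub>F n in sequentially. \<bar>weighted U (q n) (cut m (v i)) (cut m (v j))\<bar> < \<delta> / 2"
      by (simp add: dist_real_def)
  qed auto
  then show ?thesis
  proof eventually_elim
    case (elim n)
    have "l n k * (1 - (real k + 1) * \<delta>) \<le> l0 k + (real k + 1) * \<delta>"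
    proof (rule P.S.min_max_almost_orthonormal[where k = k and f = "\<lambda>i. cut m (v i)" and \<mu> = l0])
      fix i j assume ij: "i \<le> k" "j \<le> k"
      show "cut m (v i) \<in> H10 U" using cut_V[OF vV] V_H10 by blast
      show "l0 i \<le> l0 k" using mono ij by (simp add: monoD)
      show "\<bar>ip U (cut m (v i)) (cut m (v j)) - (if i = j then 1 else 0)\<bar> \<le> \<delta>"
        using m[OF ij] \<delta>(1) by linarith
      show "\<bar>dir U (cut m (v i)) (cut m (v j)) + weighted U (q n) (cut m (v i)) (cut m (v j)) -
          (if i = j then l0 i else 0)\<bar> \<le> \<delta>"
        using m[OF ij] elim[rule_format, of i j] ij by (simp add: abs_if split: if_splits)
    qed
    also have "l0 k + (real k + 1) * \<delta> = (l0 k + \<epsilon>) * (1 - (real k + 1) * \<delta>)"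
      using \<delta>(2) by (simp add: algebra_simps)
    finally show ?case using \<delta>(3) by simp
  qed
qed

text \<open>All indices up to \<open>k\<close> pass to the limit together, because the limit of the
  eigenvalues at \<open>k\<close> is identified by counting. Weak convergence of gradients then
  becomes strong by an energy identity.\<close>

theorem spectral_convergence:
  obtains u r where "strict_mono (r :: nat \<Rightarrow> nat)" "u \<in> eigenspace U V (dir U) (l0 k)" "ip U u u = 1"
    "(\<lambda>n. weighted U (q (r n)) (w (r n) k) (w (r n) k)) \<longlonglongrightarrow> 0"
    "(\<lambda>n. H1_norm U (\<lambda>x. w (r n) k x - u x)) \<longlonglongrightarrow> 0"
    "(\<lambda>n. l (r n) k) \<longlonglongrightarrow> l0 k"
proof -
  have w: "w n j \<in> H10 U" "w n j \<in> H1 U" "w n j \<in> L2 U" for n j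
    using P.S.e_mem P.S.e_L2 H10_H1 by blast+
  have Dw: "dir U (w n j) (w n j) + weighted U (q n) (w n j) (w n j) = l n j" for n j
    using P.S.a_e[of n j j] by simp
  have l_mono: "i \<le> j \<Longrightarrow> l n i \<le> l n j" for n i j using P.S.mono[of n] by (rule monoD)
  \<comment> \<open>The upper bound holds from \<open>N\<close> on only; shifting the index by
    \<open>N\<close> makes it hold throughout, as the extraction lemma demands.\<close>
  obtain N where N: "\<And>n. n \<ge> N \<Longrightarrow> l n k \<le> l0 k + 1"
    using limsup_eigenvalue[of 1 k] by (auto simp: eventually_sequentially)
  define L where "L = l0 k + 1"
  have lN: "norm (l (n + N) j) \<le> L" if "j \<in> {..k}" for n j
    using N[of "n + N"] l_mono[of j k "n + N"] P.S.l_nonneg[of "n + N" j] that by (simp add: L_def)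
  obtain r1 where r1: "strict_mono (r1 :: nat \<Rightarrow> nat)" "\<And>j. j \<in> {..k} \<Longrightarrow> \<exists>\<mu>. (\<lambda>n. l (r1 n + N) j) \<longlonglongrightarrow> \<mu>"
    using function_convergent_subsequence[of "{..k}" "\<lambda>n j. l (n + N) j" L] lN by auto
  \<comment> \<open>A second diagonal extraction makes all coefficients with respect to the fixed
    basis \<open>w 0\<close> converge, simultaneously for all pairs of indices.\<close>
  have c_bound: "norm (case ij of (j, i) \<Rightarrow> ip U (w (r1 n + N) j) (w 0 i)) \<le> 1" for n ij
  proof (cases ij)
    case (Pair j i)
    have "L2.nrm U (w m j) = 1" for m j by (simp add: L2.nrm_def P.S.e_orthonormal)
    then show ?thesis using L2.abs_le_nrm[OF w(3)[of "r1 n + N" j] w(3)[of 0 i]] Pair by simp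
  qed
  obtain r2 where r2: "strict_mono (r2 :: nat \<Rightarrow> nat)"
    "\<And>ij. \<exists>c. (\<lambda>n. case ij of (j, i) \<Rightarrow> ip U (w (r1 (r2 n) + N) j) (w 0 i)) \<longlonglongrightarrow> c"
    using function_convergent_subsequence[of UNIV "\<lambda>n ij. case ij of (j, i) \<Rightarrow> ip U (w (r1 n + N) j) (w 0 i)" 1] c_bound
    by auto
  define r where "r n = r1 (r2 n) + N" for n
  have r: "strict_mono r" using r1(1) r2(1) unfolding strict_mono_def r_def by simp
  have "\<forall>j\<in>{..k}. \<exists>\<mu>. (\<lambda>n. l (r n) j) \<longlonglongrightarrow> \<mu>"
    using r1(2) LIMSEQ_subseq_LIMSEQ[OF _ r2(1)] unfolding r_def o_def by fast
  then obtain \<mu> where \<mu>: "\<And>j. j \<le> k \<Longrightarrow> (\<lambda>n. l (r n) j) \<longlonglongrightarrow> \<mu> j" by (metis atMost_iff)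
  have "\<forall>j i. \<exists>c. (\<lambda>n. ip U (w (r n) j) (w 0 i)) \<longlonglongrightarrow> c"
    unfolding r_def using r2(2)[of "(_, _)"] by simp
  then obtain c where c: "\<And>j i. (\<lambda>n. ip U (w (r n) j) (w 0 i)) \<longlonglongrightarrow> c j i" by metis
  have lr: "l (r n) j \<le> L" if "j \<le> k" for n j
    using lN[of j "r1 (r2 n)"] that by (simp add: r_def)
  \<comment> \<open>Compactness is taken from the form with the single weight \<open>q 0\<close>,
    whose basis is \<open>w 0\<close>. This weight is bounded, so its form stays bounded along the
    sequence although the weights \<open>q n\<close> need not be uniformly bounded.\<close>
  obtain K where K: "K \<ge> 0" "\<And>u. u \<in> L2 U \<Longrightarrow> weighted U (q 0) u u \<le> K * ip U u u"
    using weighted_bound[OF weight] by blast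
  have bw: "weighted U (q (r n)) (w (r n) j) (w (r n) j) \<le> L" if "j \<le> k" for n j
    using Dw[of "r n" j] lr[OF that, of n] D.nonneg[OF w(2)[of "r n" j]] by linarith
  have bD: "dir U (w (r n) j) (w (r n) j) \<le> L" if "j \<le> k" for n j
    using Dw[of "r n" j] lr[OF that, of n] B.nonneg[OF w(3)[of "r n" j], of "r n"] by linarith
  have "\<exists>u. u \<in> H10 U \<and> (\<lambda>n. L2_norm U (\<lambda>x. w (r n) j x - u x)) \<longlonglongrightarrow> 0 \<and>
    (\<forall>\<eta>\<in>H10 U. (\<lambda>n. dir U (w (r n) j) \<eta>) \<longlonglongrightarrow> dir U u \<eta>)" if j: "j \<le> k" for j
  proof -
    have "dir U (w (r n) j) (w (r n) j) + weighted U (q 0) (w (r n) j) (w (r n) j) \<le> L + K" for n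
      using bD[OF j, of n] K(2)[OF w(3), of "r n" j] by (simp add: P.S.e_orthonormal)
    then show ?thesis
    proof (rule P.H10_compact[OF w(1) _ c])
      fix u assume "u \<in> H10 U" "(\<lambda>n. L2_norm U (\<lambda>x. w (r n) j x - u x)) \<longlonglongrightarrow> 0"
        "\<And>\<eta>. \<eta> \<in> H10 U \<Longrightarrow> (\<lambda>n. dir U (w (r n) j) \<eta>) \<longlonglongrightarrow> dir U u \<eta>"
      then show ?thesis by (intro exI[of _ u]) simp
    qed
  qed
  then have "\<forall>j\<in>{..k}. \<exists>u. u \<in> H10 U \<and> (\<lambda>n. L2_norm U (\<lambda>x. w (r n) j x - u x)) \<longlonglongrightarrow> 0 \<and>
    (\<forall>\<eta>\<in>H10 U. (\<lambda>n. dir U (w (r n) j) \<eta>) \<longlonglongrightarrow> dir U u \<eta>)" by simp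
  then obtain u where "\<forall>j\<in>{..k}. u j \<in> H10 U \<and> (\<lambda>n. L2_norm U (\<lambda>x. w (r n) j x - u j x)) \<longlonglongrightarrow> 0 \<and>
    (\<forall>\<eta>\<in>H10 U. (\<lambda>n. dir U (w (r n) j) \<eta>) \<longlonglongrightarrow> dir U (u j) \<eta>)"
    by (rule bchoice[THEN exE])
  then have u: "\<And>j. j \<le> k \<Longrightarrow> u j \<in> H10 U"
    "\<And>j. j \<le> k \<Longrightarrow> (\<lambda>n. L2_norm U (\<lambda>x. w (r n) j x - u j x)) \<longlonglongrightarrow> 0"
    "\<And>j \<eta>. j \<le> k \<Longrightarrow> \<eta> \<in> H10 U \<Longrightarrow> (\<lambda>n. dir U (w (r n) j) \<eta>) \<longlonglongrightarrow> dir U (u j) \<eta>"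
    by simp_all
  have uV: "u j \<in> V" if "j \<le> k" for j
    using barrier[OF r w(1) u(1)[OF that] bw[OF that] u(2)[OF that]] .
  have uL: "u j \<in> L2 U" "u j \<in> H1 U" if "j \<le> k" for j using uV[OF that] V_H10 by auto
  have orth: "ip U (u i) (u j) = (if i = j then 1 else 0)" if ij: "i \<le> k" "j \<le> k" for i j
  proof -
    have "(\<lambda>n. ip U (w (r n) i) (w (r n) j)) \<longlonglongrightarrow> ip U (u i) (u j)"
      by (rule L2.tendsto_form) (use w uL u ij in \<open>auto simp: L2_nrm_eq\<close>)
    then show ?thesis by (simp add: P.S.e_orthonormal LIMSEQ_const_iff)
  qed
  have eig: "u j \<in> eigenspace U V (dir U) (\<mu> j)" if j: "j \<le> k" for j
    unfolding V.eigenspace_iff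
  proof (intro conjI ballI uV[OF j])
    fix \<eta> assume \<eta>: "\<eta> \<in> V"
    \<comment> \<open>The penalty term in the eigenvalue equation vanishes in the limit only against
      bounded \<open>\<eta>\<close>; unbounded \<open>\<eta>\<close> follow as the level
      \<open>m\<close> grows.\<close>
    have cut_eq: "dir U (u j) (cut m \<eta>) = \<mu> j * ip U (u j) (cut m \<eta>)" for m
    proof (rule LIMSEQ_unique)
      have cm: "cut m \<eta> \<in> H10 U" "cut m \<eta> \<in> L2 U" using cut_V[OF \<eta>] V_H10 by auto
      have "(\<lambda>n. weighted U (q (r n)) (w (r n) j) (cut m \<eta>)) \<longlonglongrightarrow> 0"
        by (rule weighted_mixed_tendsto[OF w(3) cm(2) bw[OF j]])
           (use LIMSEQ_subseq_LIMSEQ[OF cut_recovery[OF \<eta>] r] in \<open>simp add: o_def\<close>)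
      moreover have "(\<lambda>n. ip U (w (r n) j) (cut m \<eta>)) \<longlonglongrightarrow> ip U (u j) (cut m \<eta>)"
        by (rule L2.tendsto_form) (use w uL[OF j] u(2)[OF j] cm in \<open>auto simp: L2_nrm_eq L2_norm_def\<close>)
      ultimately have "(\<lambda>n. l (r n) j * ip U (w (r n) j) (cut m \<eta>) - weighted U (q (r n)) (w (r n) j) (cut m \<eta>))
          \<longlonglongrightarrow> \<mu> j * ip U (u j) (cut m \<eta>) - 0"
        by (intro tendsto_intros \<mu>[OF j])
      moreover have "dir U (w (r n) j) (cut m \<eta>) =
          l (r n) j * ip U (w (r n) j) (cut m \<eta>) - weighted U (q (r n)) (w (r n) j) (cut m \<eta>)" for n
        using P.S.eigen[OF cm(1), of "r n" j] by simp
      ultimately show "(\<lambda>n. dir U (w (r n) j) (cut m \<eta>)) \<longlonglongrightarrow> \<mu> j * ip U (u j) (cut m \<eta>)"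
        by simp
      show "(\<lambda>n. dir U (w (r n) j) (cut m \<eta>)) \<longlonglongrightarrow> dir U (u j) (cut m \<eta>)"
        by (rule u(3)[OF j cm(1)])
    qed
    have zero: "(\<lambda>m. D.nrm (\<lambda>x. u j x - u j x)) \<longlonglongrightarrow> 0" "(\<lambda>m. L2.nrm U (\<lambda>x. u j x - u j x)) \<longlonglongrightarrow> 0"
      using D.zero_left[OF D.zero_mem] by (simp_all add: D.nrm_def L2_nrm_eq L2_norm_def)
    have "(\<lambda>m. dir U (u j) (cut m \<eta>)) \<longlonglongrightarrow> dir U (u j) \<eta>"
      by (rule D.tendsto_form[OF _ _ _ _ zero(1) cut_tendsto(2)[OF \<eta>]]) (use uL[OF j] \<eta> cut_V V_H10 in auto)
    moreover have "(\<lambda>m. \<mu> j * ip U (u j) (cut m \<eta>)) \<longlonglongrightarrow> \<mu> j * ip U (u j) \<eta>"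
      by (intro tendsto_intros, rule L2.tendsto_form[OF _ _ _ _ zero(2) cut_tendsto(1)[OF \<eta>]]) (use uL[OF j] \<eta> cut_V V_H10 in auto)
    ultimately show "dir U (u j) \<eta> = \<mu> j * ip U (u j) \<eta>"
      unfolding cut_eq by (rule LIMSEQ_unique)
  qed
  have "\<mu> j \<le> \<mu> k" if "j \<le> k" for j
    by (rule LIMSEQ_le[OF \<mu>[OF that] \<mu>[OF order_refl]]) (use l_mono[OF that] in auto)
  then have "l0 k \<le> \<mu> k"
    using V.eigenvalue_le_of_orthonormal_eigenfunctions[OF spec0, of k u \<mu>] eig orth by blast
  moreover have "\<mu> k \<le> l0 k"
  proof (rule field_le_epsilon)
    fix e :: real assume "e > 0"
    then obtain M where M: "\<And>n. n \<ge> M \<Longrightarrow> l n k \<le> l0 k + e"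
      using limsup_eigenvalue[of e k] by (auto simp: eventually_sequentially)
    show "\<mu> k \<le> l0 k + e"
      by (rule LIMSEQ_le_const2[OF \<mu>[OF order_refl]])
         (use M seq_suble[OF r] order_trans in blast)
  qed
  ultimately have \<mu>k: "\<mu> k = l0 k" by simp
  have lim: "(\<lambda>n. l (r n) k) \<longlonglongrightarrow> l0 k" using \<mu>[of k] \<mu>k by simp
  have Du: "dir U (u k) (u k) = l0 k"
    using eig[of k] uV[of k] orth[of k k] \<mu>k by (simp add: V.eigenspace_iff)
  \<comment> \<open>The limit is \<open>l0 k - 2 * l0 k + l0 k\<close>. By \<open>split\<close> this
    quantity is the sum of two nonnegative terms, the squared gradient error and the penalty, so
    both tend to 0.\<close>
  have energy: "(\<lambda>n. l (r n) k - 2 * dir U (w (r n) k) (u k) + dir U (u k) (u k)) \<longlonglongrightarrow> 0"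
    by (rule tendsto_eq_intros lim u(3) order_refl u(1) refl | simp add: Du)+
  have split: "(D.nrm (\<lambda>x. w (r n) k x - u k x))\<^sup>2 + weighted U (q (r n)) (w (r n) k) (w (r n) k) =
      l (r n) k - 2 * dir U (w (r n) k) (u k) + dir U (u k) (u k)" for n
    using Dw[of "r n" k] D.square_diff[OF w(2)[of "r n" k] uL(2)[OF order_refl]]
    by (simp add: D.nrm_squared[OF D.diff_mem[OF w(2) uL(2)]])
  have wnn: "0 \<le> weighted U (q (r n)) (w (r n) k) (w (r n) k)" for n
    by (rule B.nonneg[OF w(3)])
  have 1: "(\<lambda>n. weighted U (q (r n)) (w (r n) k) (w (r n) k)) \<longlonglongrightarrow> 0"
    by (rule tendsto_0_squeeze[OF energy wnn]) (simp add: split[symmetric])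
  have "(\<lambda>n. (D.nrm (\<lambda>x. w (r n) k x - u k x))\<^sup>2) \<longlonglongrightarrow> 0"
    by (rule tendsto_0_squeeze[OF energy]) (simp_all add: split[symmetric] wnn)
  from tendsto_real_sqrt[OF this] have "(\<lambda>n. D.nrm (\<lambda>x. w (r n) k x - u k x)) \<longlonglongrightarrow> 0"
    using D.nrm_nonneg[OF D.diff_mem[OF w(2) uL(2)[OF order_refl]]] by simp
  then have 2: "(\<lambda>n. H1_norm U (\<lambda>x. w (r n) k x - u k x)) \<longlonglongrightarrow> 0"
    using H1_norm_tendsto_iff[of "\<lambda>n. w (r n) k" "u k"] w uL u(2) by simp
  show ?thesis
    by (rule that[OF r _ _ 1 2 lim]) (use eig[of k] orth[of k k] \<mu>k in simp_all)
qed

end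

subsection \<open>The diffuse interface problem\<close>

text \<open>Completeness of Lebesgue measure, carried over to \<open>U\<close> by extending
  functions by 0.\<close>

lemma borel_measurable_AE_lebesgue_on:
  fixes f g :: "'a::euclidean_space \<Rightarrow> 'b::euclidean_space"
  assumes f: "f \<in> meas U" and AE: "AE x in leb U. f x = g x"
    and U: "U \<in> sets lebesgue"
  shows "g \<in> meas U"
proof -
  have U': "U \<inter> space lebesgue \<in> sets lebesgue" using U by simp
  have "(\<lambda>x. indicat_real U x *\<^sub>R g x) \<in> borel_measurable lebesgue"
  proof (rule borel_measurable_AE)
    show "(\<lambda>x. indicat_real U x *\<^sub>R f x) \<in> borel_measurable lebesgue"
      using f borel_measurable_restrict_space_iff[OF U'] by blast
    have "AE x in lebesgue. x \<in> U \<longrightarrow> f x = g x" using AE by (simp add: AE_restrict_space_iff[OF U'])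
    then show "AE x in lebesgue. indicat_real U x *\<^sub>R f x = indicat_real U x *\<^sub>R g x"
      by eventually_elim (auto simp: indicator_def)
  qed
  then show ?thesis using borel_measurable_restrict_space_iff[OF U'] by blast
qed

text \<open>Continuity of \<open>\<beta>\<close> is known on the interval only, so the argument is
  clamped to it, which changes the composition on a null set at most.\<close>

lemma measurable_compose_AE_interval:
  fixes f :: "'a::euclidean_space \<Rightarrow> real" and \<beta> :: "real \<Rightarrow> real"
  assumes \<beta>: "continuous_on {-1..1} \<beta>" and f: "f \<in> meas U"
    and AE: "AE x in leb U. \<bar>f x\<bar> \<le> 1" and U: "U \<in> sets lebesgue"
  shows "(\<lambda>x. \<beta> (f x)) \<in> meas U"
proof (rule borel_measurable_AE_lebesgue_on[OF _ _ U])
  have "continuous_on UNIV (\<lambda>t. \<beta> (max (-1) (min 1 t)))"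
    by (rule continuous_on_compose2[OF \<beta>]) (auto intro!: continuous_intros)
  then show "(\<lambda>x. \<beta> (max (-1) (min 1 (f x)))) \<in> meas U"
    using f by (rule borel_measurable_continuous_on)
  show "AE x in leb U. \<beta> (max (-1) (min 1 (f x))) = \<beta> (f x)"
    using AE
  proof eventually_elim
    case (elim x)
    then have "max (-1) (min 1 (f x)) = f x" by auto
    then show ?case by simp
  qed
qed

text \<open>A function orthogonal to all test functions is orthogonal to their limits
  \<open>e j\<close>, so its expansion vanishes.\<close>

lemma sobolev_of_orthonormal_basis:
  assumes U: "U \<in> sets lebesgue" and e: "orthonormal_basis_L2 U e" "\<And>j. e j \<in> H10 U"
  shows "sobolev U"
proof
  show "U \<in> sets lebesgue" by (rule U)
  fix f :: "'a \<Rightarrow> real"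
  assume f: "f \<in> L2 U" "\<And>p. p \<in> tests U \<Longrightarrow> ip U f p = 0"
  have eL: "e j \<in> L2 U" for j using e(2) H10_H1 H1_L2 by blast
  have "ip U f (e j) = 0" for j
  proof -
    obtain p where p: "\<And>n. p n \<in> tests U" "(\<lambda>n. H1_norm U (\<lambda>x. p n x - e j x)) \<longlonglongrightarrow> 0"
      using e(2)[of j] unfolding H10_def by auto
    have "(\<lambda>n. L2_norm U (\<lambda>x. p n x - e j x)) \<longlonglongrightarrow> 0"
      by (rule tendsto_0_squeeze[OF p(2)]) (auto simp: H1_norm_def intro!: real_le_rsqrt)
    then have "(\<lambda>n. ip U f (p n)) \<longlonglongrightarrow> ip U f (e j)"
      by (intro L2.tendsto_form) (use f eL test_L2[OF U p(1)] in \<open>auto simp: L2_nrm_eq L2_norm_def\<close>)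
    then show ?thesis using f(2)[OF p(1)] by (simp add: LIMSEQ_const_iff)
  qed
  moreover have "(\<lambda>N. L2_norm U (\<lambda>x. f x - (\<Sum>j<N. ip U f (e j) * e j x))) \<longlonglongrightarrow> 0"
    using e(1) f(1) by (simp add: orthonormal_basis_L2_def L2_inner_eq_ip)
  ultimately have "L2_norm U f = 0" by (simp add: LIMSEQ_const_iff)
  then show "AE x in leb U. f x = 0" by (rule L2_norm_eq_0_AE[OF f(1)])
qed

lemma (in sobolev) dirichlet_spectral_weighted:
  assumes q: "bounded_weight U q" and e: "orthonormal_basis_L2 U e" "\<And>j. e j \<in> H10 U"
    and eigen: "\<And>j v. v \<in> H10 U \<Longrightarrow> dir U (e j) v + weighted U q (e j) v = l j * ip U (e j) v"
    and mono: "mono l"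
  shows "dirichlet_spectral U (\<lambda>u v. dir U u v + weighted U q u v) e l"
proof -
  interpret B: sym_form "L2 U" "weighted U q" by (rule weighted_sym_form[OF q])
  have sub: "u \<in> H1 U" "u \<in> L2 U" if "u \<in> H10 U" for u using that H10_H1 H1_L2 by blast+
  show ?thesis
  proof
    fix u v z :: "'a \<Rightarrow> real" and c
    show "(\<lambda>x. 0) \<in> H10 U" by (rule H10_zero)
    assume uv: "u \<in> H10 U" "v \<in> H10 U"
    show "(\<lambda>x. c *\<^sub>R u x + v x) \<in> H10 U" by (rule H10_lin[OF uv])
    show "dir U u v + weighted U q u v = dir U v u + weighted U q v u"
      using uv sub D.sym[of u v] B.sym[of u v] by simp
    assume "z \<in> H10 U"
    then show "dir U (\<lambda>x. c *\<^sub>R u x + v x) z + weighted U q (\<lambda>x. c *\<^sub>R u x + v x) z =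
        c * (dir U u z + weighted U q u z) + (dir U v z + weighted U q v z)"
      using uv sub by (simp only: D.lin B.lin) (simp add: algebra_simps)
  next
    fix u assume "u \<in> H10 U"
    then show "0 \<le> dir U u u + weighted U q u u" "dir U u u \<le> dir U u u + weighted U q u u"
      using sub D.nonneg[of u] B.nonneg[of u] by auto
  qed (use e eigen mono sub in auto)
qed

text \<open>\<open>A n\<close> is the exceptional set. Off it, and where \<open>\<eta>\<close> is
  nonzero, the weights are bounded by \<open>B\<close> and tend to 0, so dominated convergence
  applies; on it only the crude bound \<open>K n\<close> times \<open>M\<^sup>2\<close> is
  available, and smallness has to come from the measure.\<close>

lemma weighted_recovery:
  assumes q: "\<And>n. bounded_weight U (q n)" and \<eta>: "\<eta> \<in> L2 U" "\<And>x. \<bar>\<eta> x\<bar> \<le> M"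
    and lim: "AE x in leb U. \<eta> x \<noteq> 0 \<longrightarrow> (\<lambda>n. q n x) \<longlonglongrightarrow> 0"
    and A: "\<And>n. A n \<in> sets (leb U)" "\<And>n. emeasure (leb U) (A n) < \<infinity>"
    and B: "\<And>n. AE x in leb U. \<eta> x \<noteq> 0 \<longrightarrow> x \<notin> A n \<longrightarrow> q n x \<le> B"
    and K: "\<And>n. AE x in leb U. q n x \<le> K n"
    and small: "(\<lambda>n. K n * measure (leb U) (A n)) \<longlonglongrightarrow> 0"
  shows "(\<lambda>n. weighted U (q n) \<eta> \<eta>) \<longlonglongrightarrow> 0"
proof -
  let ?M = "leb U"
  define g where "g n x = q n x * \<eta> x * \<eta> x * indicat_real (- A n) x" for n x
  have [measurable]: "q n \<in> borel_measurable ?M" "\<eta> \<in> borel_measurable ?M" for n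
    using q \<eta> L2_measurable by (auto simp: bounded_weight_def)
  have ind: "(\<lambda>x. indicat_real (- A n) x) \<in> borel_measurable ?M" for n
  proof -
    have "(\<lambda>x. 1 - indicat_real (A n) x) \<in> borel_measurable ?M" using A(1) by measurable
    then show ?thesis by (simp add: indicator_compl[abs_def])
  qed
  have nn: "AE x in ?M. 0 \<le> q n x" for n
    using q[of n] unfolding bounded_weight_def by (auto elim!: AE_mp)
  have gB: "AE x in ?M. norm (g n x) \<le> \<bar>B\<bar> * (norm (\<eta> x))\<^sup>2" for n
    using B[of n] nn[of n]
  proof eventually_elim
    case (elim x)
    show ?case
    proof (cases "x \<in> A n \<or> \<eta> x = 0")
      case True
      then show ?thesis by (auto simp: g_def)
    next
      case False
      then have "0 \<le> q n x" "q n x \<le> \<bar>B\<bar>" using elim by auto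
      then show ?thesis using False by (simp add: g_def abs_mult power2_eq_square mult.assoc mult_right_mono)
    qed
  qed
  have gm: "g n \<in> borel_measurable ?M" for n unfolding g_def using ind by measurable
  have dom: "integrable ?M (\<lambda>x. \<bar>B\<bar> * (norm (\<eta> x))\<^sup>2)" using \<eta>(1) by (intro integrable_mult_right L2_integrable_square)
  have gint: "integrable ?M (g n)" for n
    by (rule Bochner_Integration.integrable_bound[OF dom gm]) (use gB in \<open>auto elim!: AE_mp\<close>)
  have "(\<lambda>n. LINT x|?M. g n x) \<longlonglongrightarrow> (LINT x|?M. 0)"
  proof (rule integral_dominated_convergence[OF _ gm dom _ gB])
    show "AE x in ?M. (\<lambda>n. g n x) \<longlonglongrightarrow> 0"
      using lim
    proof eventually_elim
      case (elim x)
      show ?case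
      proof (cases "\<eta> x = 0")
        case False
        then have "(\<lambda>n. \<bar>q n x\<bar> * (\<bar>\<eta> x\<bar> * \<bar>\<eta> x\<bar>)) \<longlonglongrightarrow> 0"
          using elim by (auto intro!: tendsto_eq_intros)
        then have "(\<lambda>n. \<bar>g n x\<bar>) \<longlonglongrightarrow> 0"
          by (rule tendsto_0_squeeze) (auto simp: g_def indicator_def abs_mult)
        then show ?thesis by (simp add: tendsto_rabs_zero_iff)
      qed (simp add: g_def)
    qed
  qed simp
  then have "(\<lambda>n. (LINT x|?M. g n x) + M\<^sup>2 * (K n * measure ?M (A n))) \<longlonglongrightarrow> 0 + M\<^sup>2 * 0"
    by (intro tendsto_add tendsto_mult_left small) simp
  then have lim0: "(\<lambda>n. (LINT x|?M. g n x) + M\<^sup>2 * (K n * measure ?M (A n))) \<longlonglongrightarrow> 0" by simp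
  show ?thesis
  proof (rule tendsto_0_squeeze[OF lim0])
    fix n
    show "0 \<le> weighted U (q n) \<eta> \<eta>" by (rule sym_form.nonneg[OF weighted_sym_form[OF q] \<eta>(1)])
    have intA: "integrable ?M (\<lambda>x. M\<^sup>2 * K n * indicat_real (A n) x)"
      using A by (intro integrable_mult_right integrable_real_indicator) auto
    have "weighted U (q n) \<eta> \<eta> \<le> (LINT x|?M. g n x + M\<^sup>2 * K n * indicat_real (A n) x)"
      unfolding weighted_def
    proof (rule integral_mono_AE)
      show "AE x in ?M. q n x * \<eta> x * \<eta> x \<le> g n x + M\<^sup>2 * K n * indicat_real (A n) x"
        using K[of n] nn[of n]
      proof eventually_elim
        case (elim x)
        have "(\<eta> x)\<^sup>2 \<le> M\<^sup>2" using \<eta>(2)[of x] power_mono[of "\<bar>\<eta> x\<bar>" M 2] by simp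
        then have "q n x * (\<eta> x)\<^sup>2 \<le> K n * M\<^sup>2" using elim by (intro mult_mono) auto
        then show ?case by (auto simp: g_def indicator_def power2_eq_square mult_ac)
      qed
    qed (use weighted_integrable[OF q \<eta>(1) \<eta>(1)] gint intA in auto)
    also have "\<dots> = (LINT x|?M. g n x) + M\<^sup>2 * (K n * measure ?M (A n))"
      using gint intA A sets.sets_into_space[OF A(1)[of n]] by (simp add: Int_absorb1 Int_absorb2)
    finally show "weighted U (q n) \<eta> \<eta> \<le> (LINT x|?M. g n x) + M\<^sup>2 * (K n * measure ?M (A n))" .
  qed
qed

text \<open>The link between the real-valued form used throughout and the extended integrals of the
  final statement, which are needed there because \<open>b0\<close> may be infinite.\<close>

lemma nn_integral_weighted:
  assumes q: "bounded_weight U q" and u: "u \<in> L2 U"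
  shows "(\<integral>\<^sup>+x. ennreal (q x) * ennreal ((u x)\<^sup>2) \<partial>leb U) = ennreal (weighted U q u u)"
proof -
  have nn: "AE x in leb U. 0 \<le> q x"
    using q unfolding bounded_weight_def by (auto elim!: AE_mp)
  have "(\<integral>\<^sup>+x. ennreal (q x) * ennreal ((u x)\<^sup>2) \<partial>leb U) = (\<integral>\<^sup>+x. ennreal (q x * u x * u x) \<partial>leb U)"
  proof (rule nn_integral_cong_AE, use nn in eventually_elim)
    case (elim x)
    then show ?case by (simp add: power2_eq_square mult.assoc flip: ennreal_mult)
  qed
  also have "\<dots> = ennreal (weighted U q u u)"
    unfolding weighted_def
  proof (rule nn_integral_eq_integral[OF weighted_integrable[OF q u u]])
    show "AE x in leb U. 0 \<le> q x * u x * u x" using nn by eventually_elim (simp add: mult.assoc)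
  qed
  finally show ?thesis .
qed

text \<open>Fatou's lemma along an almost everywhere convergent subsequence of \<open>f\<close>. The
  weights \<open>q n\<close> may blow up, so they are replaced by minorants \<open>p n\<close> with
  a finite pointwise limit.\<close>

lemma weighted_lower_semicontinuous:
  assumes q: "\<And>n. bounded_weight U (q n)"
    and p: "\<And>n. p n \<in> meas U" "AE x in leb U. (\<lambda>n. p n x) \<longlonglongrightarrow> p' x"
    and pq: "\<forall>\<^sub>F n in sequentially. AE x in leb U. p n x \<le> q n x"
    and f: "\<And>n. f n \<in> L2 U" "u \<in> L2 U" "L2_tendsto U f u"
    and C: "\<And>n. weighted U (q n) (f n) (f n) \<le> C"
  shows "(\<integral>\<^sup>+x. ennreal (p' x) * ennreal ((u x)\<^sup>2) \<partial>leb U) \<le> ennreal C"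
proof -
  let ?M = "leb U"
  obtain s where s: "strict_mono (s :: nat \<Rightarrow> nat)" "AE x in ?M. (\<lambda>n. f (s n) x) \<longlonglongrightarrow> u x"
    using L2_norm_tendsto_AE_subseq[OF f] by blast
  have [measurable]: "p n \<in> borel_measurable ?M" "f n \<in> borel_measurable ?M" for n
    using p f L2_measurable by auto
  have "(\<integral>\<^sup>+x. ennreal (p' x) * ennreal ((u x)\<^sup>2) \<partial>?M) =
      (\<integral>\<^sup>+x. liminf (\<lambda>n. ennreal (p (s n) x) * ennreal ((f (s n) x)\<^sup>2)) \<partial>?M)"
  proof (rule nn_integral_cong_AE, use p(2) s(2) in eventually_elim)
    case (elim x)
    have "(\<lambda>n. ennreal (p (s n) x) * ennreal ((f (s n) x)\<^sup>2)) \<longlonglongrightarrow> ennreal (p' x) * ennreal ((u x)\<^sup>2)"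
      using LIMSEQ_subseq_LIMSEQ[OF elim(1) s(1)] elim(2) unfolding o_def
      by (intro tendsto_mult_ennreal tendsto_ennrealI tendsto_power) auto
    from lim_imp_Liminf[OF sequentially_bot this] show ?case by simp
  qed
  also have "\<dots> \<le> liminf (\<lambda>n. \<integral>\<^sup>+x. ennreal (p (s n) x) * ennreal ((f (s n) x)\<^sup>2) \<partial>?M)"
    by (rule nn_integral_liminf) measurable
  also have "\<dots> \<le> ennreal C"
  proof (rule Liminf_le)
    have "\<forall>\<^sub>F n in sequentially. AE x in ?M. p (s n) x \<le> q (s n) x"
      by (rule eventually_subseq[OF s(1) pq])
    then show "\<forall>\<^sub>F n in sequentially. (\<integral>\<^sup>+x. ennreal (p (s n) x) * ennreal ((f (s n) x)\<^sup>2) \<partial>?M) \<le> ennreal C"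
    proof eventually_elim
      case (elim n)
      have "(\<integral>\<^sup>+x. ennreal (p (s n) x) * ennreal ((f (s n) x)\<^sup>2) \<partial>?M) \<le> (\<integral>\<^sup>+x. ennreal (q (s n) x) * ennreal ((f (s n) x)\<^sup>2) \<partial>?M)"
        by (rule nn_integral_mono_AE) (use elim in \<open>auto elim!: AE_mp intro!: mult_right_mono ennreal_leI\<close>)
      also have "\<dots> \<le> ennreal C" unfolding nn_integral_weighted[OF q f(1)] using C by (rule ennreal_leI)
      finally show ?case .
    qed
  qed simp
  finally show ?thesis .
qed

theorem theorem4p6:
  fixes \<Omega> S0 S1 :: "'a::euclidean_space set"
    and b :: "real \<Rightarrow> real \<Rightarrow> real" and b0 :: "real \<Rightarrow> ennreal"
    and bbar :: "real \<Rightarrow> real" and \<kappa> :: real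
    and eps :: "nat \<Rightarrow> real"
    and \<phi>s :: "nat \<Rightarrow> 'a \<Rightarrow> real" and \<phi> :: "'a \<Rightarrow> real"
    and lam :: "nat \<Rightarrow> nat \<Rightarrow> real" and w :: "nat \<Rightarrow> nat \<Rightarrow> 'a \<Rightarrow> real"
    and lam0 :: "nat \<Rightarrow> real" and k :: nat
  assumes dim: "DIM('a) \<ge> 2"
    and Omega: "lipschitz_domain \<Omega>" "bounded \<Omega>"
    and S01: "S0 \<subseteq> \<Omega>" "S1 \<subseteq> \<Omega>" "S0 \<inter> S1 = {}"
      "finite_perimeter_in \<Omega> S0" "finite_perimeter_in \<Omega> S1"
      "lipschitz_domain (\<Omega> - (S0 \<union> S1))"
    and b_decreasing: "\<And>\<epsilon>. \<epsilon> > 0 \<Longrightarrow> antimono_on {-1..1} (b \<epsilon>)"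
    and b_continuous: "\<And>\<epsilon>. \<epsilon> > 0 \<Longrightarrow> continuous_on {-1..1} (b \<epsilon>)"
    and b_onto: "\<And>\<epsilon>. \<epsilon> > 0 \<Longrightarrow> b \<epsilon> ` {-1..1} = {0..bbar \<epsilon>}"
    and b_restriction: "\<And>\<epsilon>. \<epsilon> > 0 \<Longrightarrow>
      \<exists>g. C11_loc g \<and> (\<forall>t. g t \<ge> 0) \<and> (\<forall>t\<in>{-1..1}. b \<epsilon> t = g t)"
    and b0_continuous: "continuous (at 1 within {-1..1}) b0"
    and b0_finite: "b0 0 < \<infinity>"
    and b_limit: "\<And>t. t \<in> {-1..1} \<Longrightarrow> ((\<lambda>\<epsilon>. ennreal (b \<epsilon> t)) \<longlongrightarrow> b0 t) (at_right 0)"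
    and b_mono: "\<And>\<delta> \<epsilon> t. 0 < \<delta> \<Longrightarrow> \<delta> \<le> \<epsilon> \<Longrightarrow> t \<in> {-1..1} \<Longrightarrow> b \<epsilon> t \<le> b \<delta> t"
    and b0_bound: "\<And>\<epsilon> t. 0 < \<epsilon> \<Longrightarrow> t \<in> {-1..1} \<Longrightarrow> ennreal (b \<epsilon> t) \<le> b0 t"
    and bbar_limit: "filterlim bbar at_top (at_right 0)"
    and bbar_rate: "bbar \<in> o[at_right 0](\<lambda>\<epsilon>. \<epsilon> powr (- \<kappa>))"
    and kappa: "if DIM('a) = 2 then 0 < \<kappa> \<and> \<kappa> < 1 else \<kappa> = 2 / real DIM('a)"
    and eps: "\<And>n. eps n > 0" "eps \<longlonglongrightarrow> 0"
    and phis: "\<And>n. integrable (lebesgue_on \<Omega>) (\<phi>s n)"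
      "\<And>n. AE x in lebesgue_on \<Omega>. \<bar>\<phi>s n x\<bar> \<le> 1"
    and phi: "\<phi> \<in> BV_pm1 \<Omega> \<inter> phase_fields \<Omega> S0 S1"
      "\<exists>z r. r > 0 \<and> ball z r \<subseteq> E_set \<Omega> \<phi>"
    and phis_limit: "(\<lambda>n. LINT x|lebesgue_on \<Omega>. \<bar>\<phi>s n x - \<phi> x\<bar>) \<longlonglongrightarrow> 0"
    and phis_rate: "(\<lambda>n. LINT x|lebesgue_on (E_set \<Omega> \<phi> \<inter> {x. \<phi>s n x < 0}). \<bar>\<phi>s n x - \<phi> x\<bar>) \<in> O(eps)"
    and lam: "\<And>n. eigenvalue_sequence \<Omega> (H10 \<Omega>) (diffuse_form \<Omega> (b (eps n)) (\<phi>s n)) (lam n)"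
    and w: "\<And>n. orthonormal_basis_L2 \<Omega> (w n)"
      "\<And>n j. eigenfunction \<Omega> (H10 \<Omega>) (diffuse_form \<Omega> (b (eps n)) (\<phi>s n)) (lam n j) (w n j)"
    and lam0: "eigenvalue_sequence \<Omega> (V_space \<Omega> \<phi>) (dirichlet_form \<Omega>) lam0"
  shows "\<exists>u r. eigenfunction \<Omega> (V_space \<Omega> \<phi>) (dirichlet_form \<Omega>) (lam0 k) u \<and>
    strict_mono (r :: nat \<Rightarrow> nat) \<and>
    (\<lambda>n. \<integral>\<^sup>+ x. ennreal (b (eps (r n)) (\<phi>s (r n) x)) * ennreal ((w (r n) k x)\<^sup>2) \<partial>lebesgue_on \<Omega>)
      \<longlonglongrightarrow> (\<integral>\<^sup>+ x. b0 (\<phi> x) * ennreal ((u x)\<^sup>2) \<partial>lebesgue_on \<Omega>) \<and>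
    (\<integral>\<^sup>+ x. b0 (\<phi> x) * ennreal ((u x)\<^sup>2) \<partial>lebesgue_on \<Omega>) = 0 \<and>
    (\<lambda>n. H1_norm \<Omega> (\<lambda>x. w (r n) k x - u x)) \<longlonglongrightarrow> 0 \<and>
    (\<lambda>n. lam (r n) k) \<longlonglongrightarrow> lam0 k"
proof -
  let ?M = "lebesgue_on \<Omega>" and ?E = "E_set \<Omega> \<phi>"
  have \<Omega>: "\<Omega> \<in> sets lebesgue" using Omega(1) by (simp add: lipschitz_domain_def borel_open)
  have wH: "w n j \<in> H10 \<Omega>" for n j
    using w(2)[of n j] by (simp add: eigenfunction_def eigenspace_def)
  interpret sobolev \<Omega> by (rule sobolev_of_orthonormal_basis[OF \<Omega> w(1) wH])

  \<comment> \<open>Range and end values of the coefficients\<close>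
  have b_range: "0 \<le> b \<epsilon> t" "b \<epsilon> t \<le> bbar \<epsilon>" if "\<epsilon> > 0" "t \<in> {-1..1}" for \<epsilon> t
    using b_onto[OF that(1)] that(2) by (metis atLeastAtMost_iff imageI)+
  have b_antimono: "b \<epsilon> t \<le> b \<epsilon> s" if "\<epsilon> > 0" "s \<in> {-1..1}" "t \<in> {-1..1}" "s \<le> t" for \<epsilon> s t
    using monotone_onD[OF b_decreasing[OF that(1)] that(2-4)] .
  \<comment> \<open>A decreasing function onto an interval attains its extreme values at the end
    points.\<close>
  have b_one: "b \<epsilon> 1 = 0" and b_minus_one: "b \<epsilon> (-1) = bbar \<epsilon>" if \<epsilon>: "\<epsilon> > 0" for \<epsilon>
  proof -
    have "0 \<le> bbar \<epsilon>" using b_range[OF \<epsilon>, of 0] by simp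
    then have "0 \<in> b \<epsilon> ` {-1..1}" "bbar \<epsilon> \<in> b \<epsilon> ` {-1..1}" unfolding b_onto[OF \<epsilon>] by auto
    then obtain s t where st: "s \<in> {-1..1}" "b \<epsilon> s = 0" "t \<in> {-1..1}" "b \<epsilon> t = bbar \<epsilon>" by auto
    have "b \<epsilon> 1 \<le> b \<epsilon> s" "b \<epsilon> t \<le> b \<epsilon> (-1)"
      using b_antimono[OF \<epsilon>, of s 1] b_antimono[OF \<epsilon>, of "-1" t] st by auto
    then show "b \<epsilon> 1 = 0" "b \<epsilon> (-1) = bbar \<epsilon>"
      using st b_range[OF \<epsilon>, of 1] b_range[OF \<epsilon>, of "-1"] by auto
  qed
  have b0_one: "b0 1 = 0"
  proof -
    have "((\<lambda>\<epsilon>. ennreal (b \<epsilon> 1)) \<longlongrightarrow> 0) (at_right 0)"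
      by (rule tendsto_eventually) (auto simp: eventually_at_filter b_one)
    from tendsto_unique[OF trivial_limit_at_right_real b_limit this] show ?thesis by simp
  qed
  have weight: "bounded_weight \<Omega> (\<lambda>x. b \<epsilon> (\<phi>s n x))" if "\<epsilon> > 0" for \<epsilon> n
    unfolding bounded_weight_def
  proof (intro conjI exI[of _ "bbar \<epsilon>"])
    show "(\<lambda>x. b \<epsilon> (\<phi>s n x)) \<in> borel_measurable ?M"
      by (rule measurable_compose_AE_interval[OF b_continuous[OF that] _ phis(2) \<Omega>])
         (rule borel_measurable_integrable[OF phis(1)])
    show "AE x in ?M. 0 \<le> b \<epsilon> (\<phi>s n x) \<and> b \<epsilon> (\<phi>s n x) \<le> bbar \<epsilon>"
      using phis(2)[of n]
    proof eventually_elim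
      case (elim x)
      then have "\<phi>s n x \<in> {-1..1}" by auto
      then show ?case using b_range[OF that] by blast
    qed
  qed

  \<comment> \<open>Almost everywhere convergent phase fields and their weights\<close>
  have phi_int: "integrable ?M \<phi>" and phi_pm: "AE x in ?M. \<phi> x \<in> {-1, 1}"
    using phi(1) by (auto simp: BV_pm1_def BV_def)
  \<comment> \<open>Convergence in \<open>L1\<close> gives pointwise convergence along a subsequence
    only; the subsequence of the theorem will be \<open>\<rho> \<circ> r\<close>.\<close>
  obtain \<rho> where \<rho>: "strict_mono (\<rho> :: nat \<Rightarrow> nat)" "AE x in ?M. (\<lambda>n. \<phi>s (\<rho> n) x - \<phi> x) \<longlonglongrightarrow> 0"
  proof -
    have "(\<lambda>n. LINT x|?M. norm (\<phi>s n x - \<phi> x)) \<longlonglongrightarrow> 0" using phis_limit by simp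
    then show ?thesis
      using tendsto_L1_AE_subseq[of ?M "\<lambda>n x. \<phi>s n x - \<phi> x"] phis(1) phi_int that by auto
  qed
  have lim\<phi>: "AE x in ?M. (\<lambda>n. \<phi>s (\<rho> n) x) \<longlonglongrightarrow> \<phi> x"
    using \<rho>(2) by eventually_elim (simp add: LIM_zero_iff)
  have range\<phi>: "AE x in ?M. \<forall>n. \<phi>s (\<rho> n) x \<in> {-1..1}"
    unfolding AE_all_countable
  proof
    fix n show "AE x in ?M. \<phi>s (\<rho> n) x \<in> {-1..1}"
      using phis(2)[of "\<rho> n"] by eventually_elim auto
  qed
  define e where "e n = eps (\<rho> n)" for n
  have e: "e n > 0" "e \<longlonglongrightarrow> 0" for n
    using eps LIMSEQ_subseq_LIMSEQ[OF eps(2) \<rho>(1)] by (auto simp: e_def[abs_def] o_def)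
  have e_right: "filterlim e (at_right 0) sequentially"
    unfolding filterlim_at using e by (simp add: less_imp_neq[symmetric])
  define q where "q n x = b (e n) (\<phi>s (\<rho> n) x)" for n x
  have q: "bounded_weight \<Omega> (q n)" for n unfolding q_def by (rule weight[OF e(1)])

  \<comment> \<open>The region of \<open>E_set \<Omega> \<phi>\<close> where the phase field is
    negative\<close>
  define A where "A n = ?E \<inter> {x. \<phi>s (\<rho> n) x < 0}" for n
  have meas[measurable]: "\<phi>s n \<in> borel_measurable ?M" "\<phi> \<in> borel_measurable ?M" for n
    using phis(1) phi_int by auto
  have A_sets: "A n \<in> sets ?M" for n
  proof -
    have "A n = {x \<in> space ?M. \<phi> x = 1 \<and> \<phi>s (\<rho> n) x < 0}" by (auto simp: A_def E_set_def)
    also have "\<dots> \<in> sets ?M" by measurable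
    finally show ?thesis .
  qed
  have A_sub: "A n \<subseteq> \<Omega>" for n by (auto simp: A_def E_set_def)
  have A_leb: "A n \<in> sets lebesgue" for n
    using A_sets[of n] \<Omega> by (simp add: sets_restrict_space_iff)
  have A_emeasure: "emeasure ?M (A n) = emeasure lebesgue (A n)" for n
    using \<Omega> A_sub by (simp add: emeasure_restrict_space)
  have A_fin: "emeasure ?M (A n) < \<infinity>" for n
  proof -
    have "bounded (A n)" using Omega(2) A_sub bounded_subset by blast
    then have "A n \<in> lmeasurable" using A_leb by (rule bounded_set_imp_lmeasurable)
    then show ?thesis unfolding A_emeasure fmeasurable_def mem_Collect_eq by (rule conjunct2)
  qed
  \<comment> \<open>Markov's inequality: on \<open>A n\<close> one has \<open>\<phi> = 1\<close> and
    a negative phase field, so their distance exceeds 1.\<close>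
  have A_measure: "measure ?M (A n) \<le> (LINT x|lebesgue_on (A n). \<bar>\<phi>s (\<rho> n) x - \<phi> x\<bar>)" for n
  proof -
    have "integrable ?M (\<lambda>x. \<bar>\<phi>s (\<rho> n) x - \<phi> x\<bar>)" using phis(1) phi_int by auto
    then have "set_integrable lebesgue \<Omega> (\<lambda>x. \<bar>\<phi>s (\<rho> n) x - \<phi> x\<bar>)"
      using \<Omega> by (simp add: integrable_restrict_space set_integrable_def)
    then have si: "set_integrable lebesgue (A n) (\<lambda>x. \<bar>\<phi>s (\<rho> n) x - \<phi> x\<bar>)"
      using A_leb A_sub by (rule set_integrable_subset)
    have "measure ?M (A n) = measure lebesgue (A n)" by (simp add: measure_def A_emeasure)
    also have "\<dots> = (LINT x|lebesgue. indicat_real (A n) x)" using A_leb by simp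
    also have "\<dots> \<le> (LINT x|lebesgue. indicat_real (A n) x *\<^sub>R \<bar>\<phi>s (\<rho> n) x - \<phi> x\<bar>)"
    proof (rule integral_mono)
      show "integrable lebesgue (indicat_real (A n))"
        using A_leb A_fin[of n] unfolding A_emeasure by (intro integrable_real_indicator) auto
      show "integrable lebesgue (\<lambda>x. indicat_real (A n) x *\<^sub>R \<bar>\<phi>s (\<rho> n) x - \<phi> x\<bar>)"
        using si by (simp add: set_integrable_def)
    qed (auto simp: indicator_def A_def E_set_def)
    also have "\<dots> = (LINT x|lebesgue_on (A n). \<bar>\<phi>s (\<rho> n) x - \<phi> x\<bar>)"
      using A_leb by (simp add: integral_restrict_space)
    finally show ?thesis .
  qed
  \<comment> \<open>The measure is \<open>O(e n)\<close> and \<open>bbar (e n)\<close> is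
    \<open>o(e n powr (- \<kappa>))\<close>. Since \<open>\<kappa> \<le> 1\<close> and eventually
    \<open>e n < 1\<close>, the former is also \<open>O(e n powr \<kappa>)\<close>, and the powers
    cancel in the product.\<close>
  have small: "(\<lambda>n. bbar (e n) * measure ?M (A n)) \<longlonglongrightarrow> 0"
  proof -
    have kappa_le: "\<kappa> \<le> 1" using kappa dim by (auto split: if_splits)
    obtain C where C: "C > 0" "\<forall>\<^sub>F n in sequentially.
        norm (LINT x|lebesgue_on (?E \<inter> {x. \<phi>s n x < 0}). \<bar>\<phi>s n x - \<phi> x\<bar>) \<le> C * norm (eps n)"
      using phis_rate by (auto elim!: landau_o.bigE)
    have AC: "\<forall>\<^sub>F n in sequentially. measure ?M (A n) \<le> C * e n"
      using eventually_subseq[OF \<rho>(1) C(2)]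
    proof eventually_elim
      case (elim n)
      then show ?case using A_measure[of n] e(1)[of n] by (simp add: A_def e_def)
    qed
    have "((\<lambda>\<epsilon>. bbar \<epsilon> / \<epsilon> powr (- \<kappa>)) \<longlongrightarrow> 0) (at_right 0)"
      using bbar_rate by (rule smalloD_tendsto)
    from filterlim_compose[OF this e_right]
    have rate: "(\<lambda>n. C * (bbar (e n) / e n powr (- \<kappa>))) \<longlonglongrightarrow> 0"
      using tendsto_mult_left[of _ 0 _ C] by fastforce
    have "\<forall>\<^sub>F n in sequentially. e n < 1" using order_tendstoD(2)[OF e(2), of 1] by simp
    with AC have "\<forall>\<^sub>F n in sequentially. norm (bbar (e n) * measure ?M (A n)) \<le> C * (bbar (e n) / e n powr (- \<kappa>))"
    proof eventually_elim
      case (elim n)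
      have bb: "0 \<le> bbar (e n)" using b_range[OF e(1), of 0 n] by simp
      have "e n powr 1 \<le> e n powr \<kappa>" using elim e(1)[of n] kappa_le by (intro powr_mono') auto
      then have "e n \<le> e n powr \<kappa>" using e(1)[of n] by simp
      then have "measure ?M (A n) \<le> C * e n powr \<kappa>"
        using elim C(1) by (meson mult_left_mono less_imp_le order_trans)
      then have "bbar (e n) * measure ?M (A n) \<le> bbar (e n) * (C * e n powr \<kappa>)"
        using bb by (rule mult_left_mono)
      then show ?case using bb by (simp add: powr_minus field_simps)
    qed
    then show ?thesis by (rule Lim_null_comparison[OF _ rate])
  qed

  \<comment> \<open>Vanishing penalty of bounded competitors\<close>
  have recovery: "(\<lambda>n. weighted \<Omega> (q n) \<eta> \<eta>) \<longlonglongrightarrow> 0"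
    if \<eta>: "\<eta> \<in> V_space \<Omega> \<phi>" "\<And>x. \<bar>\<eta> x\<bar> \<le> M" for \<eta> M
  \<comment> \<open>Where \<open>\<eta>\<close> is nonzero, \<open>\<phi> = 1\<close>; there
    continuity of \<open>b0\<close> at 1, \<open>b0 1 = 0\<close> and the bound of the coefficients
    by \<open>b0\<close> make the weights tend to 0. Off \<open>A n\<close> the phase field is
    nonnegative, so monotonicity bounds the weights by \<open>b0 0\<close>, which is finite.\<close>
  proof (rule weighted_recovery[OF q _ \<eta>(2), where A = A and K = "\<lambda>n. bbar (e n)" and B = "enn2real (b0 0)"])
    have supp: "AE x in ?M. x \<notin> ?E \<longrightarrow> \<eta> x = 0" using \<eta>(1) by (simp add: V_space_def)
    show "\<eta> \<in> L2 \<Omega>" using \<eta>(1) by (auto simp: V_space_def intro: H1_L2 H10_H1)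
    show "AE x in ?M. \<eta> x \<noteq> 0 \<longrightarrow> (\<lambda>n. q n x) \<longlonglongrightarrow> 0"
      using supp lim\<phi> range\<phi>
    proof eventually_elim
      case (elim x)
      show ?case
      proof
        assume "\<eta> x \<noteq> 0"
        then have "\<phi> x = 1" using elim(1) by (auto simp: E_set_def)
        then have "(\<lambda>n. b0 (\<phi>s (\<rho> n) x)) \<longlonglongrightarrow> b0 1"
          using elim(2,3) by (intro continuous_within_tendsto_compose[OF b0_continuous]) auto
        then have "(\<lambda>n. b0 (\<phi>s (\<rho> n) x)) \<longlonglongrightarrow> 0" by (simp add: b0_one)
        then have "(\<lambda>n. ennreal (q n x)) \<longlonglongrightarrow> 0"
        proof (rule tendsto_sandwich[OF _ _ tendsto_const, rotated 2])
          show "\<forall>\<^sub>F n in sequentially. ennreal (q n x) \<le> b0 (\<phi>s (\<rho> n) x)"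
            using b0_bound[OF e(1)] elim(3) by (auto simp: q_def)
        qed simp
        then show "(\<lambda>n. q n x) \<longlonglongrightarrow> 0"
          using b_range[OF e(1)] elim(3) ennreal_tendsto_0_iff[of "\<lambda>n. q n x"] by (auto simp: q_def)
      qed
    qed
    show "AE x in ?M. \<eta> x \<noteq> 0 \<longrightarrow> x \<notin> A n \<longrightarrow> q n x \<le> enn2real (b0 0)" for n
      using supp range\<phi>
    proof eventually_elim
      case (elim x)
      show ?case
      proof (intro impI)
        assume "\<eta> x \<noteq> 0" "x \<notin> A n"
        then have ge: "0 \<le> \<phi>s (\<rho> n) x" using elim(1) by (auto simp: A_def)
        have "q n x \<le> b (e n) 0"
          using ge elim(2) unfolding q_def by (intro b_antimono[OF e(1)]) auto
        also have "b (e n) 0 \<le> enn2real (b0 0)"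
          using b0_bound[OF e(1), of 0 n] b0_finite b_range[OF e(1), of 0 n]
          by (metis enn2real_ennreal enn2real_mono atLeastAtMost_iff infinity_ennreal_def neg_le_0_iff_le zero_le_one)
        finally show "q n x \<le> enn2real (b0 0)" .
      qed
    qed
    show "AE x in ?M. q n x \<le> bbar (e n)" for n
      using range\<phi> by eventually_elim (use b_range[OF e(1)] in \<open>auto simp: q_def\<close>)
  qed (rule A_sets A_fin small)+

  \<comment> \<open>Limits of bounded penalty vanish off
    \<open>E_set \<Omega> \<phi>\<close>\<close>
  have barrier: "u \<in> V_space \<Omega> \<phi>"
    if r: "strict_mono r" and f: "\<And>n. f n \<in> H10 \<Omega>" "u \<in> H10 \<Omega>"
      "\<And>n. weighted \<Omega> (q (r n)) (f n) (f n) \<le> C" "L2_tendsto \<Omega> f u" for r f u C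
  proof -
    have L: "f n \<in> L2 \<Omega>" "u \<in> L2 \<Omega>" for n using f H10_H1 H1_L2 by blast+
    \<comment> \<open>Up to a null set, \<open>\<phi> = -1\<close> is the complement of
      \<open>E_set \<Omega> \<phi>\<close> in \<open>\<Omega>\<close>, so it suffices that
      \<open>h\<close> has integral 0.\<close>
    define h where "h x = (if \<phi> x = -1 then (u x)\<^sup>2 else 0)" for x
    have int_h: "integrable ?M h"
    proof (rule Bochner_Integration.integrable_bound[OF L2_integrable_square[OF L(2)]])
      show "h \<in> borel_measurable ?M" unfolding h_def using L2_measurable[OF L(2)] by measurable
    qed (auto simp: h_def)
    have h_nonneg: "0 \<le> h x" for x by (simp add: h_def)
    have C0: "0 \<le> C"
      using f(3)[of 0] sym_form.nonneg[OF weighted_sym_form[OF q] L(1), of "r 0" 0] by linarith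
    \<comment> \<open>With \<open>\<delta>\<close> fixed, eventually
      \<open>e (r n) < \<delta>\<close>, so \<open>b \<delta>\<close> is a minorant of the weights.
      It converges along the phase fields by continuity, and its limit equals
      \<open>bbar \<delta>\<close> where \<open>\<phi> = -1\<close>.\<close>
    have key: "bbar \<delta> * (LINT x|?M. h x) \<le> C" if \<delta>: "\<delta> > 0" for \<delta>
    proof -
      have bb: "0 \<le> bbar \<delta>" using b_range[OF \<delta>, of 0] by simp
      have fatou: "(\<integral>\<^sup>+x. ennreal (b \<delta> (\<phi> x)) * ennreal ((u x)\<^sup>2) \<partial>?M) \<le> ennreal C"
      proof (rule weighted_lower_semicontinuous[where q = "\<lambda>n. q (r n)" and p = "\<lambda>n x. b \<delta> (\<phi>s (\<rho> (r n)) x)" and f = f])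
        show "(\<lambda>x. b \<delta> (\<phi>s (\<rho> (r n)) x)) \<in> borel_measurable ?M" for n
          using weight[OF \<delta>] by (simp add: bounded_weight_def)
        show "AE x in ?M. (\<lambda>n. b \<delta> (\<phi>s (\<rho> (r n)) x)) \<longlonglongrightarrow> b \<delta> (\<phi> x)"
          using lim\<phi> range\<phi> phi_pm
        proof eventually_elim
          case (elim x)
          have "(\<lambda>n. \<phi>s (\<rho> (r n)) x) \<longlonglongrightarrow> \<phi> x" using LIMSEQ_subseq_LIMSEQ[OF elim(1) r] by (simp add: o_def)
          then show ?case
            using elim(2,3) by (intro continuous_on_tendsto_compose[OF b_continuous[OF \<delta>]]) auto
        qed
        have "(\<lambda>n. e (r n)) \<longlonglongrightarrow> 0" using LIMSEQ_subseq_LIMSEQ[OF e(2) r] by (simp add: o_def)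
        then have "\<forall>\<^sub>F n in sequentially. e (r n) < \<delta>" using \<delta> by (rule order_tendstoD)
        then show "\<forall>\<^sub>F n in sequentially. AE x in ?M. b \<delta> (\<phi>s (\<rho> (r n)) x) \<le> q (r n) x"
        proof eventually_elim
          case (elim n)
          show ?case
            using range\<phi> by eventually_elim (use elim b_mono[OF e(1)] in \<open>auto simp: q_def\<close>)
        qed
      qed (use q L f in auto)
      have "ennreal (bbar \<delta> * h x) \<le> ennreal (b \<delta> (\<phi> x)) * ennreal ((u x)\<^sup>2)" for x
        using b_minus_one[OF \<delta>] bb by (auto simp: h_def ennreal_mult)
      then have "(\<integral>\<^sup>+x. ennreal (bbar \<delta> * h x) \<partial>?M) \<le> ennreal C"
        by (rule order_trans[OF nn_integral_mono fatou])
      moreover have "(\<integral>\<^sup>+x. ennreal (bbar \<delta> * h x) \<partial>?M) = ennreal (bbar \<delta> * (LINT x|?M. h x))"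
        using nn_integral_eq_integral[of ?M "\<lambda>x. bbar \<delta> * h x"] int_h bb h_nonneg by simp
      ultimately show ?thesis using C0 by simp
    qed
    \<comment> \<open>As \<open>bbar\<close> is unbounded near 0, a positive integral would
      contradict \<open>key\<close>; the added 1 in the choice of \<open>\<delta>\<close> makes the
      inequality strict.\<close>
    have "(LINT x|?M. h x) \<le> 0"
    proof (rule ccontr)
      assume "\<not> (LINT x|?M. h x) \<le> 0"
      then have pos: "(LINT x|?M. h x) > 0" by simp
      have "\<forall>\<^sub>F \<delta> in at_right 0. \<delta> > 0 \<and> bbar \<delta> \<ge> C / (LINT x|?M. h x) + 1"
        using bbar_limit unfolding filterlim_at_top
        by (intro eventually_conj) (auto simp: eventually_at_filter)
      then obtain \<delta> where \<delta>: "\<delta> > 0" "bbar \<delta> \<ge> C / (LINT x|?M. h x) + 1"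
        using eventually_happens'[OF trivial_limit_at_right_real] by blast
      have "(C / (LINT x|?M. h x) + 1) * (LINT x|?M. h x) \<le> C"
        using mult_right_mono[OF \<delta>(2), of "LINT x|?M. h x"] pos key[OF \<delta>(1)] by linarith
      then show False using pos by (simp add: distrib_right)
    qed
    then have "(LINT x|?M. h x) = 0"
      using Bochner_Integration.integral_nonneg[of ?M h] h_nonneg by (simp add: order_antisym)
    then have "AE x in ?M. h x = 0"
      using integral_nonneg_eq_0_iff_AE[OF int_h] h_nonneg by simp
    then have "AE x in ?M. x \<notin> ?E \<longrightarrow> u x = 0"
      using phi_pm AE_space[of ?M]
    proof eventually_elim
      case (elim x)
      then show ?case by (auto simp: h_def E_set_def split: if_splits)
    qed
    then show ?thesis using f(2) by (simp add: V_space_def)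
  qed

  \<comment> \<open>Conclusion from the abstract spectral limit\<close>
  interpret P: penalised_limit \<Omega> ?E q "\<lambda>n. w (\<rho> n)" "\<lambda>n. lam (\<rho> n)" "V_space \<Omega> \<phi>" lam0
  proof (rule penalised_limit.intro[OF sobolev_axioms penalised_limit_axioms.intro])
    show "V_space \<Omega> \<phi> = {\<eta> \<in> H10 \<Omega>. AE x in ?M. x \<notin> ?E \<longrightarrow> \<eta> x = 0}"
      by (simp add: V_space_def)
    show "bounded_weight \<Omega> (q n)" for n by (rule q)
    show "dirichlet_spectral \<Omega> (\<lambda>u v. dir \<Omega> u v + weighted \<Omega> (q n) u v) (w (\<rho> n)) (lam (\<rho> n))" for n
    proof (rule dirichlet_spectral_weighted[OF q w(1) wH])
      show "mono (lam (\<rho> n))" using lam by (simp add: eigenvalue_sequence_def)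
      fix j v assume "v \<in> H10 \<Omega>"
      then show "dir \<Omega> (w (\<rho> n) j) v + weighted \<Omega> (q n) (w (\<rho> n) j) v = lam (\<rho> n) j * ip \<Omega> (w (\<rho> n) j) v"
        using w(2)[of "\<rho> n" j]
        by (simp add: eigenfunction_def eigenspace_def diffuse_form_eq L2_inner_eq_ip q_def[abs_def] e_def)
    qed
    show "eigenvalue_sequence \<Omega> (V_space \<Omega> \<phi>) (dir \<Omega>) lam0" by (rule lam0)
    show "(\<lambda>n. weighted \<Omega> (q n) \<eta> \<eta>) \<longlonglongrightarrow> 0"
      if "\<eta> \<in> V_space \<Omega> \<phi>" "\<And>x. \<bar>\<eta> x\<bar> \<le> M" for \<eta> M
      by (rule recovery[OF that])
    show "u \<in> V_space \<Omega> \<phi>"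
      if "strict_mono r" "\<And>n. f n \<in> H10 \<Omega>" "u \<in> H10 \<Omega>"
        "\<And>n. weighted \<Omega> (q (r n)) (f n) (f n) \<le> C" "L2_tendsto \<Omega> f u"
      for r f u C
      by (rule barrier[OF that])
  qed
  obtain u r where ur: "strict_mono (r :: nat \<Rightarrow> nat)" "u \<in> eigenspace \<Omega> (V_space \<Omega> \<phi>) (dir \<Omega>) (lam0 k)"
    "ip \<Omega> u u = 1"
    "(\<lambda>n. weighted \<Omega> (q (r n)) (w (\<rho> (r n)) k) (w (\<rho> (r n)) k)) \<longlonglongrightarrow> 0"
    "(\<lambda>n. H1_norm \<Omega> (\<lambda>x. w (\<rho> (r n)) k x - u x)) \<longlonglongrightarrow> 0"
    "(\<lambda>n. lam (\<rho> (r n)) k) \<longlonglongrightarrow> lam0 k"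
    using P.spectral_convergence[of k] by blast
  have uV: "u \<in> V_space \<Omega> \<phi>" using ur(2) by (simp add: eigenspace_def)
  have "\<not> (AE x in ?M. u x = 0)"
  proof
    assume "AE x in ?M. u x = 0"
    then have "ip \<Omega> u u = ip \<Omega> (\<lambda>x. 0 :: real) (\<lambda>x. 0)"
      using P.V_H10(3)[OF uV] L2_zero by (intro ip_cong_AE) auto
    then show False using ur(3) by (simp add: ip_def)
  qed
  then have eigen: "eigenfunction \<Omega> (V_space \<Omega> \<phi>) (dir \<Omega>) (lam0 k) u"
    using ur(2) by (simp add: eigenfunction_def)
  \<comment> \<open>On \<open>E_set \<Omega> \<phi>\<close> the factor \<open>b0 1\<close> is 0. Off
    it \<open>u\<close> vanishes, and the product is 0 even if \<open>b0\<close> is infinite there,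
    by the convention that infinity times 0 is 0 in \<open>ennreal\<close>.\<close>
  have zero: "(\<integral>\<^sup>+ x. b0 (\<phi> x) * ennreal ((u x)\<^sup>2) \<partial>?M) = 0"
  proof -
    have "AE x in ?M. x \<notin> ?E \<longrightarrow> u x = 0" using uV by (simp add: V_space_def)
    then have "AE x in ?M. b0 (\<phi> x) * ennreal ((u x)\<^sup>2) = 0"
      by eventually_elim (auto simp: E_set_def b0_one)
    then have "(\<integral>\<^sup>+ x. b0 (\<phi> x) * ennreal ((u x)\<^sup>2) \<partial>?M) = (\<integral>\<^sup>+ x. 0 \<partial>?M)"
      by (rule nn_integral_cong_AE)
    then show ?thesis by simp
  qed
  have "(\<lambda>n. ennreal (weighted \<Omega> (q (r n)) (w (\<rho> (r n)) k) (w (\<rho> (r n)) k))) \<longlonglongrightarrow> ennreal 0"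
    by (rule tendsto_ennrealI[OF ur(4)])
  then have "(\<lambda>n. \<integral>\<^sup>+ x. ennreal (b (eps (\<rho> (r n))) (\<phi>s (\<rho> (r n)) x)) * ennreal ((w (\<rho> (r n)) k x)\<^sup>2) \<partial>?M) \<longlonglongrightarrow> 0"
    using nn_integral_weighted[OF q H1_L2[OF H10_H1[OF wH]]] by (simp add: q_def e_def)
  then show ?thesis
    using eigen zero ur(5,6) strict_mono_o[OF \<rho>(1) ur(1)]
    by (intro exI[of _ u] exI[of _ "\<rho> \<circ> r"]) (simp add: o_def)
qed

end
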